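(* Let $(X_n : n \in \mathbb{N})$ be a sequence of continuous mappings defined on $\mathbb{R}$ with values in $\operatorname{GL}(2, \mathbb{R})$ that converges uniformly on a compact set $K$ to the mapping $\mathcal{X}$ with $\operatorname{discr} \mathcal{X}(x) \neq 0$ and $\det \mathcal{X}(x) > 0$ for each $x \in K$. If $\operatorname{discr} \mathcal{X} > 0$, we additionally assume that for all $x \in K$, $$\big|[\mathcal{X}(x)]_{1,1} - \lambda_1(x)\big| > 0 \quad\text{and}\quad \big|[\mathcal{X}(x)]_{2,2} - \lambda_2(x)\big| > 0,$$ where $\lambda_1$ and $\lambda_2$ are continuous functions on $K$ so that $\lambda_1(x)$ and $\lambda_2(x)$ are eigenvalues of $\mathcal{X}(x)$. Let $(E_n : n \in \mathbb{N})$ be a sequence of continuous mappings defined on $\mathbb{R}$ with values in $\operatorname{Mat}(2, \mathbb{C})$ such that $$\sum_{n = 1}^\infty \sup_{K}\| E_n\| < \infty.$$ If $(X_n : n \in \mathbb{N})$ belongs to $\mathcal{D}_{r, 0}\big(K, \operatorname{GL}(2, \mathbb{R}) \big)$ for a certain $r \geq 1$ and $\eta$ is a continuous eigenvalue of $\mathcal{X}$, then there are continuous mappings $\Phi_n: K \rightarrow \mathbb{C}^2$, $\mu_n: K \rightarrow \mathbb{C}$, and $v : K \rightarrow \mathbb{C}^2$, satisfying $$\Phi_{n+1} = (X_n + E_n)\Phi_n$$ and $$\lim_{n \to \infty} \sup_{x \in K}|\mu_n(x) - \eta(x)| = 0,$$ such that $$\lim_{n \to \infty} \sup_{x \in K}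 \bigg\| \frac{\Phi_n(x)}{\prod_{j=1}^{n-1} \mu_j(x)} - v(x) \bigg\| = 0,$$ where $v(x)$ is an eigenvector of $\mathcal{X}(x)$ corresponding to $\eta(x)$ for each $x \in K$.
   Context: Here $K\subset\mathbb{R}$. For a real $2\times2$ matrix $X$, $\operatorname{discr}X=(\operatorname{tr}X)^2-4\det X$, and $[X]_{i,j}$ denotes its $(i,j)$ entry. $\operatorname{Mat}(2,\mathbb{C})$ and $\operatorname{Mat}(2,\mathbb{R})$ are the spaces of $2\times 2$ complex and real matrices with the operator norm, and $\operatorname{GL}(2,\mathbb{R})$ is the set of invertible matrices in $\operatorname{Mat}(2,\mathbb{R})$. A continuous eigenvalue of $\mathcal{X}$ is a continuous function $\eta$ on $K$ such that $\eta(x)$ is an eigenvalue of $\mathcal{X}(x)$ for each $x\in K$. For a normed space $V$ and an integer $r\ge1$, a sequence $(x_n:n\in\mathbb{N})$ in $V$ belongs to $\mathcal{D}_{r,0}(V)$ if it is bounded and $\sum_{n=1}^\infty\|\Delta^jx_n\|^{r/j}<\infty$ for each $j\in\{1,\ldots,r\}$, where $\Delta^0x_n=x_n$ and $\Delta^jx_n=\Delta^{j-1}x_{n+1}-\Delta^{j-1}x_n$ for $j\ge1$. $\mathcal{D}_{r,0}(K,\operatorname{GL}(2,\mathbb{R}))$ consists of sequences of continuous maps $K\to\operatorname{GL}(2,\mathbb{R})$ that belong to $\mathcal{D}_{r,0}(V)$ with $V$ the space of continuous maps $K\to\operatorname{Mat}(2,\mathbb{R})$ equipped with the supremum norm.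
   Formalization: The recurrence Φ_{n+1} = (X_n+E_n)Φ_n is claimed only for n ≥ N, with N = 1 if all X_n+E_n are invertible on K; for all n it fails when X_n+E_n may be singular (E_1 = −X_1, E_n = 0 for n ≥ 2 forces v = 0). *)

theory Defs
  imports "HOL-Analysis.Analysis" "HOL-Library.Function_Algebras"
begin

definition discr :: "real^2^2 \<Rightarrow> real" where
  "discr A = (trace A)\<^sup>2 - 4 * det A"

abbreviation cmat :: "real^2^2 \<Rightarrow> complex^2^2" where
  "cmat \<equiv> map_matrix complex_of_real"

definition is_eigenvector :: "complex^2^2 \<Rightarrow> complex \<Rightarrow> complex^2 \<Rightarrow> bool" where
  "is_eigenvector A c v \<longleftrightarrow> v \<noteq> 0 \<and> A *v v = c *s v"

definition is_eigenvalue :: "complex^2^2 \<Rightarrow> complex \<Rightarrow> bool" where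
  "is_eigenvalue A c \<longleftrightarrow> (\<exists>v. is_eigenvector A c v)"

definition continuous_eigenvalue ::
    "real set \<Rightarrow> (real \<Rightarrow> real^2^2) \<Rightarrow> (real \<Rightarrow> complex) \<Rightarrow> bool" where
  "continuous_eigenvalue K \<X> \<eta> \<longleftrightarrow>
     continuous_on K \<eta> \<and> (\<forall>x\<in>K. is_eigenvalue (cmat (\<X> x)) (\<eta> x))"

(* The norm that the type real^2^2 (or complex^2^2) carries by default is the Frobenius norm. *)
definition opnorm :: "'a::real_normed_field^2^2 \<Rightarrow> real" where
  "opnorm A = onorm ((*v) A)"

(* Supremum over K of a nonnegative function; inserting 0 changes nothing unless K is empty,
   in which case the supremum is 0 rather than unspecified. *)
definition sup_on :: "real set \<Rightarrow> (real \<Rightarrow> real) \<Rightarrow> real" where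
  "sup_on K f = Sup (insert 0 (f ` K))"

primrec fdiff :: "nat \<Rightarrow> (nat \<Rightarrow> 'v::ab_group_add) \<Rightarrow> nat \<Rightarrow> 'v" where
  "fdiff 0 x n = x n"
| "fdiff (Suc j) x n = fdiff j x (Suc n) - fdiff j x n"

(* The norm N is a parameter, because the space of continuous maps on a set K is not a type.
   Sequences are indexed by n \<ge> 1; the value at 0 is ignored. *)
definition D_r0 :: "('v::ab_group_add \<Rightarrow> real) \<Rightarrow> nat \<Rightarrow> (nat \<Rightarrow> 'v) \<Rightarrow> bool" where
  "D_r0 N r x \<longleftrightarrow>
     (\<exists>B. \<forall>n\<ge>1. N (x n) \<le> B) \<and>
     (\<forall>j\<in>{1..r}. summable (\<lambda>n. N (fdiff j x (Suc n)) powr (real r / real j)))"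

(* Here fdiff uses the pointwise subtraction of functions from Function_Algebras. *)
definition D_r0_GL2 :: "nat \<Rightarrow> real set \<Rightarrow> (nat \<Rightarrow> real \<Rightarrow> real^2^2) \<Rightarrow> bool" where
  "D_r0_GL2 r K X \<longleftrightarrow>
     (\<forall>n\<ge>1. continuous_on K (X n) \<and> (\<forall>x\<in>K. invertible (X n x))) \<and>
     D_r0 (\<lambda>F. sup_on K (\<lambda>x. opnorm (F x))) r X"

end

theory Submission
  imports Defs
begin

text \<open>
  Everything reduces to finding directions \<open>\<phi> n\<close> and multipliers \<open>\<mu> n\<close>, continuous on \<open>K\<close> and
  uniformly convergent, with \<open>(X n + E n) \<phi> n = \<mu> n \<phi> (n + 1)\<close>, where \<open>\<mu> n\<close> tends to \<open>\<eta>\<close> and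
  \<open>\<phi> n\<close> to a limit that is nowhere zero. Then \<open>\<Phi> n\<close> is the product of the earlier multipliers times
  \<open>\<phi> n\<close>, and \<open>\<Phi> n\<close> divided by this product is \<open>\<phi> n\<close> itself. This is the predicate
  \<open>has_direction\<close>; the step from it to the theorem is \<open>solution_from_direction\<close>. The predicate can be
  glued over disjoint closed pieces of \<open>K\<close>, so the pieces where the discriminant is negative, and
  those where it is positive and \<open>\<eta>\<close> is the eigenvalue of larger, or of smaller, modulus are treated
  separately.

  Suppose that \<open>u n\<close> and \<open>w n\<close> form a basis of approximate eigendirections, mapped to multiples of
  \<open>u (n + 1)\<close> and \<open>w (n + 1)\<close> up to small errors. The direction \<open>u n + y n w n\<close> is preserved if the
  scalars \<open>y n\<close> satisfy a Riccati recursion, which is a small perturbation of the multiplication by a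
  quotient of multipliers. A solution that tends to zero is obtained by running the recursion forward
  if this multiplication contracts, and by solving it from infinity if its inverse contracts
  or is an isometry; in the last case the errors have to be summable. This is
  \<open>has_direction_almost_diagonal\<close>.

  If the discriminant is positive, then the two eigenvalues of the limit, being real with a positive
  product, have different moduli. Errors that tend to zero then suffice, and eigenvectors of the
  limit serve as the basis.

  If the discriminant is negative, then the eigenvalues are complex conjugate and have equal moduli,
  so the errors must be summable, and here the class \<open>D_r0\<close> enters. A direction \<open>(1, t n)\<close> is mapped
  exactly to a multiple of \<open>(1, t (n + 1))\<close> if \<open>t\<close> satisfies a scalar Riccati recursion
  with coefficients from \<open>X n\<close>. The slopes of the eigenvectors of \<open>X n\<close> satisfy it up to a defect
  of the size of the first differences of \<open>X n\<close>. A Newton step improves the defect by one order,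
  from products of differences of total order \<open>k\<close> to total order \<open>k + 1\<close>; at the order \<open>r\<close> it is
  summable (\<open>approximate_riccati_solution\<close>). As \<open>X n\<close> is real, \<open>(1, cnj (t n))\<close> is a second
  direction, and its multiplier is the conjugate of the first one, hence of exactly the same modulus.
\<close>

section \<open>Uniformly convergent sequences of continuous functions\<close>

text \<open>Continuity is demanded only from some index on: quotients and square roots of the
  sequences below make sense only once the sequences are close to their limits.\<close>

definition unif_conv ::
    "'a::topological_space set \<Rightarrow> (nat \<Rightarrow> 'a \<Rightarrow> 'b::real_normed_field) \<Rightarrow> ('a \<Rightarrow> 'b) \<Rightarrow> bool" where
  "unif_conv K f l \<longleftrightarrow>
     (\<forall>\<^sub>F n in sequentially. continuous_on K (f n)) \<and> uniform_limit K f l sequentially"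

lemma unif_conv_continuous_limit:
  assumes "unif_conv K f l" shows "continuous_on K l"
  using assms uniform_limit_theorem[of K f sequentially l] by (auto simp: unif_conv_def)

lemma unif_convD:
  assumes "unif_conv K f l" "e > 0"
  shows "\<forall>\<^sub>F n in sequentially. \<forall>x\<in>K. dist (f n x) (l x) < e"
  using assms by (auto simp: unif_conv_def uniform_limit_iff)

lemma unif_conv_const:
  assumes "continuous_on K l" shows "unif_conv K (\<lambda>_. l) l"
  using assms uniform_limit_const by (auto simp: unif_conv_def)

lemma unif_conv_add:
  assumes "unif_conv K f l" "unif_conv K g m"
  shows "unif_conv K (\<lambda>n x. f n x + g n x) (\<lambda>x. l x + m x)"
  using assms unfolding unif_conv_def
  by (auto intro!: uniform_limit_intros elim: eventually_elim2 intro: continuous_on_add)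

lemma unif_conv_diff:
  assumes "unif_conv K f l" "unif_conv K g m"
  shows "unif_conv K (\<lambda>n x. f n x - g n x) (\<lambda>x. l x - m x)"
  using assms unfolding unif_conv_def
  by (auto intro!: uniform_limit_intros elim: eventually_elim2 intro: continuous_on_diff)

lemma unif_conv_uminus:
  assumes "unif_conv K f l"
  shows "unif_conv K (\<lambda>n x. - f n x) (\<lambda>x. - l x)"
  using unif_conv_diff[OF unif_conv_const[of K "\<lambda>_. 0"] assms] by simp

lemma bounded_image_continuous:
  fixes l :: "'a::topological_space \<Rightarrow> 'b::real_normed_field"
  assumes "compact K" "continuous_on K l" shows "bounded (l ` K)"
  using assms by (intro compact_imp_bounded compact_continuous_image)

lemma unif_conv_mult:
  assumes "compact K" "unif_conv K f l" "unif_conv K g m"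
  shows "unif_conv K (\<lambda>n x. f n x * g n x) (\<lambda>x. l x * m x)"
proof -
  have "\<forall>\<^sub>F n in sequentially. continuous_on K (\<lambda>x. f n x * g n x)"
    using assms(2,3) unfolding unif_conv_def by (auto elim: eventually_elim2 intro: continuous_on_mult)
  moreover have "uniform_limit K (\<lambda>n x. f n x * g n x) (\<lambda>x. l x * m x) sequentially"
    using assms unif_conv_continuous_limit
    by (intro uniform_lim_mult bounded_image_continuous) (auto simp: unif_conv_def)
  ultimately show ?thesis by (simp add: unif_conv_def)
qed

lemma nonvanishing_bounded_below:
  fixes l :: "'a::topological_space \<Rightarrow> 'b::real_normed_field"
  assumes "compact K" "continuous_on K l" "\<And>x. x \<in> K \<Longrightarrow> l x \<noteq> 0"
  shows "\<exists>c>0. \<forall>x\<in>K. c \<le> norm (l x)"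
proof (cases "K = {}")
  case False
  obtain x where "x \<in> K" "\<forall>y\<in>K. norm (l x) \<le> norm (l y)"
    using continuous_attains_inf[OF assms(1) False continuous_on_norm[OF assms(2)]] by auto
  then show ?thesis using assms(3)[of x] by (intro exI[of _ "norm (l x)"]) auto
qed (auto intro: exI[of _ 1])

lemma unif_conv_bounded_below:
  assumes "compact K" "unif_conv K f l" "\<And>x. x \<in> K \<Longrightarrow> l x \<noteq> 0"
  shows "\<exists>c>0. \<forall>\<^sub>F n in sequentially. \<forall>x\<in>K. c \<le> norm (f n x)"
proof -
  obtain c where c: "c > 0" "\<forall>x\<in>K. c \<le> norm (l x)"
    using nonvanishing_bounded_below[OF assms(1) unif_conv_continuous_limit[OF assms(2)] assms(3)] by auto
  have "\<forall>\<^sub>F n in sequentially. \<forall>x\<in>K. dist (f n x) (l x) < c / 2"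
    using unif_convD[OF assms(2) half_gt_zero[OF c(1)]] .
  then have "\<forall>\<^sub>F n in sequentially. \<forall>x\<in>K. c / 2 \<le> norm (f n x)"
  proof eventually_elim
    case (elim n)
    show ?case
    proof
      fix x assume "x \<in> K"
      then have "norm (l x) \<le> norm (f n x) + dist (f n x) (l x)"
        by (metis dist_commute dist_norm norm_triangle_sub)
      then show "c / 2 \<le> norm (f n x)" using elim c(2) \<open>x \<in> K\<close> by (smt (verit) field_sum_of_halves)
    qed
  qed
  with c(1) show ?thesis by (intro exI[of _ "c / 2"]) auto
qed

lemma unif_conv_nonzero:
  assumes "compact K" "unif_conv K f l" "\<And>x. x \<in> K \<Longrightarrow> l x \<noteq> 0"
  shows "\<forall>\<^sub>F n in sequentially. \<forall>x\<in>K. f n x \<noteq> 0"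
proof -
  obtain c where "c > 0" "\<forall>\<^sub>F n in sequentially. \<forall>x\<in>K. c \<le> norm (f n x)"
    using unif_conv_bounded_below[OF assms] by blast
  from this(2) show ?thesis by eventually_elim (use \<open>c > 0\<close> in force)
qed

lemma unif_conv_bounded:
  assumes "compact K" "unif_conv K f l"
  shows "\<exists>B>0. \<forall>\<^sub>F n in sequentially. \<forall>x\<in>K. norm (f n x) \<le> B"
proof -
  obtain B where B: "\<And>x. x \<in> K \<Longrightarrow> norm (l x) \<le> B"
    using bounded_image_continuous[OF assms(1) unif_conv_continuous_limit[OF assms(2)]]
    by (auto simp: bounded_iff)
  have "\<forall>\<^sub>F n in sequentially. \<forall>x\<in>K. dist (f n x) (l x) < 1"
    using assms(2) by (auto simp: unif_conv_def uniform_limit_iff)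
  then have "\<forall>\<^sub>F n in sequentially. \<forall>x\<in>K. norm (f n x) \<le> \<bar>B\<bar> + 1"
  proof eventually_elim
    case (elim n)
    show ?case
    proof
      fix x assume "x \<in> K"
      then have "norm (f n x) \<le> norm (l x) + dist (f n x) (l x)"
        by (metis dist_norm norm_triangle_sub)
      then show "norm (f n x) \<le> \<bar>B\<bar> + 1" using elim B \<open>x \<in> K\<close> by (smt (verit))
    qed
  qed
  then show ?thesis by (intro exI[of _ "\<bar>B\<bar> + 1"]) auto
qed

lemma unif_conv_inverse:
  assumes "compact K" "unif_conv K f l" "\<And>x. x \<in> K \<Longrightarrow> l x \<noteq> 0"
  shows "unif_conv K (\<lambda>n x. inverse (f n x)) (\<lambda>x. inverse (l x))"
proof -
  obtain c where "c > 0" and c: "\<forall>\<^sub>F n in sequentially. \<forall>x\<in>K. c \<le> norm (f n x)"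
    using unif_conv_bounded_below[OF assms] by auto
  have "\<forall>\<^sub>F n in sequentially. continuous_on K (f n)"
    using assms(2) by (simp add: unif_conv_def)
  with c have "\<forall>\<^sub>F n in sequentially. continuous_on K (\<lambda>x. inverse (f n x))"
    by eventually_elim (use \<open>c > 0\<close> in \<open>force intro!: continuous_on_inverse\<close>)
  moreover obtain b where "b > 0" "\<forall>x\<in>K. b \<le> norm (l x)"
    using nonvanishing_bounded_below[OF assms(1) unif_conv_continuous_limit[OF assms(2)] assms(3)] by auto
  then have "uniform_limit K (\<lambda>n x. inverse (f n x)) (\<lambda>x. inverse (l x)) sequentially"
    using assms(2) 
    by (intro uniform_lim_inverse[where b = b, unfolded o_def]) (auto simp: unif_conv_def)
  ultimately show ?thesis by (simp add: unif_conv_def)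
qed

lemma unif_conv_divide:
  assumes "compact K" "unif_conv K f l" "unif_conv K g m" "\<And>x. x \<in> K \<Longrightarrow> m x \<noteq> 0"
  shows "unif_conv K (\<lambda>n x. f n x / g n x) (\<lambda>x. l x / m x)"
  using unif_conv_mult[OF assms(1,2) unif_conv_inverse[OF assms(1,3,4)]]
  by (simp add: divide_inverse)

lemma unif_conv_bounded_linear:
  assumes "bounded_linear h" "unif_conv K f l"
  shows "unif_conv K (\<lambda>n x. h (f n x)) (\<lambda>x. h (l x))"
  using assms bounded_linear.uniform_limit[OF assms(1)] unfolding unif_conv_def
  by (auto elim!: eventually_mono intro: bounded_linear.continuous_on)

lemmas unif_conv_cnj = unif_conv_bounded_linear[OF bounded_linear_cnj]
lemmas unif_conv_of_real = unif_conv_bounded_linear[OF bounded_linear_of_real]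

lemma unif_conv_Suc:
  assumes "unif_conv K f l" shows "unif_conv K (\<lambda>n. f (Suc n)) l"
proof -
  have "filterlim Suc sequentially sequentially"
    by (rule filterlim_Suc)
  then have "uniform_limit K (\<lambda>n. f (Suc n)) l sequentially"
    using assms filterlim_compose[of f _ sequentially Suc] by (auto simp: unif_conv_def)
  moreover have "\<forall>\<^sub>F n in sequentially. continuous_on K (f (Suc n))"
    using assms eventually_sequentially_Suc[of "\<lambda>n. continuous_on K (f n)"] by (auto simp: unif_conv_def)
  ultimately show ?thesis by (simp add: unif_conv_def)
qed

lemma unif_conv_cong:
  assumes "\<forall>\<^sub>F n in sequentially. \<forall>x\<in>K. f n x = g n x" "\<And>x. x \<in> K \<Longrightarrow> l x = m x" "unif_conv K g m"
  shows "unif_conv K f l"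
proof -
  have "\<forall>\<^sub>F n in sequentially. continuous_on K (f n)"
    using assms(1) assms(3)[unfolded unif_conv_def, THEN conjunct1]
    by eventually_elim (simp cong: continuous_on_cong)
  moreover have "uniform_limit K f l sequentially"
    using assms uniform_limit_cong[of K f g sequentially l m] by (simp add: unif_conv_def)
  ultimately show ?thesis by (simp add: unif_conv_def)
qed

lemma unif_conv_limit_unique:
  assumes "unif_conv K f l" "unif_conv K f m" "x \<in> K" shows "l x = m x"
  using assms unfolding unif_conv_def by (meson LIMSEQ_unique tendsto_uniform_limitI)

lemma unif_conv_subset:
  assumes "unif_conv K f l" "L \<subseteq> K" shows "unif_conv L f l"
  using assms unfolding unif_conv_def
  by (auto elim!: eventually_mono intro: continuous_on_subset uniform_limit_on_subset)

text \<open>Disjoint closed sets do not touch, so continuity survives the gluing. In this way the different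
  spectral types are treated separately.\<close>

lemma unif_conv_glue:
  assumes "closed A" "closed B" "A \<inter> B = {}" "unif_conv A f l" "unif_conv B g m"
  shows "unif_conv (A \<union> B) (\<lambda>n x. if x \<in> A then f n x else g n x) (\<lambda>x. if x \<in> A then l x else m x)"
    (is "unif_conv _ ?h ?k")
proof -
  have A: "unif_conv A ?h ?k"
    by (rule unif_conv_cong[OF _ _ assms(4)]) auto
  have B: "unif_conv B ?h ?k"
    by (rule unif_conv_cong[OF _ _ assms(5)])
      (use assms(3) in \<open>auto intro!: always_eventually\<close>)
  from A B have "\<forall>\<^sub>F n in sequentially. continuous_on A (?h n)"
    "\<forall>\<^sub>F n in sequentially. continuous_on B (?h n)" unfolding unif_conv_def by blast+
  then have "\<forall>\<^sub>F n in sequentially. continuous_on (A \<union> B) (?h n)"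
    by eventually_elim (rule continuous_on_closed_Un[OF assms(1,2)])
  with A B show ?thesis unfolding unif_conv_def by (auto intro: uniform_limit_on_Un)
qed

section \<open>Domination by a scalar sequence\<close>

definition dominated :: "'a set \<Rightarrow> (nat \<Rightarrow> real) \<Rightarrow> (nat \<Rightarrow> 'a \<Rightarrow> 'b::real_normed_field) \<Rightarrow> bool" where
  "dominated K \<sigma> f \<longleftrightarrow> (\<exists>C. \<forall>\<^sub>F n in sequentially. \<forall>x\<in>K. norm (f n x) \<le> C * \<sigma> n)"

lemma dominatedI:
  assumes "\<forall>\<^sub>F n in sequentially. \<forall>x\<in>K. norm (f n x) \<le> C * \<sigma> n"
  shows "dominated K \<sigma> f"
  using assms by (auto simp: dominated_def)

lemma dominatedE:
  assumes "dominated K \<sigma> f" "\<And>n. \<sigma> n \<ge> 0"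
  obtains C where "C > 0" "\<forall>\<^sub>F n in sequentially. \<forall>x\<in>K. norm (f n x) \<le> C * \<sigma> n"
proof -
  obtain C where C: "\<forall>\<^sub>F n in sequentially. \<forall>x\<in>K. norm (f n x) \<le> C * \<sigma> n"
    using assms by (auto simp: dominated_def)
  have "\<forall>\<^sub>F n in sequentially. \<forall>x\<in>K. norm (f n x) \<le> (\<bar>C\<bar> + 1) * \<sigma> n"
    using C
  proof eventually_elim
    case (elim n)
    have "C * \<sigma> n \<le> (\<bar>C\<bar> + 1) * \<sigma> n" using assms(2) by (intro mult_right_mono) auto
    with elim show ?case by force
  qed
  with that[of "\<bar>C\<bar> + 1"] show thesis by auto
qed

lemma dominated_add:
  assumes "dominated K \<sigma> f" "dominated K \<sigma> g"
  shows "dominated K \<sigma> (\<lambda>n x. f n x + g n x)"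
proof -
  from assms obtain C D where
    "\<forall>\<^sub>F n in sequentially. \<forall>x\<in>K. norm (f n x) \<le> C * \<sigma> n"
    "\<forall>\<^sub>F n in sequentially. \<forall>x\<in>K. norm (g n x) \<le> D * \<sigma> n" by (auto simp: dominated_def)
  then have "\<forall>\<^sub>F n in sequentially. \<forall>x\<in>K. norm (f n x + g n x) \<le> (C + D) * \<sigma> n"
    by eventually_elim (simp add: distrib_right norm_triangle_mono)
  then show ?thesis by (rule dominatedI)
qed

lemma dominated_uminus:
  assumes "dominated K \<sigma> f" shows "dominated K \<sigma> (\<lambda>n x. - f n x)"
  using assms by (simp add: dominated_def)

lemma dominated_diff:
  assumes "dominated K \<sigma> f" "dominated K \<sigma> g"
  shows "dominated K \<sigma> (\<lambda>n x. f n x - g n x)"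
  using dominated_add[OF assms(1) dominated_uminus[OF assms(2)]] by simp

lemma dominated_mult:
  assumes "dominated K \<sigma> f" "dominated K \<tau> g" "\<And>n. \<sigma> n \<ge> 0" "\<And>n. \<tau> n \<ge> 0"
  shows "dominated K (\<lambda>n. \<sigma> n * \<tau> n) (\<lambda>n x. f n x * g n x)"
proof -
  obtain C where "C > 0" and C: "\<forall>\<^sub>F n in sequentially. \<forall>x\<in>K. norm (f n x) \<le> C * \<sigma> n"
    using dominatedE[OF assms(1,3)] .
  obtain D where "D > 0" and D: "\<forall>\<^sub>F n in sequentially. \<forall>x\<in>K. norm (g n x) \<le> D * \<tau> n"
    using dominatedE[OF assms(2,4)] .
  from C D have "\<forall>\<^sub>F n in sequentially. \<forall>x\<in>K. norm (f n x * g n x) \<le> (C * D) * (\<sigma> n * \<tau> n)"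
  proof eventually_elim
    case (elim n)
    show ?case
    proof
      fix x assume "x \<in> K"
      then have "norm (f n x * g n x) \<le> (C * \<sigma> n) * (D * \<tau> n)"
        unfolding norm_mult using elim \<open>C > 0\<close> assms(3) by (intro mult_mono) auto
      then show "norm (f n x * g n x) \<le> (C * D) * (\<sigma> n * \<tau> n)" by (simp add: mult_ac)
    qed
  qed
  then show ?thesis by (rule dominatedI)
qed

lemma dominated_cong:
  assumes "\<forall>\<^sub>F n in sequentially. \<forall>x\<in>K. f n x = g n x" "dominated K \<sigma> g"
  shows "dominated K \<sigma> f"
proof -
  from assms(2) obtain C where "\<forall>\<^sub>F n in sequentially. \<forall>x\<in>K. norm (g n x) \<le> C * \<sigma> n"
    by (auto simp: dominated_def)
  with assms(1) have "\<forall>\<^sub>F n in sequentially. \<forall>x\<in>K. norm (f n x) \<le> C * \<sigma> n"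
    by eventually_elim auto
  then show ?thesis by (rule dominatedI)
qed

lemma dominated_mono:
  assumes "dominated K \<sigma> f" "\<And>n. \<sigma> n \<ge> 0" "\<And>n. \<sigma> n \<le> D * \<tau> n"
  shows "dominated K \<tau> f"
proof -
  obtain C where "C > 0" and C: "\<forall>\<^sub>F n in sequentially. \<forall>x\<in>K. norm (f n x) \<le> C * \<sigma> n"
    using dominatedE[OF assms(1,2)] .
  from C have "\<forall>\<^sub>F n in sequentially. \<forall>x\<in>K. norm (f n x) \<le> (C * D) * \<tau> n"
  proof eventually_elim
    case (elim n)
    have "C * \<sigma> n \<le> C * (D * \<tau> n)" using assms(3) \<open>C > 0\<close> by (intro mult_left_mono) auto
    with elim show ?case by (force simp: mult.assoc)
  qed
  then show ?thesis by (rule dominatedI)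
qed

lemma dominated_subset:
  assumes "dominated K \<sigma> f" "L \<subseteq> K" shows "dominated L \<sigma> f"
proof -
  from assms(1) obtain C where "\<forall>\<^sub>F n in sequentially. \<forall>x\<in>K. norm (f n x) \<le> C * \<sigma> n"
    by (auto simp: dominated_def)
  then have "\<forall>\<^sub>F n in sequentially. \<forall>x\<in>L. norm (f n x) \<le> C * \<sigma> n"
    by eventually_elim (use assms(2) in blast)
  then show ?thesis by (rule dominatedI)
qed

lemma dominated_Suc:
  assumes "dominated K \<sigma> f" shows "dominated K (\<lambda>n. \<sigma> (Suc n)) (\<lambda>n. f (Suc n))"
  using assms unfolding dominated_def
  by (metis (no_types, lifting) eventually_sequentially_Suc[of "\<lambda>n. \<forall>x\<in>K. norm (f n x) \<le> _ * \<sigma> n"])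

lemma unif_conv_dominated_1:
  assumes "compact K" "unif_conv K f l" shows "dominated K (\<lambda>_. 1) f"
  using unif_conv_bounded[OF assms] by (auto simp: dominated_def)

lemma dominated_mult_unif_conv:
  assumes "compact K" "unif_conv K f l" "dominated K \<sigma> g" "\<And>n. \<sigma> n \<ge> 0"
  shows "dominated K \<sigma> (\<lambda>n x. f n x * g n x)"
  using dominated_mult[OF unif_conv_dominated_1[OF assms(1,2)] assms(3) _ assms(4)] by simp

lemma dominated_imp_uniform_limit_0:
  assumes "dominated K \<sigma> f" "\<sigma> \<longlonglongrightarrow> 0" "\<And>n. \<sigma> n \<ge> 0"
  shows "uniform_limit K f (\<lambda>_. 0) sequentially"
proof -
  obtain C where "C > 0" and C: "\<forall>\<^sub>F n in sequentially. \<forall>x\<in>K. norm (f n x) \<le> C * \<sigma> n"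
    using dominatedE[OF assms(1,3)] .
  have "(\<lambda>n. C * \<sigma> n) \<longlonglongrightarrow> 0" using tendsto_mult_right_zero[OF assms(2)] .
  show ?thesis
  proof (rule uniform_limitI)
    fix e :: real assume "e > 0"
    then have "\<forall>\<^sub>F n in sequentially. C * \<sigma> n < e"
      using \<open>(\<lambda>n. C * \<sigma> n) \<longlonglongrightarrow> 0\<close> order_tendstoD(2) by blast
    with C show "\<forall>\<^sub>F n in sequentially. \<forall>x\<in>K. dist (f n x) 0 < e"
      by eventually_elim force
  qed
qed

text \<open>Conversely, a sequence that tends to zero uniformly is dominated by its own sequence of
  suprema.\<close>

lemma unif_conv_0_majorant:
  assumes "unif_conv K f (\<lambda>_. 0)"
  obtains \<epsilon> :: "nat \<Rightarrow> real" where "\<epsilon> \<longlonglongrightarrow> 0" "\<And>n. \<epsilon> n \<ge> 0"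
    "\<forall>\<^sub>F n in sequentially. \<forall>x\<in>K. norm (f n x) \<le> \<epsilon> n"
proof -
  \<comment> \<open>The truncation at \<open>1\<close> makes the suprema finite at every index.\<close>
  define \<epsilon> where "\<epsilon> n = Sup (insert 0 ((\<lambda>x. min 1 (norm (f n x))) ` K))" for n
  have bdd: "bdd_above (insert 0 ((\<lambda>x. min 1 (norm (f n x))) ` K))" for n
    by (auto intro!: bdd_aboveI[of _ 1])
  have nonneg: "\<epsilon> n \<ge> 0" for n
    unfolding \<epsilon>_def using bdd by (intro cSup_upper) auto
  have lim: "\<forall>\<^sub>F n in sequentially. \<forall>x\<in>K. norm (f n x) < e" if "e > 0" for e
    using assms that by (auto simp: unif_conv_def uniform_limit_iff)
  have "\<epsilon> \<longlonglongrightarrow> 0"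
  proof (rule tendstoI)
    fix e :: real assume "e > 0"
    have "\<forall>\<^sub>F n in sequentially. \<epsilon> n \<le> e / 2"
      using lim[OF half_gt_zero[OF \<open>e > 0\<close>]]
    proof eventually_elim
      case (elim n)
      show ?case unfolding \<epsilon>_def
        by (rule cSup_least) (use elim \<open>e > 0\<close> in \<open>force simp: min.coboundedI2 less_imp_le\<close>)+
    qed
    then show "\<forall>\<^sub>F n in sequentially. dist (\<epsilon> n) 0 < e"
      by eventually_elim (use nonneg \<open>e > 0\<close> in auto)
  qed
  moreover have "\<forall>\<^sub>F n in sequentially. \<forall>x\<in>K. norm (f n x) \<le> \<epsilon> n"
    using lim[OF zero_less_one]
  proof eventually_elim
    case (elim n)
    show ?case
    proof
      fix x assume "x \<in> K"
      then have "min 1 (norm (f n x)) \<le> \<epsilon> n"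
        unfolding \<epsilon>_def using bdd by (intro cSup_upper) auto
      then show "norm (f n x) \<le> \<epsilon> n" using elim \<open>x \<in> K\<close> by auto
    qed
  qed
  ultimately show thesis using that nonneg by blast
qed

section \<open>Recursions solved from infinity\<close>

primrec backward_iterate :: "(nat \<Rightarrow> 'a \<Rightarrow> complex \<Rightarrow> complex) \<Rightarrow> nat \<Rightarrow> nat \<Rightarrow> 'a \<Rightarrow> complex" where
  "backward_iterate h 0 n x = 0"
| "backward_iterate h (Suc k) n x = h n x (backward_iterate h k (Suc n) x)"

text \<open>Starting the backward recursion later and later gives a uniformly Cauchy sequence: \<open>S\<close> bounds
  all iterates, so two iterates differ by at most \<open>S (n + k)\<close> at the index where the earlier one
  starts, and carrying this difference back to the index \<open>n\<close> costs only the bounded product of the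
  Lipschitz constants.\<close>

lemma backward_recursion_solution:
  fixes h :: "nat \<Rightarrow> 'a::topological_space \<Rightarrow> complex \<Rightarrow> complex" and S L :: "nat \<Rightarrow> real"
  assumes invariant: "\<And>n x z. x \<in> K \<Longrightarrow> cmod z \<le> S (Suc n) \<Longrightarrow> cmod (h n x z) \<le> S n"
    and lipschitz: "\<And>n x z w. x \<in> K \<Longrightarrow> cmod z \<le> S (Suc n) \<Longrightarrow> cmod w \<le> S (Suc n) \<Longrightarrow>
      cmod (h n x z - h n x w) \<le> L n * cmod (z - w)"
    and L: "\<And>n. L n \<ge> 0" "\<And>n m. (\<Prod>i\<in>{n..<m}. L i) \<le> P"
    and S: "\<And>n. S n \<ge> 0" "S \<longlonglongrightarrow> 0"
    and cont: "\<And>n f. continuous_on K f \<Longrightarrow> (\<forall>x\<in>K. cmod (f x) \<le> S (Suc n)) \<Longrightarrow>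
      continuous_on K (\<lambda>x. h n x (f x))"
  shows "\<exists>y. \<forall>n. continuous_on K (y n) \<and> (\<forall>x\<in>K. cmod (y n x) \<le> S n \<and> y n x = h n x (y (Suc n) x))"
proof -
  let ?B = "backward_iterate h"
  have bound: "cmod (?B k n x) \<le> S n" if "x \<in> K" for k n x
    using that by (induction k arbitrary: n) (auto intro: invariant S)
  have cont_B: "continuous_on K (?B k n)" for k n
  proof (induction k arbitrary: n)
    case (Suc k)
    then show ?case using cont[OF Suc.IH[of "Suc n"]] bound by simp
  qed simp
  have diff: "cmod (?B (k + j) n x - ?B k n x) \<le> (\<Prod>i\<in>{n..<n+k}. L i) * S (n + k)"
    if "x \<in> K" for k j n x
  proof (induction k arbitrary: n)
    case 0
    then show ?case using bound[OF that] by simp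
  next
    case (Suc k)
    have "cmod (?B (Suc k + j) n x - ?B (Suc k) n x)
        \<le> L n * cmod (?B (k + j) (Suc n) x - ?B k (Suc n) x)"
      using lipschitz[OF that bound[OF that] bound[OF that]] by simp
    also have "\<dots> \<le> L n * ((\<Prod>i\<in>{Suc n..<Suc n+k}. L i) * S (Suc n + k))"
      by (intro mult_left_mono Suc.IH L)
    also have "\<dots> = (\<Prod>i\<in>{n..<n+Suc k}. L i) * S (n + Suc k)"
      by (simp add: prod.atLeast_Suc_lessThan)
    finally show ?case .
  qed
  have P: "P \<ge> 1" using L(2)[of 0 0] by simp
  have cauchy: "uniformly_Cauchy_on K (\<lambda>k. ?B k n)" for n
  proof (rule uniformly_Cauchy_onI')
    fix e :: real assume "e > 0"
    have "(\<lambda>k. P * S (n + k)) \<longlonglongrightarrow> 0"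
      using tendsto_mult_right_zero[OF LIMSEQ_ignore_initial_segment[OF S(2), of n]]
      by (simp add: add.commute)
    then have "\<forall>\<^sub>F k in sequentially. P * S (n + k) < e"
      using \<open>e > 0\<close> order_tendstoD(2) by blast
    then obtain M where M: "\<And>k. k \<ge> M \<Longrightarrow> P * S (n + k) < e"
      by (auto simp: eventually_sequentially)
    have "dist (?B k n x) (?B k' n x) < e" if "x \<in> K" "k \<ge> M" "k' > k" for x k k'
    proof -
      have "dist (?B k n x) (?B k' n x) \<le> (\<Prod>i\<in>{n..<n+k}. L i) * S (n + k)"
        using diff[OF that(1), of k "k' - k" n] that(3) by (simp add: dist_norm norm_minus_commute)
      also have "\<dots> \<le> P * S (n + k)" by (intro mult_right_mono L S)
      finally show ?thesis using M[OF that(2)] by simp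
    qed
    then show "\<exists>M. \<forall>x\<in>K. \<forall>k\<ge>M. \<forall>k'>k. dist (?B k n x) (?B k' n x) < e" by blast
  qed
  define y where "y n x = lim (\<lambda>k. ?B k n x)" for n x
  have ylim: "uniform_limit K (\<lambda>k. ?B k n) (y n) sequentially" for n
    using Cauchy_uniformly_convergent[OF cauchy[of n]]
    unfolding uniformly_convergent_uniform_limit_iff y_def .
  have y_cont: "continuous_on K (y n)" for n
    using uniform_limit_theorem[OF _ ylim] cont_B by simp
  have y_lim: "(\<lambda>k. ?B k n x) \<longlonglongrightarrow> y n x" if "x \<in> K" for n x
    using tendsto_uniform_limitI[OF ylim that] .
  have y_bound: "cmod (y n x) \<le> S n" if "x \<in> K" for n x
    by (rule Lim_bounded[OF tendsto_norm[OF y_lim[OF that]], of 0]) (simp add: bound[OF that])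
  have y_rec: "y n x = h n x (y (Suc n) x)" if "x \<in> K" for n x
  proof -
    have "(\<lambda>k. L n * cmod (?B k (Suc n) x - y (Suc n) x)) \<longlonglongrightarrow> 0"
      using y_lim[OF that, of "Suc n"] by (intro tendsto_mult_right_zero tendsto_norm_zero LIM_zero)
    then have "(\<lambda>k. ?B (Suc k) n x - h n x (y (Suc n) x)) \<longlonglongrightarrow> 0"
      by (rule Lim_null_comparison[rotated])
        (auto intro!: always_eventually lipschitz that bound y_bound)
    then have "(\<lambda>k. ?B (Suc k) n x) \<longlonglongrightarrow> h n x (y (Suc n) x)" by (simp add: LIM_zero_iff)
    moreover have "(\<lambda>k. ?B (Suc k) n x) \<longlonglongrightarrow> y n x" using y_lim[OF that] by (rule LIMSEQ_Suc)
    ultimately show ?thesis using LIMSEQ_unique by blast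
  qed
  show ?thesis using y_cont y_bound y_rec by blast
qed

text \<open>The solution of \<open>W n = \<epsilon> n + \<theta> * W (n + 1)\<close> that is null at infinity. It bounds the solutions of
  contracting recursions with inhomogeneity \<open>\<epsilon>\<close>; with \<open>\<theta> = 1 / 2\<close> it is a majorant of \<open>\<epsilon>\<close> that at most
  doubles from one index to the next.\<close>

definition weighted_tail :: "real \<Rightarrow> (nat \<Rightarrow> real) \<Rightarrow> nat \<Rightarrow> real" where
  "weighted_tail \<theta> \<epsilon> n = (\<Sum>k. \<theta> ^ k * \<epsilon> (n + k))"

lemma
  assumes "0 \<le> \<theta>" "\<theta> < 1" "\<And>n. 0 \<le> \<epsilon> n" "\<epsilon> \<longlonglongrightarrow> 0"
  shows weighted_tail_rec: "weighted_tail \<theta> \<epsilon> n = \<epsilon> n + \<theta> * weighted_tail \<theta> \<epsilon> (Suc n)"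
    and weighted_tail_nonneg: "0 \<le> weighted_tail \<theta> \<epsilon> n"
    and weighted_tail_null: "weighted_tail \<theta> \<epsilon> \<longlonglongrightarrow> 0"
proof -
  have geom: "summable (\<lambda>k. \<theta> ^ k)" using assms by (simp add: summable_geometric)
  obtain B where B: "\<And>n. \<epsilon> n \<le> B"
    using convergent_imp_Bseq[OF convergentI[OF assms(4)]] by (auto simp: Bseq_def) (metis abs_le_iff)
  have summ: "summable (\<lambda>k. \<theta> ^ k * \<epsilon> (n + k))" for n
    by (rule summable_comparison_test'[OF summable_mult2[OF geom, of B], of 0])
      (use assms B in \<open>auto intro!: mult_left_mono\<close>)
  show "weighted_tail \<theta> \<epsilon> n = \<epsilon> n + \<theta> * weighted_tail \<theta> \<epsilon> (Suc n)" for n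
    unfolding weighted_tail_def
    using suminf_split_head[OF summ[of n]] suminf_mult[OF summ[of "Suc n"], of \<theta>]
    by (simp add: mult.assoc)
  show nonneg: "0 \<le> weighted_tail \<theta> \<epsilon> n" for n
    unfolding weighted_tail_def using assms by (intro suminf_nonneg summ) auto
  show "weighted_tail \<theta> \<epsilon> \<longlonglongrightarrow> 0"
  proof (rule LIMSEQ_I)
    fix e :: real assume "e > 0"
    then have "e * (1 - \<theta>) / 2 > 0" using assms by simp
    then obtain N where N: "\<And>n. n \<ge> N \<Longrightarrow> \<epsilon> n < e * (1 - \<theta>) / 2"
      using order_tendstoD(2)[OF assms(4)] by (metis eventually_sequentially)
    have "norm (weighted_tail \<theta> \<epsilon> n - 0) < e" if "n \<ge> N" for n
    proof -
      have "weighted_tail \<theta> \<epsilon> n \<le> (\<Sum>k. \<theta> ^ k * (e * (1 - \<theta>) / 2))"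
        unfolding weighted_tail_def
        by (intro suminf_le summ summable_mult2 geom mult_left_mono)
          (use assms that N in \<open>auto intro: less_imp_le\<close>)
      also have "\<dots> = e / 2"
        using suminf_mult2[OF geom, of "e * (1 - \<theta>) / 2"] suminf_geometric[of \<theta>] assms
        by simp
      finally show ?thesis using nonneg[of n] \<open>e > 0\<close> by simp
    qed
    then show "\<exists>no. \<forall>n\<ge>no. norm (weighted_tail \<theta> \<epsilon> n - 0) < e" by blast
  qed
qed

lemma summable_tail_null:
  fixes \<epsilon> :: "nat \<Rightarrow> real"
  assumes "summable \<epsilon>" shows "(\<lambda>n. \<Sum>k. \<epsilon> (k + n)) \<longlonglongrightarrow> 0"
proof -
  have "(\<lambda>n. \<Sum>k. \<epsilon> (k + n)) = (\<lambda>n. suminf \<epsilon> - (\<Sum>i<n. \<epsilon> i))"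
    by (rule ext) (rule suminf_minus_initial_segment[OF assms])
  moreover have "\<dots> \<longlonglongrightarrow> suminf \<epsilon> - suminf \<epsilon>"
    by (intro tendsto_diff tendsto_const summable_LIMSEQ assms)
  ultimately show ?thesis by simp
qed

lemma linear_recursion_null:
  fixes s \<epsilon> :: "nat \<Rightarrow> real"
  assumes "0 \<le> \<theta>" "\<theta> < 1" "\<epsilon> \<longlonglongrightarrow> 0" "\<And>n. 0 \<le> s n" "\<And>n. s (Suc n) \<le> \<epsilon> n + \<theta> * s n"
  shows "s \<longlonglongrightarrow> 0"
proof (rule LIMSEQ_I)
  fix e :: real assume "e > 0"
  define d where "d = e / 2"
  have "d > 0" using \<open>e > 0\<close> by (simp add: d_def)
  then have "d * (1 - \<theta>) > 0" using assms by simp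
  then obtain N where N: "\<And>n. n \<ge> N \<Longrightarrow> \<epsilon> n < d * (1 - \<theta>)"
    using order_tendstoD(2)[OF assms(3)] by (metis eventually_sequentially)
  have *: "s (N + k) \<le> d + \<theta> ^ k * s N" for k
  proof (induction k)
    case (Suc k)
    have "s (N + Suc k) \<le> d * (1 - \<theta>) + \<theta> * s (N + k)"
      using assms(5)[of "N + k"] N[of "N + k"] by simp
    also have "\<dots> \<le> d * (1 - \<theta>) + \<theta> * (d + \<theta> ^ k * s N)"
      using Suc.IH assms(1) by (intro add_left_mono mult_left_mono)
    finally show ?case by (simp add: algebra_simps)
  qed (use \<open>d > 0\<close> in simp)
  have "(\<lambda>k. \<theta> ^ k * s N) \<longlonglongrightarrow> 0"
    using assms by (intro tendsto_mult_left_zero LIMSEQ_realpow_zero)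
  then obtain M where M: "\<And>k. k \<ge> M \<Longrightarrow> \<theta> ^ k * s N < d"
    using order_tendstoD(2)[OF _ \<open>d > 0\<close>] by (metis eventually_sequentially)
  have "norm (s n - 0) < e" if "n \<ge> N + M" for n
  proof -
    have "M \<le> n - N" "N \<le> n" using that by simp_all
    then show ?thesis using *[of "n - N"] M[of "n - N"] assms(4)[of n] by (simp add: d_def)
  qed
  then show "\<exists>no. \<forall>n\<ge>no. norm (s n - 0) < e" by blast
qed

section \<open>Small solutions of perturbed Riccati recursions\<close>

definition moebius :: "complex \<Rightarrow> complex \<Rightarrow> complex \<Rightarrow> complex \<Rightarrow> complex" where
  "moebius \<kappa> a b z = (\<kappa> * z - a) / (1 - b * z)"

lemma moebius_denominator:
  assumes "cmod b \<le> e" "e \<le> 1 / 4" "cmod z \<le> 1"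
  shows "1 - e \<le> cmod (1 - b * z)" "1 - b * z \<noteq> 0"
proof -
  have "cmod (b * z) \<le> e * 1"
    unfolding norm_mult using assms order_trans[OF norm_ge_zero assms(1)] by (intro mult_mono) auto
  then show "1 - e \<le> cmod (1 - b * z)"
    using norm_triangle_ineq2[of 1 "b * z"] by simp
  then show "1 - b * z \<noteq> 0" using assms(2) by auto
qed

text \<open>The difference quotient of a Moebius map is its determinant divided by the product of the
  two denominators.\<close>

lemma moebius_lipschitz:
  assumes "cmod \<kappa> \<le> \<theta> + e" "cmod a \<le> e" "cmod b \<le> e" "e \<le> 1 / 4" "0 \<le> \<theta>" "\<theta> \<le> 1"
    and "cmod z \<le> 1" "cmod w \<le> 1"
  shows "cmod (moebius \<kappa> a b z - moebius \<kappa> a b w) \<le> (\<theta> + 8 * e) * cmod (z - w)"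
proof -
  have "e \<ge> 0" using assms(2) norm_ge_zero order_trans by blast
  note dz = moebius_denominator[OF assms(3,4,7)] and dw = moebius_denominator[OF assms(3,4,8)]
  have "moebius \<kappa> a b z - moebius \<kappa> a b w = (\<kappa> - a * b) * (z - w) / ((1 - b * z) * (1 - b * w))"
    unfolding moebius_def using dz dw by (simp add: divide_simps) (simp add: algebra_simps)
  then have "cmod (moebius \<kappa> a b z - moebius \<kappa> a b w)
      = cmod (\<kappa> - a * b) * cmod (z - w) / (cmod (1 - b * z) * cmod (1 - b * w))"
    by (simp add: norm_mult norm_divide)
  also have "\<dots> \<le> (\<theta> + e + e * e) * cmod (z - w) / ((1 - e) * (1 - e))"
  proof (intro frac_le mult_right_mono mult_mono)
    have "cmod (a * b) \<le> e * e" unfolding norm_mult using assms \<open>e \<ge> 0\<close> by (intro mult_mono) auto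
    then show "cmod (\<kappa> - a * b) \<le> \<theta> + e + e * e"
      using norm_triangle_ineq4[of \<kappa> "a * b"] assms(1) by simp
  qed (use dz dw assms \<open>e \<ge> 0\<close> in auto)
  also have "\<dots> \<le> (\<theta> + 8 * e) * cmod (z - w)"
  proof -
    have "e * e \<le> e / 4" "e * e * e \<le> e * e / 4"
      using mult_left_mono[OF assms(4) \<open>e \<ge> 0\<close>] mult_left_mono[OF assms(4), of "e * e"] \<open>e \<ge> 0\<close> by auto
    moreover have "\<theta> * e \<le> e" using mult_right_mono[OF assms(6) \<open>e \<ge> 0\<close>] by simp
    moreover have "0 \<le> \<theta> * (e * e)" "0 \<le> e * (e * e)" using assms \<open>e \<ge> 0\<close> by simp_all
    ultimately have "\<theta> + e + e * e \<le> (\<theta> + 8 * e) * ((1 - e) * (1 - e))"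
      by (simp add: algebra_simps)
    from mult_right_mono[OF this norm_ge_zero, of "z - w"]
    show ?thesis using assms(4) by (simp add: pos_divide_le_eq mult_ac)
  qed
  finally show ?thesis .
qed

lemma moebius_bound:
  assumes "cmod \<kappa> \<le> \<theta> + e" "cmod a \<le> e" "cmod b \<le> e" "e \<le> 1 / 4" "0 \<le> \<theta>" "\<theta> \<le> 1" "cmod z \<le> 1"
  shows "cmod (moebius \<kappa> a b z) \<le> e + (\<theta> + 8 * e) * cmod z"
proof -
  have "cmod (moebius \<kappa> a b z - moebius \<kappa> a b 0) \<le> (\<theta> + 8 * e) * cmod z"
    using moebius_lipschitz[OF assms, of 0] by simp
  moreover have "cmod (moebius \<kappa> a b 0) \<le> e" using assms by (simp add: moebius_def)
  ultimately show ?thesis using norm_triangle_sub[of "moebius \<kappa> a b z" "moebius \<kappa> a b 0"] by simp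
qed

lemma moebius_continuous:
  assumes "continuous_on K \<kappa>" "continuous_on K a" "continuous_on K b" "continuous_on K f"
    and "\<And>x. x \<in> K \<Longrightarrow> 1 - b x * f x \<noteq> 0"
  shows "continuous_on K (\<lambda>x. moebius (\<kappa> x) (a x) (b x) (f x))"
  unfolding moebius_def using assms by (intro continuous_on_divide continuous_on_diff continuous_on_mult) auto

text \<open>The Riccati recursion solves for \<open>y n\<close> as a Moebius map of \<open>y (n + 1)\<close>, whose Lipschitz constant
  on the unit disc is at most \<open>\<theta> + 8 * \<epsilon> n\<close>. The sequence \<open>S\<close> is a supersolution of the linear
  recursion for the size of \<open>y\<close>; the lemma is stated so that it covers both the contracting case and
  the neutral case \<open>\<theta> = 1\<close>, which differ only in the choice of \<open>S\<close>.\<close>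

lemma riccati_backward:
  fixes \<kappa> a b :: "nat \<Rightarrow> 'a::topological_space \<Rightarrow> complex" and \<epsilon> S :: "nat \<Rightarrow> real"
  assumes cont: "\<forall>\<^sub>F n in sequentially. continuous_on K (\<kappa> n) \<and> continuous_on K (a n) \<and> continuous_on K (b n)"
    and bounds: "\<forall>\<^sub>F n in sequentially. \<forall>x\<in>K. cmod (\<kappa> n x) \<le> \<theta> + \<epsilon> n \<and> cmod (a n x) \<le> \<epsilon> n \<and> cmod (b n x) \<le> \<epsilon> n"
    and \<theta>: "0 \<le> \<theta>" "\<theta> \<le> 1" and \<epsilon>: "\<And>n. 0 \<le> \<epsilon> n" "\<epsilon> \<longlonglongrightarrow> 0"
    and S: "\<forall>\<^sub>F n in sequentially. \<epsilon> n + (\<theta> + 8 * \<epsilon> n) * S (Suc n) \<le> S n" "\<And>n. S n \<ge> 0" "S \<longlonglongrightarrow> 0"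
    and prod: "\<exists>P N. \<forall>n\<ge>N. \<forall>m. (\<Prod>i\<in>{n..<m}. \<theta> + 8 * \<epsilon> i) \<le> P"
  shows "\<exists>y. unif_conv K y (\<lambda>_. 0) \<and>
    (\<forall>\<^sub>F n in sequentially. \<forall>x\<in>K. y n x * (1 - b n x * y (Suc n) x) = \<kappa> n x * y (Suc n) x - a n x)"
proof -
  from prod obtain P N0 where P: "\<And>n m. n \<ge> N0 \<Longrightarrow> (\<Prod>i\<in>{n..<m}. \<theta> + 8 * \<epsilon> i) \<le> P" by blast
  have "\<forall>\<^sub>F n in sequentially. \<epsilon> n \<le> 1 / 4" "\<forall>\<^sub>F n in sequentially. S n \<le> 1"
    by (rule eventually_mono[OF order_tendstoD(2)[OF \<epsilon>(2), of "1/4"]]; simp)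
      (rule eventually_mono[OF order_tendstoD(2)[OF S(3), of 1]]; simp)
  with cont bounds S(1) eventually_ge_at_top[of N0]
  have "\<forall>\<^sub>F n in sequentially. (continuous_on K (\<kappa> n) \<and> continuous_on K (a n) \<and> continuous_on K (b n)) \<and>
    (\<forall>x\<in>K. cmod (\<kappa> n x) \<le> \<theta> + \<epsilon> n \<and> cmod (a n x) \<le> \<epsilon> n \<and> cmod (b n x) \<le> \<epsilon> n) \<and>
    \<epsilon> n + (\<theta> + 8 * \<epsilon> n) * S (Suc n) \<le> S n \<and> \<epsilon> n \<le> 1 / 4 \<and> S n \<le> 1 \<and> N0 \<le> n"
    by eventually_elim blast
  then obtain N where N: "\<And>n. n \<ge> N \<Longrightarrow> (continuous_on K (\<kappa> n) \<and> continuous_on K (a n) \<and> continuous_on K (b n)) \<and>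
    (\<forall>x\<in>K. cmod (\<kappa> n x) \<le> \<theta> + \<epsilon> n \<and> cmod (a n x) \<le> \<epsilon> n \<and> cmod (b n x) \<le> \<epsilon> n) \<and>
    \<epsilon> n + (\<theta> + 8 * \<epsilon> n) * S (Suc n) \<le> S n \<and> \<epsilon> n \<le> 1 / 4 \<and> S n \<le> 1 \<and> N0 \<le> n"
    by (auto simp: eventually_sequentially)
  define h where "h n x = moebius (\<kappa> (n + N) x) (a (n + N) x) (b (n + N) x)" for n x
  have S1: "z \<le> S (Suc n + N) \<Longrightarrow> z \<le> 1" for z n
    using N[of "Suc n + N"] by auto
  have "\<exists>y. \<forall>n. continuous_on K (y n) \<and>
      (\<forall>x\<in>K. cmod (y n x) \<le> S (n + N) \<and> y n x = h n x (y (Suc n) x))"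
  proof (rule backward_recursion_solution[where L = "\<lambda>n. \<theta> + 8 * \<epsilon> (n + N)" and P = P])
    fix n x z assume x: "x \<in> K" and z: "cmod z \<le> S (Suc n + N)"
    note B = N[of "n + N"]
    have "cmod (h n x z) \<le> \<epsilon> (n + N) + (\<theta> + 8 * \<epsilon> (n + N)) * cmod z"
      unfolding h_def using B x S1[OF z] \<theta> by (intro moebius_bound) auto
    also have "\<dots> \<le> \<epsilon> (n + N) + (\<theta> + 8 * \<epsilon> (n + N)) * S (Suc n + N)"
      using \<theta> \<epsilon>(1)[of "n+N"] z by (intro add_left_mono mult_left_mono) auto
    finally show "cmod (h n x z) \<le> S (n + N)" using B by simp
  next
    fix n x z w assume "x \<in> K" and z: "cmod z \<le> S (Suc n + N)" and w: "cmod w \<le> S (Suc n + N)"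
    then show "cmod (h n x z - h n x w) \<le> (\<theta> + 8 * \<epsilon> (n + N)) * cmod (z - w)"
      unfolding h_def using N[of "n + N"] S1[OF z] S1[OF w] \<theta> by (intro moebius_lipschitz) auto
  next
    fix n m
    have "(\<Prod>i\<in>{n..<m}. \<theta> + 8 * \<epsilon> (i + N)) = (\<Prod>i\<in>{n + N..<m + N}. \<theta> + 8 * \<epsilon> i)"
      using prod.shift_bounds_nat_ivl[of "\<lambda>i. \<theta> + 8 * \<epsilon> i" n N m] by simp
    also have "\<dots> \<le> P" using N[of "n + N"] by (intro P) auto
    finally show "(\<Prod>i\<in>{n..<m}. \<theta> + 8 * \<epsilon> (i + N)) \<le> P" .
  next
    fix n and f :: "'a \<Rightarrow> complex"
    assume f: "continuous_on K f" "\<forall>x\<in>K. cmod (f x) \<le> S (Suc n + N)"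
    show "continuous_on K (\<lambda>x. h n x (f x))"
      unfolding h_def
    proof (rule moebius_continuous)
      fix x assume x: "x \<in> K"
      show "1 - b (n + N) x * f x \<noteq> 0"
        by (rule moebius_denominator(2)[where e = "\<epsilon> (n + N)"]) (use N[of "n + N"] x f(2) S1 in auto)
    qed (use N[of "n + N"] f in auto)
  next
    show "(\<lambda>n. S (n + N)) \<longlonglongrightarrow> 0" using S(3) by (rule LIMSEQ_ignore_initial_segment)
  qed (use \<theta> \<epsilon> S in auto)
  then obtain y where y: "\<And>n. continuous_on K (y n)"
    "\<And>n x. x \<in> K \<Longrightarrow> cmod (y n x) \<le> S (n + N)" "\<And>n x. x \<in> K \<Longrightarrow> y n x = h n x (y (Suc n) x)"
    by blast
  define Y where "Y n = y (n - N)" for n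
  have "unif_conv K Y (\<lambda>_. 0)"
    unfolding unif_conv_def
  proof
    show "\<forall>\<^sub>F n in sequentially. continuous_on K (Y n)" using y(1) by (simp add: Y_def)
    have "\<forall>\<^sub>F n in sequentially. \<forall>x\<in>K. norm (Y n x) \<le> 1 * S n"
      using eventually_ge_at_top[of N]
    proof eventually_elim
      case (elim n)
      then show ?case using y(2)[of _ "n - N"] by (simp add: Y_def)
    qed
    from dominated_imp_uniform_limit_0[OF dominatedI[OF this] S(3,2)]
    show "uniform_limit K Y (\<lambda>_. 0) sequentially" .
  qed
  moreover have "\<forall>\<^sub>F n in sequentially. \<forall>x\<in>K.
      Y n x * (1 - b n x * Y (Suc n) x) = \<kappa> n x * Y (Suc n) x - a n x"
    using eventually_ge_at_top[of N]
  proof eventually_elim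
    case (elim n)
    show ?case
    proof
      fix x assume x: "x \<in> K"
      have "Y n x = moebius (\<kappa> n x) (a n x) (b n x) (Y (Suc n) x)"
        using y(3)[OF x, of "n - N"] elim by (simp add: Y_def h_def Suc_diff_le)
      moreover have "1 - b n x * Y (Suc n) x \<noteq> 0"
        by (rule moebius_denominator(2)[where e = "\<epsilon> n"])
          (use N[of n] N[of "Suc n"] x y(2)[OF x, of "Suc n - N"] elim in \<open>auto simp: Y_def\<close>)
      ultimately show "Y n x * (1 - b n x * Y (Suc n) x) = \<kappa> n x * Y (Suc n) x - a n x"
        by (simp add: moebius_def)
    qed
  qed
  ultimately show ?thesis by blast
qed

text \<open>Without contraction, summable errors are still harmless: they enter both the sizes and the
  Lipschitz constants only through convergent sums and products.\<close>

lemma riccati_backward_neutral: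
  fixes \<kappa> a b :: "nat \<Rightarrow> 'a::topological_space \<Rightarrow> complex" and \<epsilon> :: "nat \<Rightarrow> real"
  assumes cont: "\<forall>\<^sub>F n in sequentially. continuous_on K (\<kappa> n) \<and> continuous_on K (a n) \<and> continuous_on K (b n)"
    and bounds: "\<forall>\<^sub>F n in sequentially. \<forall>x\<in>K. cmod (\<kappa> n x) \<le> 1 + \<epsilon> n \<and> cmod (a n x) \<le> \<epsilon> n \<and> cmod (b n x) \<le> \<epsilon> n"
    and \<epsilon>: "\<And>n. 0 \<le> \<epsilon> n" "summable \<epsilon>"
  shows "\<exists>y. unif_conv K y (\<lambda>_. 0) \<and>
    (\<forall>\<^sub>F n in sequentially. \<forall>x\<in>K. y n x * (1 - b n x * y (Suc n) x) = \<kappa> n x * y (Suc n) x - a n x)"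
proof (rule riccati_backward[OF cont bounds])
  define T where "T n = (\<Sum>k. \<epsilon> (k + n))" for n
  \<comment> \<open>The product of the factors \<open>1 + 8 \<epsilon>\<close> over all indices from \<open>n\<close> on is at most
    \<open>exp (8 * T n)\<close>, and \<open>exp (8 * T n) - 1\<close> turns out to absorb the inhomogeneity too.\<close>
  define S where "S n = exp (8 * T n) - 1" for n
  have T_rec: "T n = \<epsilon> n + T (Suc n)" for n
    unfolding T_def using suminf_split_head[OF summable_ignore_initial_segment[OF \<epsilon>(2), of n]] by simp
  have T_nonneg: "T n \<ge> 0" for n
    unfolding T_def using \<epsilon> by (intro suminf_nonneg summable_ignore_initial_segment) auto
  have "\<epsilon> n + (1 + 8 * \<epsilon> n) * S (Suc n) \<le> S n" for n
  proof -
    have "(1 + 8 * \<epsilon> n) * exp (8 * T (Suc n)) \<le> exp (8 * \<epsilon> n) * exp (8 * T (Suc n))"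
      using exp_ge_add_one_self[of "8 * \<epsilon> n"] by (intro mult_right_mono) auto
    also have "\<dots> = exp (8 * T n)" by (simp add: T_rec[of n] exp_add distrib_left)
    finally show ?thesis unfolding S_def using \<epsilon>(1)[of n] by (simp add: algebra_simps)
  qed
  then show "\<forall>\<^sub>F n in sequentially. \<epsilon> n + (1 + 8 * \<epsilon> n) * S (Suc n) \<le> S n" by simp
  show "S n \<ge> 0" for n unfolding S_def using T_nonneg[of n] by simp
  have "T \<longlonglongrightarrow> 0" unfolding T_def by (rule summable_tail_null[OF \<epsilon>(2)])
  then have "(\<lambda>n. exp (8 * T n) - 1) \<longlonglongrightarrow> exp (8 * 0) - 1" by (intro tendsto_intros)
  then show "S \<longlonglongrightarrow> 0" by (simp add: S_def[abs_def])
  have prod: "(\<Prod>i\<in>{n..<n+k}. 1 + 8 * \<epsilon> i) \<le> exp (8 * T n)" for n k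
  proof (induction k arbitrary: n)
    case (Suc k)
    have "(\<Prod>i\<in>{n..<n+Suc k}. 1 + 8 * \<epsilon> i) = (1 + 8 * \<epsilon> n) * (\<Prod>i\<in>{Suc n..<Suc n+k}. 1 + 8 * \<epsilon> i)"
      by (simp add: prod.atLeast_Suc_lessThan)
    also have "\<dots> \<le> exp (8 * \<epsilon> n) * exp (8 * T (Suc n))"
      using exp_ge_add_one_self[of "8 * \<epsilon> n"] \<epsilon>(1) by (intro mult_mono Suc.IH prod_nonneg) auto
    also have "\<dots> = exp (8 * T n)" by (simp add: T_rec[of n] exp_add distrib_left)
    finally show ?case .
  qed (use T_nonneg in simp)
  have T_mono: "T n \<le> T 0" for n
  proof (induction n)
    case (Suc n) then show ?case using T_rec[of n] \<epsilon>(1)[of n] by simp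
  qed simp
  have "(\<Prod>i\<in>{n..<m}. 1 + 8 * \<epsilon> i) \<le> exp (8 * T 0)" for n m
  proof (cases "n \<le> m")
    case True
    then show ?thesis using prod[of n "m - n"] T_mono[of n] by (simp add: order_trans)
  qed (use T_nonneg in simp)
  then show "\<exists>P N. \<forall>n\<ge>N. \<forall>m. (\<Prod>i\<in>{n..<m}. 1 + 8 * \<epsilon> i) \<le> P" by blast
qed (use \<epsilon> summable_LIMSEQ_zero in auto)

text \<open>By compactness, a limit multiplier of modulus less than \<open>1\<close> stays away from the unit circle.\<close>

lemma contraction_data:
  fixes \<kappa> a b :: "nat \<Rightarrow> 'a::topological_space \<Rightarrow> complex"
  assumes "compact K" "unif_conv K \<kappa> \<kappa>\<^sub>0" "unif_conv K a (\<lambda>_. 0)" "unif_conv K b (\<lambda>_. 0)"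
    and "\<And>x. x \<in> K \<Longrightarrow> cmod (\<kappa>\<^sub>0 x) < 1"
  obtains \<theta> \<epsilon> where "0 \<le> \<theta>" "\<theta> < 1" "\<forall>n. 0 \<le> \<epsilon> n" "\<epsilon> \<longlonglongrightarrow> 0"
    "\<forall>\<^sub>F n in sequentially. \<forall>x\<in>K. cmod (\<kappa> n x) \<le> \<theta> + \<epsilon> n \<and> cmod (a n x) \<le> \<epsilon> n \<and> cmod (b n x) \<le> \<epsilon> n"
    "\<forall>\<^sub>F n in sequentially. continuous_on K (\<kappa> n) \<and> continuous_on K (a n) \<and> continuous_on K (b n)"
proof -
  have \<kappa>_cont: "continuous_on K \<kappa>\<^sub>0" using assms(2) by (rule unif_conv_continuous_limit)
  then have "continuous_on K (\<lambda>x. 1 - cmod (\<kappa>\<^sub>0 x))" by (intro continuous_intros)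
  from nonvanishing_bounded_below[OF assms(1) this] assms(5)
  obtain c where c: "c > 0" "\<And>x. x \<in> K \<Longrightarrow> c \<le> \<bar>1 - cmod (\<kappa>\<^sub>0 x)\<bar>" by force
  define \<theta> where "\<theta> = max 0 (1 - c)"
  have \<theta>: "cmod (\<kappa>\<^sub>0 x) \<le> \<theta>" if "x \<in> K" for x
    using c(2)[OF that] assms(5)[OF that] by (auto simp: \<theta>_def)
  have "unif_conv K (\<lambda>n x. \<kappa> n x - \<kappa>\<^sub>0 x) (\<lambda>_. 0)"
    using unif_conv_diff[OF assms(2) unif_conv_const[OF \<kappa>_cont]] by simp
  from unif_conv_0_majorant[OF this] obtain \<epsilon>1 where e1: "\<epsilon>1 \<longlonglongrightarrow> 0" "\<And>n. \<epsilon>1 n \<ge> 0"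
    "\<forall>\<^sub>F n in sequentially. \<forall>x\<in>K. norm (\<kappa> n x - \<kappa>\<^sub>0 x) \<le> \<epsilon>1 n" by blast
  from unif_conv_0_majorant[OF assms(3)] obtain \<epsilon>2 where e2: "\<epsilon>2 \<longlonglongrightarrow> 0" "\<And>n. \<epsilon>2 n \<ge> 0"
    "\<forall>\<^sub>F n in sequentially. \<forall>x\<in>K. norm (a n x) \<le> \<epsilon>2 n" by blast
  from unif_conv_0_majorant[OF assms(4)] obtain \<epsilon>3 where e3: "\<epsilon>3 \<longlonglongrightarrow> 0" "\<And>n. \<epsilon>3 n \<ge> 0"
    "\<forall>\<^sub>F n in sequentially. \<forall>x\<in>K. norm (b n x) \<le> \<epsilon>3 n" by blast
  define \<epsilon> where "\<epsilon> n = \<epsilon>1 n + \<epsilon>2 n + \<epsilon>3 n" for n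
  show thesis
  proof (rule that[of \<theta> \<epsilon>])
    show "\<epsilon> \<longlonglongrightarrow> 0"
      unfolding \<epsilon>_def using tendsto_add[OF tendsto_add[OF e1(1) e2(1)] e3(1)] by simp
    show "\<forall>\<^sub>F n in sequentially. \<forall>x\<in>K. cmod (\<kappa> n x) \<le> \<theta> + \<epsilon> n \<and> cmod (a n x) \<le> \<epsilon> n \<and> cmod (b n x) \<le> \<epsilon> n"
      using e1(3) e2(3) e3(3)
    proof eventually_elim
      case (elim n)
      show ?case
      proof
        fix x assume x: "x \<in> K"
        have "cmod (\<kappa> n x) \<le> cmod (\<kappa>\<^sub>0 x) + cmod (\<kappa> n x - \<kappa>\<^sub>0 x)" by (rule norm_triangle_sub)
        then show "cmod (\<kappa> n x) \<le> \<theta> + \<epsilon> n \<and> cmod (a n x) \<le> \<epsilon> n \<and> cmod (b n x) \<le> \<epsilon> n"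
          using elim x \<theta>[OF x] e1(2)[of n] e2(2)[of n] e3(2)[of n] unfolding \<epsilon>_def by force
      qed
    qed
    show "\<forall>\<^sub>F n in sequentially. continuous_on K (\<kappa> n) \<and> continuous_on K (a n) \<and> continuous_on K (b n)"
      using assms(2-4) by (simp add: unif_conv_def eventually_conj_iff)
  qed (use c(1) e1(2) e2(2) e3(2) in \<open>auto simp: \<theta>_def \<epsilon>_def\<close>)
qed

lemma riccati_backward_contracting:
  fixes \<kappa> a b :: "nat \<Rightarrow> 'a::topological_space \<Rightarrow> complex"
  assumes "compact K" "unif_conv K \<kappa> \<kappa>\<^sub>0" "unif_conv K a (\<lambda>_. 0)" "unif_conv K b (\<lambda>_. 0)"
    and "\<And>x. x \<in> K \<Longrightarrow> cmod (\<kappa>\<^sub>0 x) < 1"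
  shows "\<exists>y. unif_conv K y (\<lambda>_. 0) \<and>
    (\<forall>\<^sub>F n in sequentially. \<forall>x\<in>K. y n x * (1 - b n x * y (Suc n) x) = \<kappa> n x * y (Suc n) x - a n x)"
proof -
  obtain \<theta> \<epsilon> where \<theta>: "0 \<le> \<theta>" "\<theta> < 1" and \<epsilon>: "\<And>n. 0 \<le> \<epsilon> n" "\<epsilon> \<longlonglongrightarrow> 0"
    and bounds: "\<forall>\<^sub>F n in sequentially. \<forall>x\<in>K. cmod (\<kappa> n x) \<le> \<theta> + \<epsilon> n \<and> cmod (a n x) \<le> \<epsilon> n \<and> cmod (b n x) \<le> \<epsilon> n"
    and cont: "\<forall>\<^sub>F n in sequentially. continuous_on K (\<kappa> n) \<and> continuous_on K (a n) \<and> continuous_on K (b n)"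
    by (rule contraction_data[OF assms]) (assumption, (rule that; (assumption | simp)))
  define \<theta>' where "\<theta>' = (1 + \<theta>) / 2"
  have \<theta>': "0 \<le> \<theta>'" "\<theta>' < 1" using \<theta> by (auto simp: \<theta>'_def)
  have "(1 - \<theta>) / 16 > 0" using \<theta> by simp
  then have "\<forall>\<^sub>F n in sequentially. \<epsilon> n < (1 - \<theta>) / 16"
    using order_tendstoD(2)[OF \<epsilon>(2)] by blast
  then have ev: "\<forall>\<^sub>F n in sequentially. \<theta> + 8 * \<epsilon> n \<le> \<theta>'"
    by eventually_elim (auto simp: \<theta>'_def field_simps)
  let ?S = "weighted_tail \<theta>' \<epsilon>"
  note S = weighted_tail_rec[OF \<theta>' \<epsilon>] weighted_tail_nonneg[OF \<theta>' \<epsilon>] weighted_tail_null[OF \<theta>' \<epsilon>]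
  show ?thesis
  proof (rule riccati_backward[OF cont bounds \<theta>(1) less_imp_le[OF \<theta>(2)] \<epsilon> _ S(2,3)])
    show "\<forall>\<^sub>F n in sequentially. \<epsilon> n + (\<theta> + 8 * \<epsilon> n) * ?S (Suc n) \<le> ?S n"
      using ev
    proof eventually_elim
      case (elim n)
      then show ?case using S(1)[of n] mult_right_mono[OF elim S(2)[of "Suc n"]] by simp
    qed
    obtain N where N: "\<And>n. n \<ge> N \<Longrightarrow> \<theta> + 8 * \<epsilon> n \<le> \<theta>'"
      using ev by (auto simp: eventually_sequentially)
    have "(\<Prod>i\<in>{n..<m}. \<theta> + 8 * \<epsilon> i) \<le> 1" if "n \<ge> N" for n m
    proof (rule prod_le_1)
      fix i assume "i \<in> {n..<m}"
      then show "0 \<le> \<theta> + 8 * \<epsilon> i \<and> \<theta> + 8 * \<epsilon> i \<le> 1"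
        using N[of i] \<theta> \<theta>' \<epsilon>(1)[of i] that by auto
    qed
    then show "\<exists>P N. \<forall>n\<ge>N. \<forall>m. (\<Prod>i\<in>{n..<m}. \<theta> + 8 * \<epsilon> i) \<le> P" by blast
  qed
qed

text \<open>A contracting recursion may also be run forward from an arbitrary small initial value, since
  errors are forgotten geometrically; \<open>0\<close> is taken here.\<close>

lemma riccati_forward_contracting:
  fixes \<kappa> a b :: "nat \<Rightarrow> 'a::topological_space \<Rightarrow> complex"
  assumes "compact K" "unif_conv K \<kappa> \<kappa>\<^sub>0" "unif_conv K a (\<lambda>_. 0)" "unif_conv K b (\<lambda>_. 0)"
    and "\<And>x. x \<in> K \<Longrightarrow> cmod (\<kappa>\<^sub>0 x) < 1"
  shows "\<exists>y. unif_conv K y (\<lambda>_. 0) \<and>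
    (\<forall>\<^sub>F n in sequentially. \<forall>x\<in>K. y (Suc n) x * (1 - b n x * y n x) = \<kappa> n x * y n x - a n x)"
proof -
  obtain \<theta> \<epsilon> where \<theta>: "0 \<le> \<theta>" "\<theta> < 1" and \<epsilon>: "\<And>n. 0 \<le> \<epsilon> n" "\<epsilon> \<longlonglongrightarrow> 0"
    and bounds: "\<forall>\<^sub>F n in sequentially. \<forall>x\<in>K. cmod (\<kappa> n x) \<le> \<theta> + \<epsilon> n \<and> cmod (a n x) \<le> \<epsilon> n \<and> cmod (b n x) \<le> \<epsilon> n"
    and cont: "\<forall>\<^sub>F n in sequentially. continuous_on K (\<kappa> n) \<and> continuous_on K (a n) \<and> continuous_on K (b n)"
    by (rule contraction_data[OF assms]) (assumption, (rule that; (assumption | simp)))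
  define \<theta>' where "\<theta>' = (1 + \<theta>) / 2"
  have \<theta>': "0 \<le> \<theta>'" "\<theta>' < 1" using \<theta> by (auto simp: \<theta>'_def)
  have "(1 - \<theta>) / 16 > 0" using \<theta> by simp
  then have "\<forall>\<^sub>F n in sequentially. \<epsilon> n < (1 - \<theta>) / 16"
    using order_tendstoD(2)[OF \<epsilon>(2)] by blast
  then have "\<forall>\<^sub>F n in sequentially. \<theta> + 8 * \<epsilon> n \<le> \<theta>' \<and> \<epsilon> n + \<theta>' \<le> 1 \<and> \<epsilon> n \<le> 1 / 4"
    by eventually_elim (use \<theta> in \<open>auto simp: \<theta>'_def field_simps\<close>)
  with bounds cont have "\<forall>\<^sub>F n in sequentially.
     (continuous_on K (\<kappa> n) \<and> continuous_on K (a n) \<and> continuous_on K (b n)) \<and>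
     (\<forall>x\<in>K. cmod (\<kappa> n x) \<le> \<theta> + \<epsilon> n \<and> cmod (a n x) \<le> \<epsilon> n \<and> cmod (b n x) \<le> \<epsilon> n) \<and>
     \<theta> + 8 * \<epsilon> n \<le> \<theta>' \<and> \<epsilon> n + \<theta>' \<le> 1 \<and> \<epsilon> n \<le> 1 / 4"
    by eventually_elim blast
  then obtain N where N: "\<And>n. n \<ge> N \<Longrightarrow>
     (continuous_on K (\<kappa> n) \<and> continuous_on K (a n) \<and> continuous_on K (b n)) \<and>
     (\<forall>x\<in>K. cmod (\<kappa> n x) \<le> \<theta> + \<epsilon> n \<and> cmod (a n x) \<le> \<epsilon> n \<and> cmod (b n x) \<le> \<epsilon> n) \<and>
     \<theta> + 8 * \<epsilon> n \<le> \<theta>' \<and> \<epsilon> n + \<theta>' \<le> 1 \<and> \<epsilon> n \<le> 1 / 4"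
    unfolding eventually_sequentially by blast
  define s where "s = rec_nat 0 (\<lambda>k t. \<epsilon> (k + N) + \<theta>' * t)"
  have s: "s 0 = 0" "\<And>k. s (Suc k) = \<epsilon> (k + N) + \<theta>' * s k" by (simp_all add: s_def)
  have s_range: "0 \<le> s k \<and> s k \<le> 1" for k
  proof (induction k)
    case (Suc k)
    have "\<theta>' * s k \<le> \<theta>'" using Suc \<theta>' by (simp add: mult_left_le)
    then show ?case using N[of "k + N"] \<epsilon>(1)[of "k + N"] \<theta>' Suc by (simp add: s)
  qed (simp add: s)
  have "s \<longlonglongrightarrow> 0"
    using linear_recursion_null[OF \<theta>' LIMSEQ_ignore_initial_segment[OF \<epsilon>(2), of N], of s] s_range s by simp
  define y where "y = rec_nat (\<lambda>x. 0) (\<lambda>k f x. moebius (\<kappa> (k + N) x) (a (k + N) x) (b (k + N) x) (f x))"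
  have y: "y 0 = (\<lambda>x. 0)" "\<And>k x. y (Suc k) x = moebius (\<kappa> (k + N) x) (a (k + N) x) (b (k + N) x) (y k x)"
    by (simp_all add: y_def)
  have y_bound: "cmod (y k x) \<le> s k" if "x \<in> K" for k x
  proof (induction k)
    case (Suc k)
    have "cmod (y (Suc k) x) \<le> \<epsilon> (k + N) + (\<theta> + 8 * \<epsilon> (k + N)) * cmod (y k x)"
      unfolding y using N[of "k + N"] that Suc s_range[of k] \<theta> by (intro moebius_bound) auto
    also have "\<dots> \<le> \<epsilon> (k + N) + \<theta>' * s k"
      using N[of "k + N"] \<theta>' Suc by (intro add_left_mono mult_mono) auto
    finally show ?case by (simp add: s)
  qed (simp add: y s)
  have denom: "1 - b (k + N) x * y k x \<noteq> 0" if "x \<in> K" for k x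
    by (rule moebius_denominator(2)[where e = "\<epsilon> (k + N)"])
      (use N[of "k + N"] that y_bound[OF that, of k] s_range[of k] in auto)
  have y_cont: "continuous_on K (y k)" for k
  proof (induction k)
    case (Suc k)
    show ?case unfolding y using N[of "k + N"] Suc denom by (intro moebius_continuous) auto
  qed (simp add: y)
  define Y where "Y n = y (n - N)" for n
  have "unif_conv K Y (\<lambda>_. 0)"
    unfolding unif_conv_def
  proof
    show "\<forall>\<^sub>F n in sequentially. continuous_on K (Y n)" using y_cont by (simp add: Y_def)
    have "dominated K (\<lambda>n. s (n - N)) Y"
      by (rule dominatedI[where C = 1]) (simp add: Y_def y_bound)
    moreover have "(\<lambda>n. s (n - N)) \<longlonglongrightarrow> 0"
      using \<open>s \<longlonglongrightarrow> 0\<close> by (subst seq_offset_neg) auto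
    ultimately show "uniform_limit K Y (\<lambda>_. 0) sequentially"
      using dominated_imp_uniform_limit_0 s_range by blast
  qed
  moreover have "\<forall>\<^sub>F n in sequentially. \<forall>x\<in>K.
      Y (Suc n) x * (1 - b n x * Y n x) = \<kappa> n x * Y n x - a n x"
    using eventually_ge_at_top[of N]
  proof eventually_elim
    case (elim n)
    then show ?case
      using y(2)[of "n - N"] denom[of _ "n - N"] by (auto simp: Y_def Suc_diff_le moebius_def)
  qed
  ultimately show ?thesis by blast
qed

section \<open>Almost diagonal systems\<close>

text \<open>The matrices \<open>M n\<close> map the direction \<open>\<phi> n\<close> to the direction \<open>\<phi> (n + 1)\<close>, with a multiplier
  \<open>\<mu> n\<close> that tends to \<open>\<eta>\<close>. Multiplying \<open>\<phi> n\<close> by the product of the earlier multipliers then gives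
  a solution of the system, and passing to the limit shows that \<open>v\<close> is an eigenvector. Vectors are
  given by their two coordinates.\<close>

definition has_direction ::
    "'a::topological_space set \<Rightarrow> (nat \<Rightarrow> 'a \<Rightarrow> complex^2^2) \<Rightarrow> ('a \<Rightarrow> complex) \<Rightarrow> bool" where
  "has_direction K M \<eta> \<longleftrightarrow> (\<exists>\<phi>\<^sub>1 \<phi>\<^sub>2 v\<^sub>1 v\<^sub>2 \<mu>.
     unif_conv K \<phi>\<^sub>1 v\<^sub>1 \<and> unif_conv K \<phi>\<^sub>2 v\<^sub>2 \<and> unif_conv K \<mu> \<eta> \<and> (\<forall>x\<in>K. v\<^sub>1 x \<noteq> 0 \<or> v\<^sub>2 x \<noteq> 0) \<and>
     (\<forall>\<^sub>F n in sequentially. \<forall>x\<in>K.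
        M n x $ 1 $ 1 * \<phi>\<^sub>1 n x + M n x $ 1 $ 2 * \<phi>\<^sub>2 n x = \<mu> n x * \<phi>\<^sub>1 (Suc n) x \<and>
        M n x $ 2 $ 1 * \<phi>\<^sub>1 n x + M n x $ 2 $ 2 * \<phi>\<^sub>2 n x = \<mu> n x * \<phi>\<^sub>2 (Suc n) x))"

lemma has_direction_glue:
  assumes "closed A" "closed B" "A \<inter> B = {}" "has_direction A M \<eta>" "has_direction B M \<eta>"
  shows "has_direction (A \<union> B) M \<eta>"
proof -
  obtain f1 f2 v1 v2 \<mu> where A: "unif_conv A f1 v1" "unif_conv A f2 v2" "unif_conv A \<mu> \<eta>"
    "\<forall>x\<in>A. v1 x \<noteq> 0 \<or> v2 x \<noteq> 0"
    and A': "\<forall>\<^sub>F n in sequentially. \<forall>x\<in>A.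
        M n x $ 1 $ 1 * f1 n x + M n x $ 1 $ 2 * f2 n x = \<mu> n x * f1 (Suc n) x \<and>
        M n x $ 2 $ 1 * f1 n x + M n x $ 2 $ 2 * f2 n x = \<mu> n x * f2 (Suc n) x"
    using assms(4) unfolding has_direction_def by blast
  obtain g1 g2 w1 w2 \<nu> where B: "unif_conv B g1 w1" "unif_conv B g2 w2" "unif_conv B \<nu> \<eta>"
    "\<forall>x\<in>B. w1 x \<noteq> 0 \<or> w2 x \<noteq> 0"
    and B': "\<forall>\<^sub>F n in sequentially. \<forall>x\<in>B.
        M n x $ 1 $ 1 * g1 n x + M n x $ 1 $ 2 * g2 n x = \<nu> n x * g1 (Suc n) x \<and>
        M n x $ 2 $ 1 * g1 n x + M n x $ 2 $ 2 * g2 n x = \<nu> n x * g2 (Suc n) x"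
    using assms(5) unfolding has_direction_def by blast
  note glue = unif_conv_glue[OF assms(1-3)]
  show ?thesis
    unfolding has_direction_def
  proof (intro exI conjI)
    show "unif_conv (A \<union> B) (\<lambda>n x. if x \<in> A then f1 n x else g1 n x) (\<lambda>x. if x \<in> A then v1 x else w1 x)"
      "unif_conv (A \<union> B) (\<lambda>n x. if x \<in> A then f2 n x else g2 n x) (\<lambda>x. if x \<in> A then v2 x else w2 x)"
      using A B by (auto intro: glue)
    show "unif_conv (A \<union> B) (\<lambda>n x. if x \<in> A then \<mu> n x else \<nu> n x) \<eta>"
      using glue[OF A(3) B(3)] by (simp cong: if_cong)
    show "\<forall>x\<in>A \<union> B. (if x \<in> A then v1 x else w1 x) \<noteq> 0 \<or> (if x \<in> A then v2 x else w2 x) \<noteq> 0"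
      using A(4) B(4) by auto
    show "\<forall>\<^sub>F n in sequentially. \<forall>x\<in>A \<union> B.
        M n x $ 1 $ 1 * (if x \<in> A then f1 n x else g1 n x) + M n x $ 1 $ 2 * (if x \<in> A then f2 n x else g2 n x)
          = (if x \<in> A then \<mu> n x else \<nu> n x) * (if x \<in> A then f1 (Suc n) x else g1 (Suc n) x) \<and>
        M n x $ 2 $ 1 * (if x \<in> A then f1 n x else g1 n x) + M n x $ 2 $ 2 * (if x \<in> A then f2 n x else g2 n x)
          = (if x \<in> A then \<mu> n x else \<nu> n x) * (if x \<in> A then f2 (Suc n) x else g2 (Suc n) x)"
      using A' B' by eventually_elim auto
  qed
qed

text \<open>A system written in a moving basis \<open>u\<close>, \<open>w\<close> with coefficients \<open>m\<^sub>i\<^sub>j\<close>: the combination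
  \<open>u + y w\<close> keeps its shape exactly when \<open>y\<close> solves a Riccati recursion.\<close>

lemma has_direction_from_riccati:
  fixes M :: "nat \<Rightarrow> 'a::topological_space \<Rightarrow> complex^2^2"
  assumes K: "compact K"
    and u: "unif_conv K u\<^sub>1 v\<^sub>1" "unif_conv K u\<^sub>2 v\<^sub>2" and v: "\<And>x. x \<in> K \<Longrightarrow> v\<^sub>1 x \<noteq> 0 \<or> v\<^sub>2 x \<noteq> 0"
    and w: "unif_conv K w\<^sub>1 w\<^sub>1'" "unif_conv K w\<^sub>2 w\<^sub>2'"
    and m: "unif_conv K m\<^sub>1\<^sub>1 \<eta>" "unif_conv K m\<^sub>1\<^sub>2 m\<^sub>1\<^sub>2'"
    and y: "unif_conv K y (\<lambda>_. 0)"
    and Mu: "\<forall>\<^sub>F n in sequentially. \<forall>x\<in>K.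
      M n x $ 1 $ 1 * u\<^sub>1 n x + M n x $ 1 $ 2 * u\<^sub>2 n x = m\<^sub>1\<^sub>1 n x * u\<^sub>1 (Suc n) x + m\<^sub>2\<^sub>1 n x * w\<^sub>1 (Suc n) x \<and>
      M n x $ 2 $ 1 * u\<^sub>1 n x + M n x $ 2 $ 2 * u\<^sub>2 n x = m\<^sub>1\<^sub>1 n x * u\<^sub>2 (Suc n) x + m\<^sub>2\<^sub>1 n x * w\<^sub>2 (Suc n) x"
    and Mw: "\<forall>\<^sub>F n in sequentially. \<forall>x\<in>K.
      M n x $ 1 $ 1 * w\<^sub>1 n x + M n x $ 1 $ 2 * w\<^sub>2 n x = m\<^sub>1\<^sub>2 n x * u\<^sub>1 (Suc n) x + m\<^sub>2\<^sub>2 n x * w\<^sub>1 (Suc n) x \<and>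
      M n x $ 2 $ 1 * w\<^sub>1 n x + M n x $ 2 $ 2 * w\<^sub>2 n x = m\<^sub>1\<^sub>2 n x * u\<^sub>2 (Suc n) x + m\<^sub>2\<^sub>2 n x * w\<^sub>2 (Suc n) x"
    and riccati: "\<forall>\<^sub>F n in sequentially. \<forall>x\<in>K.
      y (Suc n) x * (m\<^sub>1\<^sub>1 n x + m\<^sub>1\<^sub>2 n x * y n x) = m\<^sub>2\<^sub>1 n x + m\<^sub>2\<^sub>2 n x * y n x"
  shows "has_direction K M \<eta>"
  unfolding has_direction_def
proof (intro exI conjI)
  show "unif_conv K (\<lambda>n x. u\<^sub>1 n x + y n x * w\<^sub>1 n x) v\<^sub>1" "unif_conv K (\<lambda>n x. u\<^sub>2 n x + y n x * w\<^sub>2 n x) v\<^sub>2"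
    using unif_conv_add[OF u(1) unif_conv_mult[OF K y w(1)]] unif_conv_add[OF u(2) unif_conv_mult[OF K y w(2)]]
    by simp_all
  show "unif_conv K (\<lambda>n x. m\<^sub>1\<^sub>1 n x + m\<^sub>1\<^sub>2 n x * y n x) \<eta>"
    using unif_conv_add[OF m(1) unif_conv_mult[OF K m(2) y]] by simp
  show "\<forall>\<^sub>F n in sequentially. \<forall>x\<in>K.
    M n x $ 1 $ 1 * (u\<^sub>1 n x + y n x * w\<^sub>1 n x) + M n x $ 1 $ 2 * (u\<^sub>2 n x + y n x * w\<^sub>2 n x)
      = (m\<^sub>1\<^sub>1 n x + m\<^sub>1\<^sub>2 n x * y n x) * (u\<^sub>1 (Suc n) x + y (Suc n) x * w\<^sub>1 (Suc n) x) \<and>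
    M n x $ 2 $ 1 * (u\<^sub>1 n x + y n x * w\<^sub>1 n x) + M n x $ 2 $ 2 * (u\<^sub>2 n x + y n x * w\<^sub>2 n x)
      = (m\<^sub>1\<^sub>1 n x + m\<^sub>1\<^sub>2 n x * y n x) * (u\<^sub>2 (Suc n) x + y (Suc n) x * w\<^sub>2 (Suc n) x)"
    using Mu Mw riccati
  proof eventually_elim
    case (elim n)
    have *: "A * (u + y * w) + B * (u' + y * w') = (p + q * y) * (U + Y * W)"
      if "A * u + B * u' = p * U + r * W" "A * w + B * w' = q * U + s * W" "Y * (p + q * y) = r + s * y"
      for A B u u' w w' p q r s U W Y y :: complex
    proof -
      have "A * (u + y * w) + B * (u' + y * w') = (A * u + B * u') + y * (A * w + B * w')"
        by (simp add: algebra_simps)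
      also have "\<dots> = (p + q * y) * U + (r + s * y) * W" unfolding that(1,2) by (simp add: algebra_simps)
      also have "\<dots> = (p + q * y) * (U + Y * W)" unfolding that(3)[symmetric] by (simp add: algebra_simps)
      finally show ?thesis .
    qed
    show ?case using elim by (auto intro!: *)
  qed
qed (use v in auto)

text \<open>The hypotheses say that the two directions are approximate eigenvectors, up to an error that
  tends to zero (and is summable in the case of equal moduli). The off-diagonal coefficients of the
  system in this basis, computed by Cramer's rule, are then of the size of the errors. If the
  multipliers have equal moduli, or if \<open>w\<close> is the dominant direction, the Riccati recursion is solved
  from infinity; if \<open>u\<close> is dominant, it is solved forward.\<close>

lemma has_direction_almost_diagonal:
  fixes M :: "nat \<Rightarrow> 'a::topological_space \<Rightarrow> complex^2^2"
  assumes K: "compact K"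
    and M: "\<And>i j. unif_conv K (\<lambda>n x. M n x $ i $ j) (\<lambda>x. A x $ i $ j)"
    and u: "unif_conv K u\<^sub>1 u\<^sub>1'" "unif_conv K u\<^sub>2 u\<^sub>2'" and w: "unif_conv K w\<^sub>1 w\<^sub>1'" "unif_conv K w\<^sub>2 w\<^sub>2'"
    and det: "\<And>x. x \<in> K \<Longrightarrow> u\<^sub>1' x * w\<^sub>2' x - u\<^sub>2' x * w\<^sub>1' x \<noteq> 0"
    and p: "unif_conv K p \<eta>" "\<And>x. x \<in> K \<Longrightarrow> \<eta> x \<noteq> 0"
    and q: "unif_conv K q \<eta>'" "\<And>x. x \<in> K \<Longrightarrow> \<eta>' x \<noteq> 0"
    and \<epsilon>: "\<And>n. 0 \<le> \<epsilon> n" "\<epsilon> \<longlonglongrightarrow> 0"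
    and Mu: "dominated K \<epsilon> (\<lambda>n x. M n x $ 1 $ 1 * u\<^sub>1 n x + M n x $ 1 $ 2 * u\<^sub>2 n x - p n x * u\<^sub>1 (Suc n) x)"
      "dominated K \<epsilon> (\<lambda>n x. M n x $ 2 $ 1 * u\<^sub>1 n x + M n x $ 2 $ 2 * u\<^sub>2 n x - p n x * u\<^sub>2 (Suc n) x)"
    and Mw: "dominated K \<epsilon> (\<lambda>n x. M n x $ 1 $ 1 * w\<^sub>1 n x + M n x $ 1 $ 2 * w\<^sub>2 n x - q n x * w\<^sub>1 (Suc n) x)"
      "dominated K \<epsilon> (\<lambda>n x. M n x $ 2 $ 1 * w\<^sub>1 n x + M n x $ 2 $ 2 * w\<^sub>2 n x - q n x * w\<^sub>2 (Suc n) x)"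
    and dichotomy: "(summable \<epsilon> \<and> (\<forall>\<^sub>F n in sequentially. \<forall>x\<in>K. cmod (p n x) = cmod (q n x)))
      \<or> (\<forall>x\<in>K. cmod (\<eta> x) < cmod (\<eta>' x)) \<or> (\<forall>x\<in>K. cmod (\<eta>' x) < cmod (\<eta> x))"
  shows "has_direction K M \<eta>"
proof -
  define D where "D n x = u\<^sub>1 n x * w\<^sub>2 n x - u\<^sub>2 n x * w\<^sub>1 n x" for n x
  define I where "I n x = inverse (D (Suc n) x)" for n x
  have D: "unif_conv K D (\<lambda>x. u\<^sub>1' x * w\<^sub>2' x - u\<^sub>2' x * w\<^sub>1' x)"
    unfolding D_def by (intro unif_conv_diff unif_conv_mult K u w)
  have D': "unif_conv K (\<lambda>n. D (Suc n)) (\<lambda>x. u\<^sub>1' x * w\<^sub>2' x - u\<^sub>2' x * w\<^sub>1' x)"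
    by (rule unif_conv_Suc[OF D])
  have I: "unif_conv K I (\<lambda>x. inverse (u\<^sub>1' x * w\<^sub>2' x - u\<^sub>2' x * w\<^sub>1' x))"
    unfolding I_def[abs_def] by (rule unif_conv_inverse[OF K D' det])
  have "\<forall>\<^sub>F n in sequentially. \<forall>x\<in>K. D (Suc n) x \<noteq> 0"
    by (rule unif_conv_nonzero[OF K D' det])
  then have ID: "\<forall>\<^sub>F n in sequentially. \<forall>x\<in>K. I n x * D (Suc n) x = 1"
    by (elim eventually_mono) (simp add: I_def)
  define s\<^sub>1 where "s\<^sub>1 n x = M n x $ 1 $ 1 * u\<^sub>1 n x + M n x $ 1 $ 2 * u\<^sub>2 n x" for n x
  define s\<^sub>2 where "s\<^sub>2 n x = M n x $ 2 $ 1 * u\<^sub>1 n x + M n x $ 2 $ 2 * u\<^sub>2 n x" for n x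
  define t\<^sub>1 where "t\<^sub>1 n x = M n x $ 1 $ 1 * w\<^sub>1 n x + M n x $ 1 $ 2 * w\<^sub>2 n x" for n x
  define t\<^sub>2 where "t\<^sub>2 n x = M n x $ 2 $ 1 * w\<^sub>1 n x + M n x $ 2 $ 2 * w\<^sub>2 n x" for n x
  define m\<^sub>1\<^sub>1 where "m\<^sub>1\<^sub>1 n x = I n x * (s\<^sub>1 n x * w\<^sub>2 (Suc n) x - s\<^sub>2 n x * w\<^sub>1 (Suc n) x)" for n x
  define m\<^sub>2\<^sub>1 where "m\<^sub>2\<^sub>1 n x = I n x * (u\<^sub>1 (Suc n) x * s\<^sub>2 n x - u\<^sub>2 (Suc n) x * s\<^sub>1 n x)" for n x
  define m\<^sub>1\<^sub>2 where "m\<^sub>1\<^sub>2 n x = I n x * (t\<^sub>1 n x * w\<^sub>2 (Suc n) x - t\<^sub>2 n x * w\<^sub>1 (Suc n) x)" for n x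
  define m\<^sub>2\<^sub>2 where "m\<^sub>2\<^sub>2 n x = I n x * (u\<^sub>1 (Suc n) x * t\<^sub>2 n x - u\<^sub>2 (Suc n) x * t\<^sub>1 n x)" for n x
  note S = unif_conv_Suc[OF u(1)] unif_conv_Suc[OF u(2)] unif_conv_Suc[OF w(1)] unif_conv_Suc[OF w(2)]
  have cramer: "I * (s * w' - s' * w) * u + I * (u * s' - u' * s) * w = s"
      "I * (s * w' - s' * w) * u' + I * (u * s' - u' * s) * w' = s'"
    if "I * (u * w' - u' * w) = 1" for I s s' u u' w w' :: complex
  proof -
    have "I * (s * w' - s' * w) * u + I * (u * s' - u' * s) * w = I * (u * w' - u' * w) * s"
      "I * (s * w' - s' * w) * u' + I * (u * s' - u' * s) * w' = I * (u * w' - u' * w) * s'"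
      by (simp_all add: algebra_simps)
    with that show "I * (s * w' - s' * w) * u + I * (u * s' - u' * s) * w = s"
      "I * (s * w' - s' * w) * u' + I * (u * s' - u' * s) * w' = s'" by simp_all
  qed
  have eq_u: "\<forall>\<^sub>F n in sequentially. \<forall>x\<in>K.
      M n x $ 1 $ 1 * u\<^sub>1 n x + M n x $ 1 $ 2 * u\<^sub>2 n x = m\<^sub>1\<^sub>1 n x * u\<^sub>1 (Suc n) x + m\<^sub>2\<^sub>1 n x * w\<^sub>1 (Suc n) x \<and>
      M n x $ 2 $ 1 * u\<^sub>1 n x + M n x $ 2 $ 2 * u\<^sub>2 n x = m\<^sub>1\<^sub>1 n x * u\<^sub>2 (Suc n) x + m\<^sub>2\<^sub>1 n x * w\<^sub>2 (Suc n) x"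
    using ID unfolding m\<^sub>1\<^sub>1_def m\<^sub>2\<^sub>1_def s\<^sub>1_def[symmetric] s\<^sub>2_def[symmetric] D_def
    by (elim eventually_mono) (simp add: cramer)
  have eq_w: "\<forall>\<^sub>F n in sequentially. \<forall>x\<in>K.
      M n x $ 1 $ 1 * w\<^sub>1 n x + M n x $ 1 $ 2 * w\<^sub>2 n x = m\<^sub>1\<^sub>2 n x * u\<^sub>1 (Suc n) x + m\<^sub>2\<^sub>2 n x * w\<^sub>1 (Suc n) x \<and>
      M n x $ 2 $ 1 * w\<^sub>1 n x + M n x $ 2 $ 2 * w\<^sub>2 n x = m\<^sub>1\<^sub>2 n x * u\<^sub>2 (Suc n) x + m\<^sub>2\<^sub>2 n x * w\<^sub>2 (Suc n) x"
    using ID unfolding m\<^sub>1\<^sub>2_def m\<^sub>2\<^sub>2_def t\<^sub>1_def[symmetric] t\<^sub>2_def[symmetric] D_def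
    by (elim eventually_mono) (simp add: cramer)

  \<comment> \<open>The coefficients inherit the error bounds, because Cramer's rule is exact on \<open>p u\<close> and \<open>q w\<close>.\<close>
  have dom: "dominated K \<epsilon> (\<lambda>n x. I n x * (f n x * g n x - h n x * k n x))"
    if "unif_conv K f f'" "dominated K \<epsilon> g" "unif_conv K h h'" "dominated K \<epsilon> k" for f g h k f' h'
    using dominated_mult_unif_conv[OF K I dominated_diff[OF dominated_mult_unif_conv[OF K that(1,2)]
      dominated_mult_unif_conv[OF K that(3,4)]]] \<epsilon>(1) by blast
  note dom_u = Mu[folded s\<^sub>1_def s\<^sub>2_def] and dom_w = Mw[folded t\<^sub>1_def t\<^sub>2_def]
  have m11: "dominated K \<epsilon> (\<lambda>n x. m\<^sub>1\<^sub>1 n x - p n x)"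
  proof (rule dominated_cong[OF _ dom[OF S(4) dom_u(1) S(3) dom_u(2)]])
    show "\<forall>\<^sub>F n in sequentially. \<forall>x\<in>K. m\<^sub>1\<^sub>1 n x - p n x = I n x * (w\<^sub>2 (Suc n) x * (s\<^sub>1 n x - p n x * u\<^sub>1 (Suc n) x)
        - w\<^sub>1 (Suc n) x * (s\<^sub>2 n x - p n x * u\<^sub>2 (Suc n) x))"
      using ID
    proof eventually_elim
      case (elim n)
      show ?case
      proof
        fix x assume "x \<in> K"
        then have "m\<^sub>1\<^sub>1 n x - p n x = m\<^sub>1\<^sub>1 n x - p n x * (I n x * D (Suc n) x)" using elim by simp
        then show "m\<^sub>1\<^sub>1 n x - p n x = I n x * (w\<^sub>2 (Suc n) x * (s\<^sub>1 n x - p n x * u\<^sub>1 (Suc n) x)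
        - w\<^sub>1 (Suc n) x * (s\<^sub>2 n x - p n x * u\<^sub>2 (Suc n) x))"
          by (simp add: m\<^sub>1\<^sub>1_def D_def algebra_simps)
      qed
    qed
  qed
  have m22: "dominated K \<epsilon> (\<lambda>n x. m\<^sub>2\<^sub>2 n x - q n x)"
  proof (rule dominated_cong[OF _ dom[OF S(1) dom_w(2) S(2) dom_w(1)]])
    show "\<forall>\<^sub>F n in sequentially. \<forall>x\<in>K. m\<^sub>2\<^sub>2 n x - q n x = I n x * (u\<^sub>1 (Suc n) x * (t\<^sub>2 n x - q n x * w\<^sub>2 (Suc n) x)
        - u\<^sub>2 (Suc n) x * (t\<^sub>1 n x - q n x * w\<^sub>1 (Suc n) x))"
      using ID
    proof eventually_elim
      case (elim n)
      show ?case
      proof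
        fix x assume "x \<in> K"
        then have "m\<^sub>2\<^sub>2 n x - q n x = m\<^sub>2\<^sub>2 n x - q n x * (I n x * D (Suc n) x)" using elim by simp
        then show "m\<^sub>2\<^sub>2 n x - q n x = I n x * (u\<^sub>1 (Suc n) x * (t\<^sub>2 n x - q n x * w\<^sub>2 (Suc n) x)
        - u\<^sub>2 (Suc n) x * (t\<^sub>1 n x - q n x * w\<^sub>1 (Suc n) x))"
          by (simp add: m\<^sub>2\<^sub>2_def D_def algebra_simps)
      qed
    qed
  qed
  have m21: "dominated K \<epsilon> m\<^sub>2\<^sub>1"
  proof -
    have "m\<^sub>2\<^sub>1 = (\<lambda>n x. I n x * (u\<^sub>1 (Suc n) x * (s\<^sub>2 n x - p n x * u\<^sub>2 (Suc n) x)
        - u\<^sub>2 (Suc n) x * (s\<^sub>1 n x - p n x * u\<^sub>1 (Suc n) x)))"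
      by (intro ext) (simp add: m\<^sub>2\<^sub>1_def algebra_simps)
    then show ?thesis using dom[OF S(1) dom_u(2) S(2) dom_u(1)] by simp
  qed
  have m12: "dominated K \<epsilon> m\<^sub>1\<^sub>2"
  proof -
    have "m\<^sub>1\<^sub>2 = (\<lambda>n x. I n x * (w\<^sub>2 (Suc n) x * (t\<^sub>1 n x - q n x * w\<^sub>1 (Suc n) x)
        - w\<^sub>1 (Suc n) x * (t\<^sub>2 n x - q n x * w\<^sub>2 (Suc n) x)))"
      by (intro ext) (simp add: m\<^sub>1\<^sub>2_def algebra_simps)
    then show ?thesis using dom[OF S(4) dom_w(1) S(3) dom_w(2)] by simp
  qed
  have conv: "\<exists>l. unif_conv K m\<^sub>1\<^sub>1 l" "\<exists>l. unif_conv K m\<^sub>1\<^sub>2 l" "\<exists>l. unif_conv K m\<^sub>2\<^sub>1 l" "\<exists>l. unif_conv K m\<^sub>2\<^sub>2 l"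
    unfolding m\<^sub>1\<^sub>1_def m\<^sub>1\<^sub>2_def m\<^sub>2\<^sub>1_def m\<^sub>2\<^sub>2_def s\<^sub>1_def s\<^sub>2_def t\<^sub>1_def t\<^sub>2_def
    by - (rule exI, (rule unif_conv_mult unif_conv_diff unif_conv_add K I M u w S)+)+
  have limit: "unif_conv K f m" if "\<exists>l. unif_conv K f l" "unif_conv K g m" "dominated K \<epsilon> (\<lambda>n x. f n x - g n x)"
    for f g :: "nat \<Rightarrow> 'a \<Rightarrow> complex" and m
  proof -
    have "uniform_limit K (\<lambda>n x. (f n x - g n x) + g n x) (\<lambda>x. 0 + m x) sequentially"
      using dominated_imp_uniform_limit_0[OF that(3) \<epsilon>(2,1)] that(2)
      by (intro uniform_limit_add) (auto simp: unif_conv_def)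
    then show ?thesis using that(1) by (auto simp: unif_conv_def)
  qed
  have zero: "unif_conv K (\<lambda>_ _. 0) (\<lambda>_::'a. 0::complex)" by (rule unif_conv_const) simp
  note lim = limit[OF conv(1) p(1) m11] limit[OF conv(4) q(1) m22] limit[OF conv(2) zero] limit[OF conv(3) zero]
  have lim12: "unif_conv K m\<^sub>1\<^sub>2 (\<lambda>_. 0)" and lim21: "unif_conv K m\<^sub>2\<^sub>1 (\<lambda>_. 0)"
    using lim(3,4) m12 m21 by simp_all
  have nonzero: "\<forall>\<^sub>F n in sequentially. \<forall>x\<in>K. m\<^sub>1\<^sub>1 n x \<noteq> 0 \<and> m\<^sub>2\<^sub>2 n x \<noteq> 0"
  proof -
    have "\<forall>\<^sub>F n in sequentially. \<forall>x\<in>K. m\<^sub>1\<^sub>1 n x \<noteq> 0" by (rule unif_conv_nonzero[OF K lim(1) p(2)])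
    moreover have "\<forall>\<^sub>F n in sequentially. \<forall>x\<in>K. m\<^sub>2\<^sub>2 n x \<noteq> 0" by (rule unif_conv_nonzero[OF K lim(2) q(2)])
    ultimately show ?thesis by eventually_elim blast
  qed
  let ?\<kappa> = "\<lambda>n x. inverse (m\<^sub>2\<^sub>2 n x) * m\<^sub>1\<^sub>1 n x" and ?a = "\<lambda>n x. inverse (m\<^sub>2\<^sub>2 n x) * m\<^sub>2\<^sub>1 n x"
    and ?b = "\<lambda>n x. inverse (m\<^sub>2\<^sub>2 n x) * m\<^sub>1\<^sub>2 n x"
  have qinv: "unif_conv K (\<lambda>n x. inverse (m\<^sub>2\<^sub>2 n x)) (\<lambda>x. inverse (\<eta>' x))"
    by (rule unif_conv_inverse[OF K lim(2) q(2)])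
  note back_lim = unif_conv_mult[OF K qinv lim(1)] unif_conv_mult[OF K qinv lim21, simplified]
    unif_conv_mult[OF K qinv lim12, simplified]
  have backward: "\<exists>y. unif_conv K y (\<lambda>_. 0) \<and> (\<forall>\<^sub>F n in sequentially. \<forall>x\<in>K.
      y (Suc n) x * (m\<^sub>1\<^sub>1 n x + m\<^sub>1\<^sub>2 n x * y n x) = m\<^sub>2\<^sub>1 n x + m\<^sub>2\<^sub>2 n x * y n x)"
    if sol: "\<exists>y. unif_conv K y (\<lambda>_. 0) \<and> (\<forall>\<^sub>F n in sequentially. \<forall>x\<in>K.
      y n x * (1 - ?b n x * y (Suc n) x) = ?\<kappa> n x * y (Suc n) x - ?a n x)"
  proof -
    from sol obtain y where y: "unif_conv K y (\<lambda>_. 0)" "\<forall>\<^sub>F n in sequentially. \<forall>x\<in>K.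
      y n x * (1 - ?b n x * y (Suc n) x) = ?\<kappa> n x * y (Suc n) x - ?a n x" by blast
    from y(2) nonzero have "\<forall>\<^sub>F n in sequentially. \<forall>x\<in>K.
      y (Suc n) x * (m\<^sub>1\<^sub>1 n x + m\<^sub>1\<^sub>2 n x * y n x) = m\<^sub>2\<^sub>1 n x + m\<^sub>2\<^sub>2 n x * y n x"
    proof eventually_elim
      case (elim n)
      then show ?case by (auto simp: field_simps)
    qed
    with y(1) show ?thesis by blast
  qed
  have "\<exists>y. unif_conv K y (\<lambda>_. 0) \<and> (\<forall>\<^sub>F n in sequentially. \<forall>x\<in>K.
      y (Suc n) x * (m\<^sub>1\<^sub>1 n x + m\<^sub>1\<^sub>2 n x * y n x) = m\<^sub>2\<^sub>1 n x + m\<^sub>2\<^sub>2 n x * y n x)"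
    using dichotomy
  proof (elim disjE conjE)
    assume "summable \<epsilon>" and eq: "\<forall>\<^sub>F n in sequentially. \<forall>x\<in>K. cmod (p n x) = cmod (q n x)"
    note dm = dominated_mult_unif_conv[OF K qinv _ \<epsilon>(1)]
    obtain C1 where C1: "C1 > 0" "\<forall>\<^sub>F n in sequentially. \<forall>x\<in>K. cmod (inverse (m\<^sub>2\<^sub>2 n x) * m\<^sub>2\<^sub>1 n x) \<le> C1 * \<epsilon> n"
      using dominatedE[OF dm[OF m21] \<epsilon>(1)] .
    obtain C2 where C2: "C2 > 0" "\<forall>\<^sub>F n in sequentially. \<forall>x\<in>K. cmod (inverse (m\<^sub>2\<^sub>2 n x) * m\<^sub>1\<^sub>2 n x) \<le> C2 * \<epsilon> n"
      using dominatedE[OF dm[OF m12] \<epsilon>(1)] .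
    obtain C3 where C3: "C3 > 0" "\<forall>\<^sub>F n in sequentially. \<forall>x\<in>K. cmod (inverse (m\<^sub>2\<^sub>2 n x) * (m\<^sub>1\<^sub>1 n x - p n x)) \<le> C3 * \<epsilon> n"
      using dominatedE[OF dm[OF m11] \<epsilon>(1)] .
    obtain C4 where C4: "C4 > 0" "\<forall>\<^sub>F n in sequentially. \<forall>x\<in>K. cmod (inverse (m\<^sub>2\<^sub>2 n x) * (m\<^sub>2\<^sub>2 n x - q n x)) \<le> C4 * \<epsilon> n"
      using dominatedE[OF dm[OF m22] \<epsilon>(1)] .
    define \<delta> where "\<delta> n = (C1 + C2 + C3 + C4) * \<epsilon> n" for n
    show ?thesis
    proof (rule backward[OF riccati_backward_neutral[where \<epsilon> = \<delta>]])
      show "\<forall>\<^sub>F n in sequentially. continuous_on K (\<lambda>x. inverse (m\<^sub>2\<^sub>2 n x) * m\<^sub>1\<^sub>1 n x) \<and>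
          continuous_on K (\<lambda>x. inverse (m\<^sub>2\<^sub>2 n x) * m\<^sub>2\<^sub>1 n x) \<and>
          continuous_on K (\<lambda>x. inverse (m\<^sub>2\<^sub>2 n x) * m\<^sub>1\<^sub>2 n x)"
        using back_lim by (simp add: unif_conv_def eventually_conj_iff)
      show "\<forall>\<^sub>F n in sequentially. \<forall>x\<in>K. cmod (inverse (m\<^sub>2\<^sub>2 n x) * m\<^sub>1\<^sub>1 n x) \<le> 1 + \<delta> n \<and>
          cmod (inverse (m\<^sub>2\<^sub>2 n x) * m\<^sub>2\<^sub>1 n x) \<le> \<delta> n \<and> cmod (inverse (m\<^sub>2\<^sub>2 n x) * m\<^sub>1\<^sub>2 n x) \<le> \<delta> n"
        using C1(2) C2(2) C3(2) C4(2) eq nonzero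
      proof eventually_elim
        case (elim n)
        show ?case
        proof
          fix x assume x: "x \<in> K"
          have \<delta>: "C1 * \<epsilon> n \<le> \<delta> n" "C2 * \<epsilon> n \<le> \<delta> n" "C3 * \<epsilon> n + C4 * \<epsilon> n \<le> \<delta> n"
            unfolding \<delta>_def distrib_right using C1(1) C2(1) C3(1) C4(1) \<epsilon>(1)[of n] by auto
          let ?i = "inverse (m\<^sub>2\<^sub>2 n x)"
          have "cmod (?i * m\<^sub>1\<^sub>1 n x) \<le> cmod (?i * p n x) + cmod (?i * (m\<^sub>1\<^sub>1 n x - p n x))"
            using norm_triangle_ineq[of "?i * p n x" "?i * (m\<^sub>1\<^sub>1 n x - p n x)"] by (simp add: algebra_simps)
          also have "cmod (?i * p n x) = cmod (?i * q n x)" using elim x by (simp add: norm_mult)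
          also have "cmod (?i * q n x) \<le> 1 + cmod (?i * (m\<^sub>2\<^sub>2 n x - q n x))"
            using norm_triangle_ineq4[of 1 "?i * (m\<^sub>2\<^sub>2 n x - q n x)"] elim x by (simp add: algebra_simps)
          finally have "cmod (?i * m\<^sub>1\<^sub>1 n x) \<le> 1 + C4 * \<epsilon> n + C3 * \<epsilon> n" using elim x by force
          then show "cmod (?i * m\<^sub>1\<^sub>1 n x) \<le> 1 + \<delta> n \<and> cmod (?i * m\<^sub>2\<^sub>1 n x) \<le> \<delta> n \<and>
              cmod (?i * m\<^sub>1\<^sub>2 n x) \<le> \<delta> n"
            using \<delta> elim x by force
        qed
      qed
      show "0 \<le> \<delta> n" for n unfolding \<delta>_def using C1(1) C2(1) C3(1) C4(1) \<epsilon>(1)[of n] by simp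
      show "summable \<delta>" unfolding \<delta>_def using \<open>summable \<epsilon>\<close> by (rule summable_mult)
    qed
  next
    assume less: "\<forall>x\<in>K. cmod (\<eta> x) < cmod (\<eta>' x)"
    show ?thesis
    proof (rule backward[OF riccati_backward_contracting[OF K back_lim]])
      fix x assume "x \<in> K"
      then show "cmod (inverse (\<eta>' x) * \<eta> x) < 1"
        using less q(2) by (simp add: norm_divide field_simps)
    qed
  next
    assume less: "\<forall>x\<in>K. cmod (\<eta>' x) < cmod (\<eta> x)"
    have pinv: "unif_conv K (\<lambda>n x. inverse (m\<^sub>1\<^sub>1 n x)) (\<lambda>x. inverse (\<eta> x))"
      by (rule unif_conv_inverse[OF K lim(1) p(2)])
    have "\<exists>y. unif_conv K y (\<lambda>_. 0) \<and> (\<forall>\<^sub>F n in sequentially. \<forall>x\<in>K.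
        y (Suc n) x * (1 - (- (inverse (m\<^sub>1\<^sub>1 n x) * m\<^sub>1\<^sub>2 n x)) * y n x)
          = inverse (m\<^sub>1\<^sub>1 n x) * m\<^sub>2\<^sub>2 n x * y n x - (- (inverse (m\<^sub>1\<^sub>1 n x) * m\<^sub>2\<^sub>1 n x)))"
    proof (rule riccati_forward_contracting[OF K unif_conv_mult[OF K pinv lim(2)]
          unif_conv_uminus[OF unif_conv_mult[OF K pinv lim21], simplified]
          unif_conv_uminus[OF unif_conv_mult[OF K pinv lim12], simplified]])
      fix x assume "x \<in> K"
      then show "cmod (inverse (\<eta> x) * \<eta>' x) < 1"
        using less p(2) by (simp add: norm_divide field_simps)
    qed
    then obtain y where y: "unif_conv K y (\<lambda>_. 0)" "\<forall>\<^sub>F n in sequentially. \<forall>x\<in>K.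
        y (Suc n) x * (1 - (- (inverse (m\<^sub>1\<^sub>1 n x) * m\<^sub>1\<^sub>2 n x)) * y n x)
          = inverse (m\<^sub>1\<^sub>1 n x) * m\<^sub>2\<^sub>2 n x * y n x - (- (inverse (m\<^sub>1\<^sub>1 n x) * m\<^sub>2\<^sub>1 n x))" by blast
    from y(2) nonzero have "\<forall>\<^sub>F n in sequentially. \<forall>x\<in>K.
      y (Suc n) x * (m\<^sub>1\<^sub>1 n x + m\<^sub>1\<^sub>2 n x * y n x) = m\<^sub>2\<^sub>1 n x + m\<^sub>2\<^sub>2 n x * y n x"
    proof eventually_elim
      case (elim n)
      then show ?case by (auto simp: field_simps)
    qed
    with y(1) show ?thesis by blast
  qed
  then obtain y where "unif_conv K y (\<lambda>_. 0)" "\<forall>\<^sub>F n in sequentially. \<forall>x\<in>K.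
      y (Suc n) x * (m\<^sub>1\<^sub>1 n x + m\<^sub>1\<^sub>2 n x * y n x) = m\<^sub>2\<^sub>1 n x + m\<^sub>2\<^sub>2 n x * y n x" by blast
  from has_direction_from_riccati[OF K u _ w lim(1) lim12 this(1) eq_u eq_w this(2)] det
  show ?thesis by fastforce
qed

section \<open>Sequences graded by their differences\<close>

text \<open>The conditions \<open>\<Sum>\<parallel>\<Delta>\<^sup>j x\<^sub>n\<parallel>\<^bsup>r/j\<^esup> < \<infinity>\<close> with different exponents are encoded by one scalar
  sequence \<open>\<rho>\<close> with \<open>\<Sum>\<rho>\<^sub>n\<^sup>r < \<infinity>\<close> and pointwise bounds by the powers \<open>\<rho>\<^sub>n\<^sup>j\<close>. A sequence has weight
  \<open>k\<close> up to order \<open>m\<close> if its \<open>j\<close>-th difference is at most a multiple of \<open>\<rho>\<^sup>k\<^sup>+\<^sup>j\<close> for \<open>j \<le> m\<close>. Weights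
  add under multiplication, and taking a difference raises the weight by one; with Hoelder's
  inequality hidden in the powers of \<open>\<rho>\<close>, this is proved by induction on \<open>m\<close>.
  That \<open>\<rho>\<close> varies slowly makes the weights invariant under shifts.\<close>

locale weight_sequence =
  fixes K :: "'a::topological_space set" and \<rho> :: "nat \<Rightarrow> real"
  assumes compact: "compact K"
    and nonneg: "\<And>n. 0 \<le> \<rho> n"
    and slow: "\<And>n. \<rho> (Suc n) \<le> 2 * \<rho> n"
    and null: "\<rho> \<longlonglongrightarrow> 0"
begin

definition graded :: "nat \<Rightarrow> nat \<Rightarrow> (nat \<Rightarrow> 'a \<Rightarrow> complex) \<Rightarrow> bool" where
  "graded m k y \<longleftrightarrow> (\<forall>j\<le>m. dominated K (\<lambda>n. \<rho> n ^ (k + j)) (fdiff j y))"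

lemma fdiff_Suc_shift: "fdiff (Suc j) y n = fdiff j (\<lambda>n x. y (Suc n) x - y n x) n"
  for y :: "nat \<Rightarrow> 'a \<Rightarrow> complex"
  by (induction j arbitrary: n) (auto simp: fun_diff_def)

lemma graded_0: "graded 0 k y \<longleftrightarrow> dominated K (\<lambda>n. \<rho> n ^ k) y"
proof -
  have "fdiff 0 y = y" by (rule ext) simp
  then show ?thesis by (simp add: graded_def)
qed

lemma graded_Suc:
  "graded (Suc m) k y \<longleftrightarrow>
     dominated K (\<lambda>n. \<rho> n ^ k) y \<and> graded m (Suc k) (\<lambda>n x. y (Suc n) x - y n x)"
proof -
  have 0: "fdiff 0 y = y" by (rule ext) simp
  have 1: "fdiff (Suc j) y = fdiff j (\<lambda>n x. y (Suc n) x - y n x)" for j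
    by (rule ext) (rule fdiff_Suc_shift)
  have "(\<forall>j\<le>Suc m. P j) \<longleftrightarrow> P 0 \<and> (\<forall>j\<le>m. P (Suc j))" for P :: "nat \<Rightarrow> bool"
    by (metis Suc_le_mono le0 not0_implies_Suc)
  then show ?thesis unfolding graded_def by (simp only: 0 1) simp
qed

lemma dominated_power_weaken:
  assumes "dominated K (\<lambda>n. \<rho> n ^ (k + i)) y" shows "dominated K (\<lambda>n. \<rho> n ^ k) y"
proof -
  obtain R where R: "\<And>n. \<rho> n \<le> R" "0 \<le> R"
    using convergent_imp_Bseq[OF convergentI[OF null]] by (auto simp: Bseq_def) (metis abs_le_iff less_imp_le)
  have "\<rho> n ^ (k + i) \<le> R ^ i * \<rho> n ^ k" for n
    unfolding power_add mult.commute[of "\<rho> n ^ k"] using R nonneg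
    by (intro mult_right_mono power_mono) auto
  from dominated_mono[OF assms _ this] show ?thesis by (simp add: nonneg)
qed

lemma dominated_power_shift:
  assumes "dominated K (\<lambda>n. \<rho> n ^ k) y" shows "dominated K (\<lambda>n. \<rho> n ^ k) (\<lambda>n. y (Suc n))"
proof -
  have "\<rho> (Suc n) ^ k \<le> 2 ^ k * \<rho> n ^ k" for n
    unfolding power_mult_distrib[symmetric] by (intro power_mono slow nonneg)
  from dominated_mono[OF dominated_Suc[OF assms] _ this] show ?thesis by (simp add: nonneg)
qed

lemma graded_dominated: "graded m k y \<Longrightarrow> dominated K (\<lambda>n. \<rho> n ^ k) y"
  by (cases m) (auto simp: graded_0 graded_Suc)

lemma graded_weaken:
  assumes "graded (m + i) (k + l) y" shows "graded m k y"
proof -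
  have "dominated K (\<lambda>n. \<rho> n ^ (k + j + l)) (fdiff j y)" if "j \<le> m" for j
    using assms that unfolding graded_def by (simp add: add_ac)
  then show ?thesis unfolding graded_def using dominated_power_weaken by blast
qed

lemma graded_add:
  assumes "graded m k y" "graded m k z" shows "graded m k (\<lambda>n x. y n x + z n x)"
  using assms
proof (induction m arbitrary: k y z)
  case 0
  then show ?case by (simp add: graded_0 dominated_add)
next
  case (Suc m)
  from Suc.IH[of "Suc k" "\<lambda>n x. y (Suc n) x - y n x" "\<lambda>n x. z (Suc n) x - z n x"] Suc.prems
  show ?case by (simp add: graded_Suc dominated_add algebra_simps)
qed

lemma graded_uminus:
  assumes "graded m k y" shows "graded m k (\<lambda>n x. - y n x)"
  using assms
proof (induction m arbitrary: k y)
  case 0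
  then show ?case by (simp add: graded_0 dominated_uminus)
next
  case (Suc m)
  from Suc.IH[of "Suc k" "\<lambda>n x. y (Suc n) x - y n x"] Suc.prems
  show ?case by (simp add: graded_Suc dominated_uminus)
qed

lemma graded_diff:
  assumes "graded m k y" "graded m k z" shows "graded m k (\<lambda>n x. y n x - z n x)"
  using graded_add[OF assms(1) graded_uminus[OF assms(2)]] by simp

lemma graded_shift:
  assumes "graded m k y" shows "graded m k (\<lambda>n. y (Suc n))"
  using assms
proof (induction m arbitrary: k y)
  case 0
  then show ?case by (simp add: graded_0 dominated_power_shift)
next
  case (Suc m)
  from Suc.IH[of "Suc k" "\<lambda>n x. y (Suc n) x - y n x"] Suc.prems
  show ?case by (simp add: graded_Suc dominated_power_shift)
qed

lemma graded_cong:
  assumes "\<forall>\<^sub>F n in sequentially. \<forall>x\<in>K. y n x = z n x" "graded m k z" shows "graded m k y"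
  using assms
proof (induction m arbitrary: k y z)
  case 0
  then show ?case using dominated_cong[OF 0(1)] by (simp add: graded_0)
next
  case (Suc m)
  have "\<forall>\<^sub>F n in sequentially. \<forall>x\<in>K. y (Suc n) x = z (Suc n) x"
    using Suc.prems(1) eventually_sequentially_Suc[of "\<lambda>n. \<forall>x\<in>K. y n x = z n x"] by blast
  with Suc.prems(1) have "\<forall>\<^sub>F n in sequentially. \<forall>x\<in>K. y (Suc n) x - y n x = z (Suc n) x - z n x"
    by eventually_elim simp
  from Suc.IH[OF this] Suc.prems(2) dominated_cong[OF Suc.prems(1)] show ?case
    by (simp add: graded_Suc)
qed

lemma graded_const_zero: "graded m k (\<lambda>n x. 0)"
  by (induction m arbitrary: k) (auto simp: graded_0 graded_Suc intro: dominatedI[where C = 0])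

lemma graded_const: "graded m 0 (\<lambda>n x. c)"
proof (cases m)
  case 0
  then show ?thesis by (auto simp: graded_0 intro: dominatedI[where C = "cmod c"])
next
  case (Suc i)
  then show ?thesis
    by (auto simp: graded_Suc graded_const_zero intro: dominatedI[where C = "cmod c"])
qed

lemma graded_mult:
  assumes "graded m k y" "graded m l z" shows "graded m (k + l) (\<lambda>n x. y n x * z n x)"
  using assms
proof (induction m arbitrary: k l y z)
  case 0
  then show ?case using dominated_mult[of K "\<lambda>n. \<rho> n ^ k" y "\<lambda>n. \<rho> n ^ l" z] nonneg
    by (simp add: graded_0 power_add)
next
  case (Suc m)
  let ?dy = "\<lambda>n x. y (Suc n) x - y n x" and ?dz = "\<lambda>n x. z (Suc n) x - z n x"
  have "graded m (k + Suc l) (\<lambda>n x. y (Suc n) x * ?dz n x)"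
    using Suc.prems graded_weaken[of m 1 k 0 y] by (intro Suc.IH graded_shift) (auto simp: graded_Suc)
  moreover have "graded m (Suc k + l) (\<lambda>n x. ?dy n x * z n x)"
    using Suc.prems graded_weaken[of m 1 l 0 z] by (intro Suc.IH) (auto simp: graded_Suc)
  ultimately have "graded m (Suc (k + l)) (\<lambda>n x. y (Suc n) x * ?dz n x + ?dy n x * z n x)"
    using graded_add by simp
  moreover have "(\<lambda>n x. y (Suc n) x * ?dz n x + ?dy n x * z n x)
      = (\<lambda>n x. y (Suc n) x * z (Suc n) x - y n x * z n x)"
    by (intro ext) (simp add: algebra_simps)
  moreover have "dominated K (\<lambda>n. \<rho> n ^ (k + l)) (\<lambda>n x. y n x * z n x)"
    using dominated_mult[OF graded_dominated[OF Suc.prems(1)] graded_dominated[OF Suc.prems(2)]] nonneg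
    by (simp add: power_add)
  ultimately show ?case by (simp add: graded_Suc)
qed

text \<open>The difference of \<open>1 / y\<close> is the difference of \<open>y\<close> times a product of undifferenced reciprocals, so
  one order of regularity is gained at each step of the induction. Square roots work in the same
  way, the difference of \<open>y\<close> being that of \<open>y\<^sup>2\<close> divided by a sum of two values of \<open>y\<close>.\<close>

lemma graded_inverse:
  assumes "graded m 0 y" "unif_conv K y l" "\<And>x. x \<in> K \<Longrightarrow> l x \<noteq> 0"
  shows "graded m 0 (\<lambda>n x. inverse (y n x))"
  using assms(1)
proof (induction m)
  have inv: "unif_conv K (\<lambda>n x. inverse (y n x)) (\<lambda>x. inverse (l x))"
    by (rule unif_conv_inverse[OF compact assms(2,3)])
  then have dom: "dominated K (\<lambda>n. \<rho> n ^ 0) (\<lambda>n x. inverse (y n x))"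
    using unif_conv_dominated_1[OF compact] by simp
  {
    case 0
    show ?case using dom by (simp only: graded_0)
  next
    case (Suc m)
    let ?z = "\<lambda>n x. inverse (y n x)"
    have z: "graded m 0 ?z" using Suc graded_weaken[of m 1 0 0 y] by simp
    have "graded m (Suc 0) (\<lambda>n x. - ((y (Suc n) x - y n x) * (?z n x * ?z (Suc n) x)))"
      using graded_mult[of m "Suc 0" _ 0, OF _ graded_mult[OF z graded_shift[OF z], simplified]] Suc.prems
      by (intro graded_uminus) (simp add: graded_Suc)
    moreover have "\<forall>\<^sub>F n in sequentially. \<forall>x\<in>K. ?z (Suc n) x - ?z n x
        = - ((y (Suc n) x - y n x) * (?z n x * ?z (Suc n) x))"
    proof -
      have "\<forall>\<^sub>F n in sequentially. \<forall>x\<in>K. y n x \<noteq> 0" by (rule unif_conv_nonzero[OF compact assms(2,3)])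
      moreover have "\<forall>\<^sub>F n in sequentially. \<forall>x\<in>K. y (Suc n) x \<noteq> 0"
        by (rule unif_conv_nonzero[OF compact unif_conv_Suc[OF assms(2)] assms(3)])
      ultimately show ?thesis by eventually_elim (simp add: field_simps)
    qed
    ultimately have "graded m (Suc 0) (\<lambda>n x. ?z (Suc n) x - ?z n x)" by (rule graded_cong[rotated])
    with dom show ?case by (simp add: graded_Suc)
  }
qed

lemma graded_sqrt:
  assumes "graded m 0 d" "unif_conv K y l" "\<And>x. x \<in> K \<Longrightarrow> l x \<noteq> 0"
    and "\<forall>\<^sub>F n in sequentially. \<forall>x\<in>K. y n x * y n x = d n x"
  shows "graded m 0 y"
  using assms(1)
proof (induction m)
  have dom: "dominated K (\<lambda>n. \<rho> n ^ 0) y"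
    using unif_conv_dominated_1[OF compact assms(2)] by simp
  {
    case 0
    show ?case using dom by (simp only: graded_0)
  next
    case (Suc m)
    let ?s = "\<lambda>n x. y n x + y (Suc n) x"
    have y: "graded m 0 y" using Suc graded_weaken[of m 1 0 0 d] by simp
    have s: "unif_conv K ?s (\<lambda>x. l x + l x)" by (intro unif_conv_add assms(2) unif_conv_Suc)
    have s0: "l x + l x \<noteq> 0" if "x \<in> K" for x using assms(3)[OF that] by (simp add: mult_2[symmetric])
    have "graded m (Suc 0 + 0) (\<lambda>n x. (d (Suc n) x - d n x) * inverse (?s n x))"
      using Suc.prems by (intro graded_mult graded_inverse[OF graded_add[OF y graded_shift[OF y]] s s0])
        (simp_all add: graded_Suc)
    moreover have "\<forall>\<^sub>F n in sequentially. \<forall>x\<in>K. y (Suc n) x - y n x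
        = (d (Suc n) x - d n x) * inverse (?s n x)"
    proof -
      have "\<forall>\<^sub>F n in sequentially. \<forall>x\<in>K. ?s n x \<noteq> 0" by (rule unif_conv_nonzero[OF compact s s0])
      moreover have "\<forall>\<^sub>F n in sequentially. \<forall>x\<in>K. y (Suc n) x * y (Suc n) x = d (Suc n) x"
        using assms(4) eventually_sequentially_Suc[of "\<lambda>n. \<forall>x\<in>K. y n x * y n x = d n x"] by blast
      ultimately show ?thesis using assms(4)
      proof eventually_elim
        case (elim n)
        show ?case
        proof
          fix x assume "x \<in> K"
          then have "d (Suc n) x - d n x = (y (Suc n) x - y n x) * ?s n x" "?s n x \<noteq> 0"
            using elim by (auto simp: algebra_simps)
          then show "y (Suc n) x - y n x = (d (Suc n) x - d n x) * inverse (?s n x)" by simp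
        qed
      qed
    qed
    ultimately have "graded m (Suc 0 + 0) (\<lambda>n x. y (Suc n) x - y n x)" by (rule graded_cong[rotated])
    with dom show ?case by (simp add: graded_Suc)
  }
qed

section \<open>Approximate solutions of a slowly varying Riccati recursion\<close>

text \<open>The slope \<open>t\<close> of an exact solution direction \<open>(1, t)\<close> of the system with matrix
  \<open>[[a, b], [c, d]]\<close> makes this defect vanish.\<close>

definition defect :: "(nat \<Rightarrow> 'a \<Rightarrow> complex) \<Rightarrow> (nat \<Rightarrow> 'a \<Rightarrow> complex) \<Rightarrow> (nat \<Rightarrow> 'a \<Rightarrow> complex) \<Rightarrow>
    (nat \<Rightarrow> 'a \<Rightarrow> complex) \<Rightarrow> (nat \<Rightarrow> 'a \<Rightarrow> complex) \<Rightarrow> nat \<Rightarrow> 'a \<Rightarrow> complex" where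
  "defect a b c d t n x = t (Suc n) x * (a n x + b n x * t n x) - (c n x + d n x * t n x)"

text \<open>One Newton step. If the correction \<open>s\<close> were constant in \<open>n\<close>, the linear part of the
  defect would be cancelled exactly; so the new defect consists of a term with the difference of \<open>s\<close>
  and a quadratic term, and both have a higher weight.\<close>

lemma newton_step:
  assumes coeffs: "graded (Suc m) 0 a" "graded (Suc m) 0 b" "graded (Suc m) 0 d"
    and conv: "unif_conv K a a'" "unif_conv K b b'" "unif_conv K c c'" "unif_conv K d d'" "unif_conv K t \<tau>"
    and simple: "\<And>x. x \<in> K \<Longrightarrow> a' x - d' x + 2 * b' x * \<tau> x \<noteq> 0"
    and t: "graded (Suc m) 0 t" and F: "graded (Suc m) (Suc k) (defect a b c d t)"
  shows "\<exists>t'. unif_conv K t' \<tau> \<and> graded (Suc m) 0 t' \<and> graded m (Suc (Suc k)) (defect a b c d t')"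
proof -
  define g where "g n x = a n x - d n x + b n x * (t n x + t (Suc n) x)" for n x
  define s where "s n x = - (defect a b c d t n x * inverse (g n x))" for n x
  define t' where "t' n x = t n x + s n x" for n x
  have "graded (Suc m) 0 (\<lambda>n x. b n x * (t n x + t (Suc n) x))"
    using graded_mult[OF coeffs(2) graded_add[OF t graded_shift[OF t]]] by simp
  then have g: "graded (Suc m) 0 g"
    unfolding g_def using coeffs by (intro graded_add graded_diff)
  have "unif_conv K g (\<lambda>x. a' x - d' x + b' x * (\<tau> x + \<tau> x))"
    unfolding g_def[abs_def] by (intro unif_conv_add unif_conv_diff unif_conv_mult compact conv unif_conv_Suc)
  then have g_conv: "unif_conv K g (\<lambda>x. a' x - d' x + 2 * b' x * \<tau> x)"
    by (simp add: algebra_simps mult_2)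
  have g_inv: "graded (Suc m) 0 (\<lambda>n x. inverse (g n x))"
    by (rule graded_inverse[OF g g_conv simple])
  have s: "graded (Suc m) (Suc k) s"
    unfolding s_def using graded_uminus[OF graded_mult[OF F g_inv]] by simp
  have s_conv: "unif_conv K s (\<lambda>_. 0)"
  proof -
    have "unif_conv K (defect a b c d t) (\<lambda>x. \<tau> x * (a' x + b' x * \<tau> x) - (c' x + d' x * \<tau> x))"
      unfolding defect_def[abs_def]
      by (intro unif_conv_diff unif_conv_add unif_conv_mult compact conv unif_conv_Suc)
    moreover have "unif_conv K (\<lambda>n x. inverse (g n x)) (\<lambda>x. inverse (a' x - d' x + 2 * b' x * \<tau> x))"
      by (rule unif_conv_inverse[OF compact g_conv simple])
    ultimately have "\<exists>l. unif_conv K s l"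
      unfolding s_def[abs_def] using unif_conv_uminus unif_conv_mult[OF compact] by blast
    moreover have "dominated K (\<lambda>n. \<rho> n ^ Suc k) s" using s by (rule graded_dominated)
    then have "uniform_limit K s (\<lambda>_. 0) sequentially"
      using tendsto_power[OF null, of "Suc k"] nonneg by (intro dominated_imp_uniform_limit_0) auto
    ultimately show ?thesis by (auto simp: unif_conv_def)
  qed
  have "unif_conv K t' \<tau>" unfolding t'_def[abs_def] using unif_conv_add[OF conv(5) s_conv] by simp
  moreover have "graded (Suc m) 0 t'"
    unfolding t'_def[abs_def] using graded_weaken[of "Suc m" 0 0 "Suc k" s] s by (intro graded_add t) simp
  moreover have "graded m (Suc (Suc k)) (defect a b c d t')"
  proof (rule graded_cong)
    note low = graded_weaken[of m 1 0 0, simplified]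
    have "graded m (Suc (Suc k)) (\<lambda>n x. (s (Suc n) x - s n x) * (a n x + b n x * t n x))"
      using s graded_mult[of m "Suc (Suc k)" _ 0]
        graded_add[OF low[OF coeffs(1)] graded_mult[OF low[OF coeffs(2)] low[OF t], simplified]]
      by (simp add: graded_Suc)
    moreover have "graded m (Suc (Suc k)) (\<lambda>n x. b n x * (s (Suc n) x * s n x))"
    proof -
      have "graded m (Suc k) s" using graded_weaken[of m 1 "Suc k" 0 s] s by simp
      then have "graded m (0 + (Suc k + Suc k)) (\<lambda>n x. b n x * (s (Suc n) x * s n x))"
        by (intro graded_mult graded_shift low coeffs)
      then show ?thesis using graded_weaken[of m 0 "Suc (Suc k)" k] by (simp add: add_ac)
    qed
    ultimately show "graded m (Suc (Suc k))
        (\<lambda>n x. (s (Suc n) x - s n x) * (a n x + b n x * t n x) + b n x * (s (Suc n) x * s n x))"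
      by (rule graded_add)
    have "\<forall>\<^sub>F n in sequentially. \<forall>x\<in>K. g n x \<noteq> 0" by (rule unif_conv_nonzero[OF compact g_conv simple])
    then show "\<forall>\<^sub>F n in sequentially. \<forall>x\<in>K. defect a b c d t' n x
        = (s (Suc n) x - s n x) * (a n x + b n x * t n x) + b n x * (s (Suc n) x * s n x)"
    proof eventually_elim
      case (elim n)
      show ?case
      proof
        fix x assume "x \<in> K"
        then have "defect a b c d t n x + s n x * g n x = 0" using elim by (simp add: s_def)
        then show "defect a b c d t' n x
            = (s (Suc n) x - s n x) * (a n x + b n x * t n x) + b n x * (s (Suc n) x * s n x)"
          unfolding defect_def t'_def g_def by (simp add: algebra_simps)
      qed
    qed
  qed
  ultimately show ?thesis by blast
qed

text \<open>Each Newton step trades one order of regularity for one unit of weight, so \<open>m\<close> steps use up the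
  available regularity and leave a defect of weight \<open>k + 1 + m\<close>.\<close>

lemma approximate_riccati_solution:
  assumes coeffs: "graded m 0 a" "graded m 0 b" "graded m 0 d"
    and conv: "unif_conv K a a'" "unif_conv K b b'" "unif_conv K c c'" "unif_conv K d d'" "unif_conv K t \<tau>"
    and simple: "\<And>x. x \<in> K \<Longrightarrow> a' x - d' x + 2 * b' x * \<tau> x \<noteq> 0"
    and t: "graded m 0 t" and F: "graded m (Suc k) (defect a b c d t)"
  shows "\<exists>t'. unif_conv K t' \<tau> \<and> dominated K (\<lambda>n. \<rho> n ^ (Suc k + m)) (defect a b c d t')"
  using coeffs conv(5) t F
proof (induction m arbitrary: k t)
  case 0
  then show ?case by (auto simp: graded_0)
next
  case (Suc m)
  note low = graded_weaken[of m 1 0 0, simplified]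
  obtain t' where t': "unif_conv K t' \<tau>" "graded (Suc m) 0 t'" "graded m (Suc (Suc k)) (defect a b c d t')"
    using newton_step[OF Suc.prems(1-3) conv(1-4) Suc.prems(4) simple Suc.prems(5,6)] by blast
  from Suc.IH[OF low[OF Suc.prems(1)] low[OF Suc.prems(2)] low[OF Suc.prems(3)] t'(1) low[OF t'(2)] t'(3)]
  show ?case by simp
qed

end

section \<open>From the summability conditions to a weight sequence\<close>

lemma summable_weighted_tail:
  assumes "\<And>n. 0 \<le> \<omega> n" "summable \<omega>"
  shows "summable (weighted_tail (1 / 2) \<omega>)"
proof -
  let ?W = "weighted_tail (1 / 2) \<omega>"
  have null: "\<omega> \<longlonglongrightarrow> 0" by (rule summable_LIMSEQ_zero[OF assms(2)])
  have half: "0 \<le> (1 / 2 :: real)" "1 / 2 < (1 :: real)" by simp_all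
  note W = weighted_tail_rec[OF half assms(1) null] weighted_tail_nonneg[OF half assms(1) null]
  obtain B where B: "\<And>n. ?W n \<le> B"
    using convergent_imp_Bseq[OF convergentI[OF weighted_tail_null[OF half assms(1) null]]]
    by (auto simp: Bseq_def) (metis abs_le_iff)
  have telescope: "(\<Sum>i<n. ?W i) + ?W 0 = 2 * (\<Sum>i<n. \<omega> i) + ?W n" for n
  proof (induction n)
    case (Suc n)
    then show ?case using W(1)[of n] by simp
  qed simp
  have sum_le: "(\<Sum>i<n. \<omega> i) \<le> suminf \<omega>" for n
    by (rule sum_le_suminf[OF assms(2)]) (use assms(1) in auto)
  have "(\<Sum>i<n. ?W i) \<le> 2 * suminf \<omega> + B" for n
    using telescope[of n] sum_le[of n] W(2)[of 0] B[of n] by linarith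
  then show ?thesis using W(2) by (intro summableI_nonneg_bounded) auto
qed

text \<open>Adding up the terms of the \<open>r\<close> convergent series, smearing the result backwards with geometric
  weights so that it varies slowly, and taking the \<open>r\<close>-th root gives a weight sequence.\<close>

lemma weight_exists:
  fixes D :: "nat \<Rightarrow> nat \<Rightarrow> real"
  assumes r: "r \<ge> 1" and D: "\<And>j. j \<in> {1..r} \<Longrightarrow> summable (\<lambda>n. D j (Suc n) powr (real r / real j))"
  obtains \<rho> where "\<And>n. 0 \<le> \<rho> n" "\<And>n. \<rho> (Suc n) \<le> 2 * \<rho> n" "\<rho> \<longlonglongrightarrow> 0" "summable (\<lambda>n. \<rho> n ^ r)"
    "\<And>j n. j \<in> {1..r} \<Longrightarrow> D j n \<le> \<rho> n ^ j"
proof -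
  define \<omega> where "\<omega> n = (\<Sum>j\<in>{1..r}. D j n powr (real r / real j))" for n
  define W where "W = weighted_tail (1 / 2) \<omega>"
  have summ: "summable \<omega>"
    unfolding \<omega>_def
    by (intro summable_sum) (use D summable_Suc_iff[of "\<lambda>n. D _ n powr (real r / real _)"] in blast)
  have \<omega>: "0 \<le> \<omega> n" for n unfolding \<omega>_def by (intro sum_nonneg) simp
  have half: "0 \<le> (1 / 2 :: real)" "1 / 2 < (1 :: real)" by simp_all
  note W = weighted_tail_rec[OF half \<omega> summable_LIMSEQ_zero[OF summ], folded W_def]
    weighted_tail_nonneg[OF half \<omega> summable_LIMSEQ_zero[OF summ], folded W_def]
    weighted_tail_null[OF half \<omega> summable_LIMSEQ_zero[OF summ], folded W_def]
  define \<rho> where "\<rho> n = root r (W n)" for n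
  have \<rho>0: "0 \<le> \<rho> n" for n unfolding \<rho>_def by (rule real_root_ge_zero[OF W(2)])
  have pow: "\<rho> n ^ r = W n" for n unfolding \<rho>_def using r W(2) by simp
  show thesis
  proof (rule that[of \<rho>])
    show "0 \<le> \<rho> n" for n by (rule \<rho>0)
    show "\<rho> (Suc n) \<le> 2 * \<rho> n" for n
    proof -
      have "W n * 1 \<le> W n * 2 ^ (r - 1)" using W(2) by (intro mult_left_mono) auto
      then have "2 * W n \<le> 2 ^ r * W n" using r by (cases r) (auto simp: mult_ac)
      moreover have "W (Suc n) \<le> 2 * W n" using W(1)[of n] \<omega>[of n] by simp
      ultimately have "\<rho> (Suc n) ^ r \<le> (2 * \<rho> n) ^ r" by (simp add: pow power_mult_distrib)
      then show ?thesis using \<rho>0 r by (subst (asm) power_mono_iff) auto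
    qed
    show "\<rho> \<longlonglongrightarrow> 0" unfolding \<rho>_def using tendsto_real_root[OF W(3), of r] by simp
    show "summable (\<lambda>n. \<rho> n ^ r)"
      unfolding pow W_def by (rule summable_weighted_tail[OF \<omega> summ])
    show "D j n \<le> \<rho> n ^ j" if j: "j \<in> {1..r}" for j n
    proof (cases "D j n \<le> 0")
      case True
      then show ?thesis using zero_le_power[OF \<rho>0[of n], of j] by linarith
    next
      case False
      have "D j n powr (real r / real j) \<le> \<omega> n"
        unfolding \<omega>_def by (rule member_le_sum[OF j]) auto
      also have "\<dots> \<le> \<rho> n ^ r" using W(1)[of n] W(2)[of "Suc n"] by (simp add: pow)
      finally have *: "D j n powr (real r / real j) \<le> \<rho> n ^ r" .
      then have "\<rho> n > 0" using False \<rho>0[of n] r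
        by (metis less_le powr_gt_zero not_le zero_power linorder_not_less not_one_le_zero order.strict_trans2)
      have "D j n = (D j n powr (real r / real j)) powr (real j / real r)"
        using False j r by (simp add: powr_powr)
      also have "\<dots> \<le> (\<rho> n ^ r) powr (real j / real r)" using * by (intro powr_mono2) auto
      also have "\<dots> = \<rho> n ^ j"
        using \<open>\<rho> n > 0\<close> r by (simp add: powr_realpow[symmetric] powr_powr)
      finally show ?thesis .
    qed
  qed
qed

section \<open>Operator norm, suprema and differences of entries\<close>

lemma bounded_linear_matrix_vector_mult_2:
  fixes A :: "'a::real_normed_field^2^2"
  shows "bounded_linear ((*v) A)" and "opnorm A \<le> (\<Sum>i\<in>UNIV. \<Sum>j\<in>UNIV. norm (A $ i $ j))"
proof -
  have bound: "norm (A *v v) \<le> norm v * (\<Sum>i\<in>UNIV. \<Sum>j\<in>UNIV. norm (A $ i $ j))" for v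
  proof -
    have "norm (A *v v) \<le> (\<Sum>i\<in>UNIV. norm ((A *v v) $ i))"
      unfolding norm_vec_def by (rule L2_set_le_sum) simp
    also have "\<dots> \<le> (\<Sum>i\<in>UNIV. \<Sum>j\<in>UNIV. norm (A $ i $ j) * norm v)"
    proof (rule sum_mono)
      fix i :: 2
      have "norm ((A *v v) $ i) \<le> (\<Sum>j\<in>UNIV. norm (A $ i $ j * v $ j))"
        unfolding matrix_vector_mult_def by (simp add: norm_sum)
      also have "\<dots> \<le> (\<Sum>j\<in>UNIV. norm (A $ i $ j) * norm v)"
        by (intro sum_mono) (simp add: norm_mult mult_left_mono Finite_Cartesian_Product.norm_nth_le)
      finally show "norm ((A *v v) $ i) \<le> (\<Sum>j\<in>UNIV. norm (A $ i $ j) * norm v)" .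
    qed
    finally show ?thesis by (simp add: sum_distrib_left sum_distrib_right mult.commute)
  qed
  show "bounded_linear ((*v) A)"
    by (rule bounded_linear_intro[OF _ _ bound])
      (simp_all add: matrix_vector_right_distrib vec_eq_iff matrix_vector_mult_def scaleR_sum_right distrib_left sum.distrib)
  show "opnorm A \<le> (\<Sum>i\<in>UNIV. \<Sum>j\<in>UNIV. norm (A $ i $ j))"
    unfolding opnorm_def 
    by (rule onorm_bound[OF sum_nonneg[OF sum_nonneg]]) (use bound in \<open>simp_all add: mult.commute\<close>)
qed

lemma norm_entry_le_opnorm:
  fixes A :: "'a::real_normed_field^2^2"
  shows "norm (A $ i $ j) \<le> opnorm A"
proof -
  have "(A *v axis j 1) $ i = A $ i $ j"
    by (simp add: matrix_vector_mult_def axis_def if_distrib cong: if_cong)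
  then have "norm (A $ i $ j) \<le> norm (A *v axis j 1)"
    by (metis Finite_Cartesian_Product.norm_nth_le)
  also have "\<dots> \<le> opnorm A * norm (axis j 1 :: 'a^2)"
    unfolding opnorm_def by (rule onorm[OF bounded_linear_matrix_vector_mult_2(1)])
  also have "norm (axis j 1 :: 'a^2) = 1"
    using exhaust_2[of j] by (auto simp: norm_vec_def L2_set_def sum_2 axis_def)
  finally show ?thesis by simp
qed

lemma norm_entry_le_sup_on:
  fixes F :: "real \<Rightarrow> 'a::real_normed_field^2^2"
  assumes "compact K" "continuous_on K F" "x \<in> K"
  shows "norm (F x $ i $ j) \<le> sup_on K (\<lambda>x. opnorm (F x))"
proof -
  have "continuous_on K (\<lambda>x. \<Sum>i\<in>UNIV. \<Sum>j\<in>UNIV. norm (F x $ i $ j))"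
    using assms(2) by (intro continuous_intros)
  from compact_imp_bounded[OF compact_continuous_image[OF this assms(1)]]
  obtain B where B: "\<And>x. x \<in> K \<Longrightarrow> (\<Sum>i\<in>UNIV. \<Sum>j\<in>UNIV. norm (F x $ i $ j)) \<le> B"
    by (auto simp: bounded_iff) (metis abs_le_iff)
  have "bdd_above ((\<lambda>x. opnorm (F x)) ` K)"
    using order_trans[OF bounded_linear_matrix_vector_mult_2(2) B] by (auto intro!: bdd_aboveI[of _ B])
  then have "opnorm (F x) \<le> sup_on K (\<lambda>x. opnorm (F x))"
    unfolding sup_on_def using assms(3) by (intro cSup_upper) (auto simp: bdd_above_insert)
  then show ?thesis using norm_entry_le_opnorm order_trans by blast
qed

lemma sup_on_tendsto_0:
  assumes "\<And>n x. x \<in> K \<Longrightarrow> 0 \<le> f n x" "\<And>e. e > 0 \<Longrightarrow> \<forall>\<^sub>F n in sequentially. \<forall>x\<in>K. f n x < e"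
  shows "(\<lambda>n. sup_on K (f n)) \<longlonglongrightarrow> 0"
proof (rule tendstoI)
  fix e :: real assume "e > 0"
  from assms(2)[OF half_gt_zero[OF this]]
  show "\<forall>\<^sub>F n in sequentially. dist (sup_on K (f n)) 0 < e"
  proof eventually_elim
    case (elim n)
    have "sup_on K (f n) \<le> e / 2"
      unfolding sup_on_def by (rule cSup_least) (use elim \<open>e > 0\<close> in \<open>force intro: less_imp_le\<close>)+
    moreover have "0 \<le> sup_on K (f n)"
      unfolding sup_on_def using elim by (intro cSup_upper) (auto intro!: bdd_aboveI[of _ "e / 2"] less_imp_le \<open>e > 0\<close>)
    ultimately show ?case using \<open>e > 0\<close> by simp
  qed
qed

lemma continuous_on_fdiff:
  fixes X :: "nat \<Rightarrow> 'a::topological_space \<Rightarrow> 'b::real_normed_vector"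
  assumes "\<And>n. n \<ge> 1 \<Longrightarrow> continuous_on K (X n)" "n \<ge> 1"
  shows "continuous_on K (fdiff j X n)"
  using assms(2)
proof (induction j arbitrary: n)
  case (Suc j)
  have "continuous_on K (\<lambda>x. fdiff j X (Suc n) x - fdiff j X n x)"
    using Suc by (intro continuous_on_diff) auto
  then show ?case by (simp add: fun_diff_def)
qed (use assms(1) in simp)

lemma fdiff_entry:
  "fdiff j (\<lambda>n x. complex_of_real (X n x $ i $ l)) n x = complex_of_real (fdiff j X n x $ i $ l)"
  by (induction j arbitrary: n) auto

lemma (in weight_sequence) graded_entry:
  fixes X :: "nat \<Rightarrow> 'a \<Rightarrow> real^2^2"
  assumes "unif_conv K (\<lambda>n x. complex_of_real (X n x $ i $ l)) a"
    and "\<And>j n x. j \<in> {1..r} \<Longrightarrow> n \<ge> 1 \<Longrightarrow> x \<in> K \<Longrightarrow> \<bar>fdiff j X n x $ i $ l\<bar> \<le> \<rho> n ^ j"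
  shows "graded r 0 (\<lambda>n x. complex_of_real (X n x $ i $ l))"
  unfolding graded_def
proof (intro allI impI)
  fix j assume "j \<le> r"
  show "dominated K (\<lambda>n. \<rho> n ^ (0 + j)) (fdiff j (\<lambda>n x. complex_of_real (X n x $ i $ l)))"
  proof (cases "j = 0")
    case True
    have "fdiff 0 (\<lambda>n x. complex_of_real (X n x $ i $ l)) = (\<lambda>n x. complex_of_real (X n x $ i $ l))"
      by (rule ext) simp
    then show ?thesis using True unif_conv_dominated_1[OF compact assms(1)] by simp
  next
    case False
    have "\<forall>\<^sub>F n in sequentially. \<forall>x\<in>K.
        cmod (fdiff j (\<lambda>n x. complex_of_real (X n x $ i $ l)) n x) \<le> 1 * \<rho> n ^ (0 + j)"
      using eventually_ge_at_top[of 1]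
      by eventually_elim (use assms(2) False \<open>j \<le> r\<close> in \<open>simp add: fdiff_entry\<close>)
    then show ?thesis by (rule dominatedI)
  qed
qed

section \<open>The hyperbolic case\<close>

lemma common_majorant:
  assumes "finite I" "\<And>i. i \<in> I \<Longrightarrow> unif_conv K (f i) (\<lambda>_. 0)"
  shows "\<exists>\<epsilon>. (\<forall>n. 0 \<le> \<epsilon> n) \<and> \<epsilon> \<longlonglongrightarrow> 0 \<and> (\<forall>i\<in>I. dominated K \<epsilon> (f i))"
  using assms
proof (induction I rule: finite_induct)
  case empty
  then show ?case by (intro exI[of _ "\<lambda>_. 0"]) simp
next
  case (insert i I)
  then obtain \<epsilon> where \<epsilon>: "\<forall>n. 0 \<le> \<epsilon> n" "\<epsilon> \<longlonglongrightarrow> 0" "\<forall>i\<in>I. dominated K \<epsilon> (f i)" by blast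
  have "unif_conv K (f i) (\<lambda>_. 0)" using insert.prems by simp
  from unif_conv_0_majorant[OF this] obtain \<delta> where \<delta>: "\<delta> \<longlonglongrightarrow> 0" "\<And>n. 0 \<le> \<delta> n"
    "\<forall>\<^sub>F n in sequentially. \<forall>x\<in>K. norm (f i n x) \<le> \<delta> n" by blast
  have i: "dominated K \<delta> (f i)" using \<delta>(3) by (intro dominatedI[where C = 1]) simp
  have "dominated K (\<lambda>n. \<epsilon> n + \<delta> n) (f k)" if "k \<in> insert i I" for k
  proof (cases "k = i")
    case True
    then show ?thesis using dominated_mono[OF i \<delta>(2), of 1 "\<lambda>n. \<epsilon> n + \<delta> n"] \<epsilon>(1) by simp
  next
    case False
    then have "dominated K \<epsilon> (f k)" using that \<epsilon>(3) by simp
    then show ?thesis using dominated_mono[of K \<epsilon> "f k" 1 "\<lambda>n. \<epsilon> n + \<delta> n"] \<epsilon>(1) \<delta>(2) by simp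
  qed
  then show ?case using \<epsilon> \<delta> tendsto_add[OF \<epsilon>(2) \<delta>(1)]
    by (intro exI[of _ "\<lambda>n. \<epsilon> n + \<delta> n"]) simp
qed

text \<open>When the moduli of the eigenvalues differ, the eigenvectors of the limit serve as the basis: the
  residuals then tend to zero together with the difference of \<open>M\<close> and its limit.\<close>

lemma has_direction_hyperbolic:
  fixes M :: "nat \<Rightarrow> 'a::topological_space \<Rightarrow> complex^2^2" and A :: "'a \<Rightarrow> real^2^2"
  assumes K: "compact K"
    and M: "\<And>i j. unif_conv K (\<lambda>n x. M n x $ i $ j) (\<lambda>x. cmat (A x) $ i $ j)"
    and discr: "\<And>x. x \<in> K \<Longrightarrow> discr (A x) > 0"
    and \<eta>: "continuous_on K \<eta>" "continuous_on K \<eta>'"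
      "\<And>x. x \<in> K \<Longrightarrow> \<eta> x + \<eta>' x = complex_of_real (trace (A x))"
      "\<And>x. x \<in> K \<Longrightarrow> \<eta> x * \<eta>' x = complex_of_real (det (A x))" "\<And>x. x \<in> K \<Longrightarrow> det (A x) \<noteq> 0"
    and dominance: "(\<forall>x\<in>K. cmod (\<eta> x) < cmod (\<eta>' x)) \<or> (\<forall>x\<in>K. cmod (\<eta>' x) < cmod (\<eta> x))"
  shows "has_direction K M \<eta>"
proof -
  define a where "a x = complex_of_real (A x $ 1 $ 1)" for x
  define b where "b x = complex_of_real (A x $ 1 $ 2)" for x
  define c where "c x = complex_of_real (A x $ 2 $ 1)" for x
  define d where "d x = complex_of_real (A x $ 2 $ 2)" for x
  have entry: "cmat (A x) $ 1 $ 1 = a x" "cmat (A x) $ 1 $ 2 = b x" "cmat (A x) $ 2 $ 1 = c x" "cmat (A x) $ 2 $ 2 = d x" for x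
    by (simp_all add: a_def b_def c_def d_def map_matrix_def)
  note M' = M[of 1 1, unfolded entry] M[of 1 2, unfolded entry] M[of 2 1, unfolded entry] M[of 2 2, unfolded entry]
  note cont = M'[THEN unif_conv_continuous_limit]
  have tr: "\<eta> x + \<eta>' x = a x + d x" and dt: "\<eta> x * \<eta>' x = a x * d x - b x * c x" if "x \<in> K" for x
    using \<eta>(3,4)[OF that] by (simp_all add: a_def b_def c_def d_def trace_def sum_2 det_2)
  \<comment> \<open>The image of \<open>A - \<eta>'\<close> is the eigenline for \<open>\<eta>\<close>. The image of a fixed real vector may vanish at
    some point, but that of \<open>(1, \<i>)\<close> cannot: \<open>A - \<eta>'\<close> is real and not zero, so it does not annihilate
    both the real and the imaginary part.\<close>
  define u\<^sub>1 where "u\<^sub>1 x = a x - \<eta>' x + b x * \<i>" for x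
  define u\<^sub>2 where "u\<^sub>2 x = c x + (d x - \<eta>' x) * \<i>" for x
  define w\<^sub>1 where "w\<^sub>1 x = a x - \<eta> x + b x * \<i>" for x
  define w\<^sub>2 where "w\<^sub>2 x = c x + (d x - \<eta> x) * \<i>" for x
  have eig: "a x * u\<^sub>1 x + b x * u\<^sub>2 x = \<eta> x * u\<^sub>1 x" "c x * u\<^sub>1 x + d x * u\<^sub>2 x = \<eta> x * u\<^sub>2 x"
    "a x * w\<^sub>1 x + b x * w\<^sub>2 x = \<eta>' x * w\<^sub>1 x" "c x * w\<^sub>1 x + d x * w\<^sub>2 x = \<eta>' x * w\<^sub>2 x" if "x \<in> K" for x
  proof -
    have d: "d x = \<eta> x + \<eta>' x - a x" using tr[OF that] by (simp add: algebra_simps)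
    have bc: "b x * c x = a x * (\<eta> x + \<eta>' x - a x) - \<eta> x * \<eta>' x" using dt[OF that] by (simp add: d)
    show "a x * u\<^sub>1 x + b x * u\<^sub>2 x = \<eta> x * u\<^sub>1 x" "c x * u\<^sub>1 x + d x * u\<^sub>2 x = \<eta> x * u\<^sub>2 x"
      "a x * w\<^sub>1 x + b x * w\<^sub>2 x = \<eta>' x * w\<^sub>1 x" "c x * w\<^sub>1 x + d x * w\<^sub>2 x = \<eta>' x * w\<^sub>2 x"
      unfolding u\<^sub>1_def u\<^sub>2_def w\<^sub>1_def w\<^sub>2_def d using bc by algebra+
  qed
  have u: "unif_conv K (\<lambda>_. u\<^sub>1) u\<^sub>1" "unif_conv K (\<lambda>_. u\<^sub>2) u\<^sub>2" "unif_conv K (\<lambda>_. w\<^sub>1) w\<^sub>1" "unif_conv K (\<lambda>_. w\<^sub>2) w\<^sub>2"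
    unfolding u\<^sub>1_def u\<^sub>2_def w\<^sub>1_def w\<^sub>2_def by (intro unif_conv_const continuous_intros cont \<eta>(1,2))+
  have null: "unif_conv K (\<lambda>n x. f n x * u x + g n x * v x - h x * k x) (\<lambda>_. 0)"
    if "unif_conv K f f'" "unif_conv K g g'" "unif_conv K (\<lambda>_. u) u" "unif_conv K (\<lambda>_. v) v" "continuous_on K h"
      "unif_conv K (\<lambda>_. k) k" "\<And>x. x \<in> K \<Longrightarrow> f' x * u x + g' x * v x = h x * k x" for f g f' g' u v h k
    by (rule unif_conv_cong[OF _ _ unif_conv_diff[OF unif_conv_add[OF unif_conv_mult[OF K that(1,3)]
          unif_conv_mult[OF K that(2,4)]] unif_conv_mult[OF K unif_conv_const[OF that(5)] that(6)]]])
      (use that(7) in simp_all)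
  \<comment> \<open>The four residuals, collected in a list so that one null sequence dominates them all\<close>
  define e where "e i = [\<lambda>n x. M n x $ 1 $ 1 * u\<^sub>1 x + M n x $ 1 $ 2 * u\<^sub>2 x - \<eta> x * u\<^sub>1 x,
      \<lambda>n x. M n x $ 2 $ 1 * u\<^sub>1 x + M n x $ 2 $ 2 * u\<^sub>2 x - \<eta> x * u\<^sub>2 x,
      \<lambda>n x. M n x $ 1 $ 1 * w\<^sub>1 x + M n x $ 1 $ 2 * w\<^sub>2 x - \<eta>' x * w\<^sub>1 x,
      \<lambda>n x. M n x $ 2 $ 1 * w\<^sub>1 x + M n x $ 2 $ 2 * w\<^sub>2 x - \<eta>' x * w\<^sub>2 x] ! i" for i
  have "unif_conv K (e i) (\<lambda>_. 0)" if "i \<in> {..<4}" for i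
  proof -
    have "i = 0 \<or> i = 1 \<or> i = 2 \<or> i = 3" using that by auto
    then show ?thesis
      by (elim disjE) (simp_all add: e_def numeral_3_eq_3 numeral_2_eq_2 null[OF M'(1,2) u(1,2) \<eta>(1) u(1) eig(1)]
        null[OF M'(3,4) u(1,2) \<eta>(1) u(2) eig(2)] null[OF M'(1,2) u(3,4) \<eta>(2) u(3) eig(3)]
        null[OF M'(3,4) u(3,4) \<eta>(2) u(4) eig(4)])
  qed
  with common_majorant[of "{..<4::nat}" K e]
  have "\<exists>\<epsilon>. (\<forall>n. 0 \<le> \<epsilon> n) \<and> \<epsilon> \<longlonglongrightarrow> 0 \<and> (\<forall>i\<in>{..<4}. dominated K \<epsilon> (e i))" by simp
  then obtain \<epsilon> where \<epsilon>: "\<And>n. 0 \<le> \<epsilon> n" "\<epsilon> \<longlonglongrightarrow> 0"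
    "\<And>i. i < 4 \<Longrightarrow> dominated K \<epsilon> (e i)" by blast
  show ?thesis
  proof (rule has_direction_almost_diagonal[OF K M u _ unif_conv_const[OF \<eta>(1)] _ unif_conv_const[OF \<eta>(2)] _ \<epsilon>(1,2)])
    fix x assume x: "x \<in> K"
    have "complex_of_real (det (A x)) \<noteq> 0" using \<eta>(5)[OF x] by simp
    then show "\<eta> x \<noteq> 0" "\<eta>' x \<noteq> 0" using \<eta>(4)[OF x] by auto
    have "u\<^sub>1 x * w\<^sub>2 x - u\<^sub>2 x * w\<^sub>1 x = (\<eta> x - \<eta>' x) * ((b x + c x) + \<i> * (d x - a x))"
      unfolding u\<^sub>1_def u\<^sub>2_def w\<^sub>1_def w\<^sub>2_def by (simp add: algebra_simps)
    moreover have "(b x + c x) + \<i> * (d x - a x) \<noteq> 0"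
    proof
      assume "(b x + c x) + \<i> * (d x - a x) = 0"
      then have "A x $ 2 $ 1 = - (A x $ 1 $ 2)" "A x $ 2 $ 2 = A x $ 1 $ 1"
        by (auto simp: complex_eq_iff a_def b_def c_def d_def)
      then have "discr (A x) = - (2 * A x $ 1 $ 2)\<^sup>2"
        by (simp add: discr_def trace_def sum_2 det_2 power2_eq_square algebra_simps)
      with discr[OF x] show False by simp
    qed
    moreover have "\<eta> x \<noteq> \<eta>' x" using dominance x by auto
    ultimately show "u\<^sub>1 x * w\<^sub>2 x - u\<^sub>2 x * w\<^sub>1 x \<noteq> 0" by simp
  qed (use \<epsilon>(3)[of 0] \<epsilon>(3)[of 1] \<epsilon>(3)[of 2] \<epsilon>(3)[of 3] dominance in \<open>simp_all add: e_def numeral_3_eq_3 numeral_2_eq_2\<close>)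
qed

section \<open>The elliptic case\<close>

lemma abs_sqrt_minus_1_le:
  assumes "0 \<le> q" shows "\<bar>sqrt q - 1\<bar> \<le> \<bar>q - 1\<bar>"
proof -
  have "q - 1 = (sqrt q - 1) * (sqrt q + 1)" using assms by (simp add: algebra_simps)
  then have "\<bar>q - 1\<bar> = \<bar>sqrt q - 1\<bar> * (sqrt q + 1)" using assms by (simp add: abs_mult)
  moreover have "\<bar>sqrt q - 1\<bar> * 1 \<le> \<bar>sqrt q - 1\<bar> * (sqrt q + 1)"
    using assms by (intro mult_left_mono) auto
  ultimately show ?thesis by simp
qed

lemma unif_conv_sqrt_1:
  fixes q :: "nat \<Rightarrow> 'a::topological_space \<Rightarrow> real"
  assumes "unif_conv K q (\<lambda>_. 1)"
  shows "unif_conv K (\<lambda>n x. sqrt (q n x)) (\<lambda>_. 1)"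
    and "\<forall>\<^sub>F n in sequentially. \<forall>x\<in>K. 0 \<le> q n x"
proof -
  show nonneg: "\<forall>\<^sub>F n in sequentially. \<forall>x\<in>K. 0 \<le> q n x"
    using unif_convD[OF assms zero_less_one]
    by eventually_elim (force simp: dist_real_def)
  have "uniform_limit K (\<lambda>n x. sqrt (q n x)) (\<lambda>_. 1) sequentially"
  proof (rule uniform_limitI)
    fix e :: real assume "e > 0"
    from unif_convD[OF assms this] nonneg
    show "\<forall>\<^sub>F n in sequentially. \<forall>x\<in>K. dist (sqrt (q n x)) 1 < e"
      by eventually_elim (use abs_sqrt_minus_1_le in \<open>force simp: dist_real_def\<close>)
  qed
  moreover have "\<forall>\<^sub>F n in sequentially. continuous_on K (\<lambda>x. sqrt (q n x))"
    using assms by (auto simp: unif_conv_def elim!: eventually_mono intro: continuous_intros)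
  ultimately show "unif_conv K (\<lambda>n x. sqrt (q n x)) (\<lambda>_. 1)" by (simp add: unif_conv_def)
qed

text \<open>Here \<open>X\<close> is the real, slowly varying part and \<open>E\<close> the summable perturbation. An approximate
  solution \<open>t\<close> of the Riccati recursion of \<open>X\<close> with summable defect gives the direction \<open>(1, t)\<close>;
  because \<open>X\<close> is real, its conjugate is an equally good direction, belonging to the conjugate
  multiplier. The two multipliers have equal moduli exactly, not only in the limit.\<close>

lemma (in weight_sequence) has_direction_elliptic:
  fixes X :: "nat \<Rightarrow> 'a \<Rightarrow> real^2^2" and E :: "nat \<Rightarrow> 'a \<Rightarrow> complex^2^2" and A :: "'a \<Rightarrow> real^2^2"
  assumes X: "\<And>i j. unif_conv K (\<lambda>n x. X n x $ i $ j) (\<lambda>x. A x $ i $ j)"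
    and X_diff: "\<And>j n x i l. j \<in> {1..Suc m} \<Longrightarrow> n \<ge> 1 \<Longrightarrow> x \<in> K \<Longrightarrow> \<bar>fdiff j X n x $ i $ l\<bar> \<le> \<rho> n ^ j"
    and \<rho>_summable: "summable (\<lambda>n. \<rho> n ^ Suc m)"
    and E: "\<And>i j. unif_conv K (\<lambda>n x. E n x $ i $ j) (\<lambda>_. 0)" "\<And>i j. dominated K \<epsilon> (\<lambda>n x. E n x $ i $ j)"
    and \<epsilon>: "\<And>n. 0 \<le> \<epsilon> n" "summable \<epsilon>"
    and discr: "\<And>x. x \<in> K \<Longrightarrow> discr (A x) < 0"
    and \<eta>: "continuous_on K \<eta>"
      "\<And>x. x \<in> K \<Longrightarrow> \<eta> x * \<eta> x - complex_of_real (trace (A x)) * \<eta> x + complex_of_real (det (A x)) = 0"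
  shows "has_direction K (\<lambda>n x. cmat (X n x) + E n x) \<eta>"
proof -
  define a where "a n x = complex_of_real (X n x $ 1 $ 1)" for n x
  define b where "b n x = complex_of_real (X n x $ 1 $ 2)" for n x
  define c where "c n x = complex_of_real (X n x $ 2 $ 1)" for n x
  define d where "d n x = complex_of_real (X n x $ 2 $ 2)" for n x
  define a' where "a' x = complex_of_real (A x $ 1 $ 1)" for x
  define b' where "b' x = complex_of_real (A x $ 1 $ 2)" for x
  define c' where "c' x = complex_of_real (A x $ 2 $ 1)" for x
  define d' where "d' x = complex_of_real (A x $ 2 $ 2)" for x
  have Xc: "unif_conv K (\<lambda>n x. complex_of_real (X n x $ i $ j)) (\<lambda>x. complex_of_real (A x $ i $ j))" for i j
    by (rule unif_conv_of_real[OF X])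
  have conv: "unif_conv K a a'" "unif_conv K b b'" "unif_conv K c c'" "unif_conv K d d'"
    unfolding a_def[abs_def] b_def[abs_def] c_def[abs_def] d_def[abs_def]
      a'_def[abs_def] b'_def[abs_def] c'_def[abs_def] d'_def[abs_def] by (rule Xc)+
  note cont = conv[THEN unif_conv_continuous_limit]
  have graded: "graded (Suc m) 0 a" "graded (Suc m) 0 b" "graded (Suc m) 0 c" "graded (Suc m) 0 d"
    unfolding a_def[abs_def] b_def[abs_def] c_def[abs_def] d_def[abs_def]
    by (rule graded_entry[OF Xc X_diff]; assumption)+
  define \<xi> where "\<xi> x = 2 * \<eta> x - (a' x + d' x)" for x
  have \<xi>_cont: "continuous_on K \<xi>" unfolding \<xi>_def by (intro continuous_intros \<eta>(1) cont)
  have discr_X: "complex_of_real (discr (X n x)) = (a n x - d n x) * (a n x - d n x) + 4 * b n x * c n x" for n x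
    unfolding a_def b_def c_def d_def
    by (simp add: discr_def trace_def sum_2 det_2 power2_eq_square algebra_simps)
  have \<xi>_sq: "\<xi> x * \<xi> x = complex_of_real (discr (A x))" if "x \<in> K" for x
  proof -
    have "\<eta> x * \<eta> x - (a' x + d' x) * \<eta> x + (a' x * d' x - b' x * c' x) = 0"
      using \<eta>(2)[OF that] by (simp add: a'_def b'_def c'_def d'_def trace_def sum_2 det_2)
    then have "\<xi> x * \<xi> x = (a' x + d' x) * (a' x + d' x) - 4 * (a' x * d' x - b' x * c' x)"
      unfolding \<xi>_def by algebra
    then show ?thesis
      by (simp add: a'_def b'_def c'_def d'_def discr_def trace_def sum_2 det_2 power2_eq_square)
  qed
  have \<xi>_imag: "Im (\<xi> x) \<noteq> 0" if "x \<in> K" for x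
  proof
    assume "Im (\<xi> x) = 0"
    then have "Re (\<xi> x * \<xi> x) \<ge> 0" by simp
    with discr[OF that] show False unfolding \<xi>_sq[OF that] by simp
  qed
  have b'_nz: "b' x \<noteq> 0" if "x \<in> K" for x
  proof
    assume "b' x = 0"
    then have "discr (A x) = (A x $ 1 $ 1 - A x $ 2 $ 2)\<^sup>2"
      by (simp add: b'_def discr_def trace_def sum_2 det_2 power2_eq_square algebra_simps)
    with discr[OF that] show False by simp
  qed

  \<comment> \<open>The branch of the square root of the discriminant of \<open>X\<^sub>n\<close> that tends to \<open>\<xi>\<close>\<close>
  define \<xi>' where "\<xi>' n x = \<xi> x * complex_of_real (sqrt (discr (X n x) / discr (A x)))" for n x
  have "unif_conv K (\<lambda>n x. discr (X n x)) (\<lambda>x. discr (A x))"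
    unfolding discr_def trace_def sum_2 det_2 power2_eq_square
    by (intro unif_conv_diff unif_conv_mult unif_conv_add compact X unif_conv_const continuous_on_const)
  then have discr_conv: "unif_conv K (\<lambda>n x. discr (X n x)) (\<lambda>x. discr (A x))" .
  have "unif_conv K (\<lambda>n x. discr (X n x) / discr (A x)) (\<lambda>x. discr (A x) / discr (A x))"
    using discr by (intro unif_conv_divide[OF compact discr_conv] unif_conv_const
        unif_conv_continuous_limit[OF discr_conv]) force
  then have ratio: "unif_conv K (\<lambda>n x. discr (X n x) / discr (A x)) (\<lambda>_. 1)"
    by (rule unif_conv_cong[rotated 2]) (use discr in force)+
  have \<xi>'_conv: "unif_conv K \<xi>' \<xi>"
    using unif_conv_mult[OF compact unif_conv_const[OF \<xi>_cont] unif_conv_of_real[OF unif_conv_sqrt_1(1)[OF ratio]]]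
    unfolding \<xi>'_def[abs_def] by simp
  have \<xi>'_sq: "\<forall>\<^sub>F n in sequentially. \<forall>x\<in>K. \<xi>' n x * \<xi>' n x = complex_of_real (discr (X n x))"
    using unif_conv_sqrt_1(2)[OF ratio]
  proof eventually_elim
    case (elim n)
    show ?case
    proof
      fix x assume x: "x \<in> K"
      have "\<xi>' n x * \<xi>' n x = \<xi> x * \<xi> x * complex_of_real (sqrt (discr (X n x) / discr (A x)) * sqrt (discr (X n x) / discr (A x)))"
        unfolding \<xi>'_def by (simp only: of_real_mult mult_ac)
      also have "sqrt (discr (X n x) / discr (A x)) * sqrt (discr (X n x) / discr (A x)) = discr (X n x) / discr (A x)"
        using elim x abs_of_nonneg unfolding real_sqrt_mult_self by blast
      finally show "\<xi>' n x * \<xi>' n x = complex_of_real (discr (X n x))"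
        using discr[OF x] by (simp add: \<xi>_sq[OF x])
    qed
  qed
  have "graded (Suc m) 0 (\<lambda>n x. complex_of_real (discr (X n x)))"
  proof -
    have "graded (Suc m) 0 (\<lambda>n x. (a n x - d n x) * (a n x - d n x) + 4 * b n x * c n x)"
      using graded_mult[of "Suc m" 0 _ 0, simplified] graded_const graded
      by (intro graded_add graded_mult[of "Suc m" 0 _ 0, simplified] graded_diff) auto
    then show ?thesis by (simp only: discr_X)
  qed
  then have \<xi>'_graded: "graded (Suc m) 0 \<xi>'"
    using \<xi>'_conv \<xi>'_sq \<xi>_imag by (rule_tac graded_sqrt[where l = \<xi>]) force+

  \<comment> \<open>The slope of the eigenvector of \<open>X\<^sub>n\<close>, a fixed point of its Moebius map\<close>
  define t\<^sub>0 where "t\<^sub>0 n x = (d n x - a n x + \<xi>' n x) * inverse (2 * b n x)" for n x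
  define \<tau> where "\<tau> x = (d' x - a' x + \<xi> x) * inverse (2 * b' x)" for x
  have b2: "unif_conv K (\<lambda>n x. 2 * b n x) (\<lambda>x. 2 * b' x)"
    by (intro unif_conv_mult compact conv unif_conv_const continuous_on_const)
  have t\<^sub>0_conv: "unif_conv K t\<^sub>0 \<tau>"
    unfolding t\<^sub>0_def[abs_def] \<tau>_def[abs_def]
    by (intro unif_conv_mult unif_conv_add unif_conv_diff unif_conv_inverse b2 compact conv \<xi>'_conv)
      (use b'_nz in auto)
  have t\<^sub>0_graded: "graded (Suc m) 0 t\<^sub>0"
  proof -
    have "graded (Suc m) 0 (\<lambda>n x. 2 * b n x)" using graded_mult[OF graded_const graded(2)] by simp
    then have "graded (Suc m) 0 (\<lambda>n x. inverse (2 * b n x))"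
      by (rule graded_inverse[OF _ b2]) (use b'_nz in auto)
    then have "graded (Suc m) (0 + 0) t\<^sub>0"
      unfolding t\<^sub>0_def[abs_def] by (intro graded_mult graded_add graded_diff graded \<xi>'_graded)
    then show ?thesis by simp
  qed
  have F\<^sub>0: "graded m (Suc 0) (defect a b c d t\<^sub>0)"
  proof (rule graded_cong)
    note low = graded_weaken[of m 1 0 0, simplified]
    have "graded m 0 (\<lambda>n x. a n x + b n x * t\<^sub>0 n x)"
      using graded_add[OF low[OF graded(1)] graded_mult[OF low[OF graded(2)] low[OF t\<^sub>0_graded], simplified]] .
    moreover have "graded m (Suc 0) (\<lambda>n x. t\<^sub>0 (Suc n) x - t\<^sub>0 n x)" using t\<^sub>0_graded by (simp add: graded_Suc)
    ultimately show "graded m (Suc 0) (\<lambda>n x. (t\<^sub>0 (Suc n) x - t\<^sub>0 n x) * (a n x + b n x * t\<^sub>0 n x))"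
      using graded_mult[of m "Suc 0" _ 0] by simp
    have "\<forall>\<^sub>F n in sequentially. \<forall>x\<in>K. 2 * b n x \<noteq> 0"
      by (rule unif_conv_nonzero[OF compact b2]) (use b'_nz in auto)
    then show "\<forall>\<^sub>F n in sequentially. \<forall>x\<in>K. defect a b c d t\<^sub>0 n x
        = (t\<^sub>0 (Suc n) x - t\<^sub>0 n x) * (a n x + b n x * t\<^sub>0 n x)"
      using \<xi>'_sq
    proof eventually_elim
      case (elim n)
      show ?case
      proof
        fix x assume x: "x \<in> K"
        have nz: "2 * b n x \<noteq> 0" using elim x by blast
        have t: "2 * b n x * t\<^sub>0 n x = d n x - a n x + \<xi>' n x" using nz by (simp add: t\<^sub>0_def)
        have sq: "\<xi>' n x * \<xi>' n x = (a n x - d n x) * (a n x - d n x) + 4 * b n x * c n x"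
          using elim x by (simp add: discr_X)
        have "2 * (2 * b n x) * (t\<^sub>0 n x * (a n x + b n x * t\<^sub>0 n x) - (c n x + d n x * t\<^sub>0 n x)) = 0"
          using t sq by algebra
        then have "t\<^sub>0 n x * (a n x + b n x * t\<^sub>0 n x) = c n x + d n x * t\<^sub>0 n x" using nz by simp
        then show "defect a b c d t\<^sub>0 n x = (t\<^sub>0 (Suc n) x - t\<^sub>0 n x) * (a n x + b n x * t\<^sub>0 n x)"
          unfolding defect_def by (simp add: left_diff_distrib)
      qed
    qed
  qed
  have two_b\<tau>: "2 * b' x * \<tau> x = d' x - a' x + \<xi> x" if "x \<in> K" for x
    using b'_nz[OF that] by (simp add: \<tau>_def)
  have simple: "a' x - d' x + 2 * b' x * \<tau> x \<noteq> 0" if "x \<in> K" for x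
    using \<xi>_imag[OF that] unfolding two_b\<tau>[OF that] by force
  note low = graded_weaken[of m 1 0 0, simplified]
  from approximate_riccati_solution[OF low[OF graded(1)] low[OF graded(2)] low[OF graded(4)] conv t\<^sub>0_conv
      simple low[OF t\<^sub>0_graded] F\<^sub>0]
  obtain t where t: "unif_conv K t \<tau>" and F: "dominated K (\<lambda>n. \<rho> n ^ Suc m) (defect a b c d t)" by auto

  define \<delta> where "\<delta> n = \<epsilon> n + \<rho> n ^ Suc m" for n
  have \<delta>: "0 \<le> \<delta> n" for n using \<epsilon>(1) nonneg by (simp add: \<delta>_def)
  have \<delta>_summable: "summable \<delta>" unfolding \<delta>_def by (intro summable_add \<epsilon>(2) \<rho>_summable)
  have E_dom: "dominated K \<delta> (\<lambda>n x. E n x $ i $ j)" for i j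
    using dominated_mono[OF E(2) \<epsilon>(1), of 1 \<delta>] nonneg by (simp add: \<delta>_def)
  have F_dom: "dominated K \<delta> (defect a b c d t)"
    by (rule dominated_mono[OF F, of 1]) (simp_all add: \<delta>_def \<epsilon>(1) nonneg del: power_Suc)
  have F_dom': "dominated K \<delta> (\<lambda>n x. cnj (defect a b c d t n x))"
    using F_dom by (simp add: dominated_def)
  define p where "p n x = a n x + b n x * t n x" for n x
  have "unif_conv K p (\<lambda>x. a' x + b' x * \<tau> x)"
    unfolding p_def[abs_def] by (intro unif_conv_add unif_conv_mult compact conv t)
  then have p: "unif_conv K p \<eta>"
  proof (rule unif_conv_cong[rotated 2])
    fix x assume "x \<in> K"
    then have "2 * (a' x + b' x * \<tau> x) = 2 * \<eta> x" using two_b\<tau>[of x] by (simp add: \<xi>_def algebra_simps)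
    then show "\<eta> x = a' x + b' x * \<tau> x" by (metis mult_cancel_left zero_neq_numeral)
  qed simp
  have \<eta>_nz: "\<eta> x \<noteq> 0" if "x \<in> K" for x
  proof -
    have "Im (\<xi> x) = 2 * Im (\<eta> x)" by (simp add: \<xi>_def a'_def d'_def)
    with \<xi>_imag[OF that] show ?thesis by auto
  qed
  have entry: "(cmat (X n x) + E n x) $ 1 $ 1 = a n x + E n x $ 1 $ 1"
    "(cmat (X n x) + E n x) $ 1 $ 2 = b n x + E n x $ 1 $ 2"
    "(cmat (X n x) + E n x) $ 2 $ 1 = c n x + E n x $ 2 $ 1"
    "(cmat (X n x) + E n x) $ 2 $ 2 = d n x + E n x $ 2 $ 2" for n x
    by (simp_all add: a_def b_def c_def d_def map_matrix_def)
  have real: "cnj (a n x) = a n x" "cnj (b n x) = b n x" "cnj (c n x) = c n x" "cnj (d n x) = d n x" for n x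
    by (simp_all add: a_def b_def c_def d_def)
  note Et = dominated_mult_unif_conv[OF compact t E_dom \<delta>]
  note Et' = dominated_mult_unif_conv[OF compact unif_conv_cnj[OF t] E_dom \<delta>]
  have one: "unif_conv K (\<lambda>_ _. 1) (\<lambda>_. 1 :: complex)" by (intro unif_conv_const continuous_on_const)
  show ?thesis
  proof (rule has_direction_almost_diagonal[where A = "\<lambda>x. cmat (A x)" and \<epsilon> = \<delta> and p = p and q = "\<lambda>n x. cnj (p n x)",
        OF compact _ one t one unif_conv_cnj[OF t] _ p \<eta>_nz unif_conv_cnj[OF p] _ \<delta> summable_LIMSEQ_zero[OF \<delta>_summable]])
    show "unif_conv K (\<lambda>n x. (cmat (X n x) + E n x) $ i $ j) (\<lambda>x. cmat (A x) $ i $ j)" for i j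
      using unif_conv_add[OF Xc[of i j] E(1)[of i j]] by (simp add: map_matrix_def)
    fix x assume x: "x \<in> K"
    have "Im (2 * b' x * \<tau> x) \<noteq> 0" using \<xi>_imag[OF x] unfolding two_b\<tau>[OF x] by (simp add: a'_def d'_def)
    then have "Im (\<tau> x) \<noteq> 0" by (auto simp: b'_def)
    then show "1 * cnj (\<tau> x) - \<tau> x * 1 \<noteq> 0" by (auto simp: complex_eq_iff)
    show "cnj (\<eta> x) \<noteq> 0" using \<eta>_nz[OF x] by simp
  next
    show "dominated K \<delta> (\<lambda>n x. (cmat (X n x) + E n x) $ 1 $ 1 * 1 + (cmat (X n x) + E n x) $ 1 $ 2 * t n x - p n x * 1)"
      using dominated_add[OF E_dom[of 1 1] Et[of 1 2]]
      unfolding entry p_def by (simp add: algebra_simps)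
    show "dominated K \<delta> (\<lambda>n x. (cmat (X n x) + E n x) $ 2 $ 1 * 1 + (cmat (X n x) + E n x) $ 2 $ 2 * t n x - p n x * t (Suc n) x)"
      using dominated_diff[OF dominated_add[OF E_dom[of 2 1] Et[of 2 2]] F_dom]
      unfolding entry p_def defect_def by (simp add: algebra_simps)
    show "dominated K \<delta> (\<lambda>n x. (cmat (X n x) + E n x) $ 1 $ 1 * 1 + (cmat (X n x) + E n x) $ 1 $ 2 * cnj (t n x) - cnj (p n x) * 1)"
      using dominated_add[OF E_dom[of 1 1] Et'[of 1 2]]
      unfolding entry p_def by (simp add: algebra_simps real)
    show "dominated K \<delta> (\<lambda>n x. (cmat (X n x) + E n x) $ 2 $ 1 * 1 + (cmat (X n x) + E n x) $ 2 $ 2 * cnj (t n x) - cnj (p n x) * cnj (t (Suc n) x))"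
      using dominated_diff[OF dominated_add[OF E_dom[of 2 1] Et'[of 2 2]] F_dom']
      unfolding entry p_def defect_def by (simp add: algebra_simps real)
    show "(summable \<delta> \<and> (\<forall>\<^sub>F n in sequentially. \<forall>x\<in>K. cmod (p n x) = cmod (cnj (p n x))))
        \<or> (\<forall>x\<in>K. cmod (\<eta> x) < cmod (cnj (\<eta> x))) \<or> (\<forall>x\<in>K. cmod (cnj (\<eta> x)) < cmod (\<eta> x))"
      using \<delta>_summable by simp
  qed
qed

section \<open>Solutions with prescribed direction\<close>

lemma uniform_limit_vec2:
  fixes f g :: "nat \<Rightarrow> 'a::topological_space \<Rightarrow> complex"
  assumes "unif_conv K f l" "unif_conv K g m" "e > 0"
  shows "\<forall>\<^sub>F n in sequentially. \<forall>x\<in>K. norm (vector [f n x, g n x] - vector [l x, m x] :: complex^2) < e"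
  using unif_convD[OF assms(1) half_gt_zero[OF assms(3)]] unif_convD[OF assms(2) half_gt_zero[OF assms(3)]]
proof eventually_elim
  case (elim n)
  show ?case
  proof
    fix x assume x: "x \<in> K"
    have "norm (vector [f n x, g n x] - vector [l x, m x] :: complex^2)
        \<le> (\<Sum>i\<in>UNIV. norm ((vector [f n x, g n x] - vector [l x, m x] :: complex^2) $ i))"
      unfolding norm_vec_def by (rule L2_set_le_sum) simp
    also have "\<dots> = dist (f n x) (l x) + dist (g n x) (m x)"
      by (simp add: sum_2 dist_norm)
    also have "\<dots> < e / 2 + e / 2" using elim x by (intro add_strict_mono) auto
    finally show "norm (vector [f n x, g n x] - vector [l x, m x] :: complex^2) < e" by simp
  qed
qed

lemma continuous_on_vec2:
  fixes f g :: "'a::topological_space \<Rightarrow> complex"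
  assumes "continuous_on K f" "continuous_on K g"
  shows "continuous_on K (\<lambda>x. vector [f x, g x] :: complex^2)"
proof -
  have eq: "(\<lambda>x. vector [f x, g x] :: complex^2) = (\<lambda>x. \<chi> i. if i = 1 then f x else g x)"
    by (simp add: fun_eq_iff vec_eq_iff forall_2)
  have "continuous_on K (\<lambda>x. if i = 1 then f x else g x)" for i :: 2
    using assms by (cases "i = 1") auto
  then show ?thesis unfolding eq by (rule continuous_on_vec_lambda)
qed

lemma matrix_vector_mult_2:
  "((A :: complex^2^2) *v v) = vector [A $ 1 $ 1 * v $ 1 + A $ 1 $ 2 * v $ 2, A $ 2 $ 1 * v $ 1 + A $ 2 $ 2 * v $ 2]"
  by (simp add: vec_eq_iff forall_2 matrix_vector_mult_def sum_2)

lemma scalar_mult_vec2: "c *s (vector [a, b] :: complex^2) = vector [c * a, c * b]"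
  by (simp add: vec_eq_iff forall_2)

lemma invertible_linear_solve_continuous:
  fixes M :: "'a::topological_space \<Rightarrow> complex^2^2" and z :: "'a \<Rightarrow> complex^2"
  assumes "continuous_on K M" "continuous_on K z" "\<And>x. x \<in> K \<Longrightarrow> invertible (M x)"
  shows "\<exists>y. continuous_on K y \<and> (\<forall>x\<in>K. M x *v y x = z x)"
proof -
  define y :: "'a \<Rightarrow> complex^2" where "y x = vector [
    (M x $ 2 $ 2 * z x $ 1 - M x $ 1 $ 2 * z x $ 2) / det (M x),
    (M x $ 1 $ 1 * z x $ 2 - M x $ 2 $ 1 * z x $ 1) / det (M x)]" for x
  have nz: "det (M x) \<noteq> 0" if "x \<in> K" for x using assms(3)[OF that] by (simp add: invertible_det_nz)
  have "continuous_on K y"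
    unfolding y_def using nz assms(1,2) by (intro continuous_on_vec2 continuous_intros) (auto simp: det_2 intro!: continuous_intros)
  moreover have "M x *v y x = z x" if "x \<in> K" for x
  proof -
    have "(a * ((d * u - b * v) / D) + b * ((a * v - c * u) / D)) = u"
      "(c * ((d * u - b * v) / D) + d * ((a * v - c * u) / D)) = v"
      if "D = a * d - b * c" "D \<noteq> 0" for a b c d u v D :: complex
      using that(2) by (simp_all add: field_simps) (simp_all add: that(1) algebra_simps)
    from this[of "det (M x)"] nz[OF that]
    show ?thesis by (simp add: vec_eq_iff forall_2 matrix_vector_mult_2 y_def det_2)
  qed
  ultimately show ?thesis by blast
qed

text \<open>The earlier values are found one step at a time, and Cramer's rule keeps them continuous.\<close>

lemma backward_extension:
  fixes M :: "nat \<Rightarrow> 'a::topological_space \<Rightarrow> complex^2^2" and z :: "'a \<Rightarrow> complex^2"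
  assumes "\<And>n. n \<ge> 1 \<Longrightarrow> continuous_on K (M n)" "\<And>n x. n \<ge> 1 \<Longrightarrow> x \<in> K \<Longrightarrow> invertible (M n x)"
    and "continuous_on K z" "N \<ge> 1"
  shows "\<exists>\<Phi>. (\<forall>n\<in>{1..N}. continuous_on K (\<Phi> n)) \<and> \<Phi> N = z \<and>
    (\<forall>n\<in>{1..<N}. \<forall>x\<in>K. \<Phi> (Suc n) x = M n x *v \<Phi> n x)"
  using assms(4,3)
proof (induction N arbitrary: z rule: dec_induct)
  case base
  then show ?case by (intro exI[of _ "\<lambda>_. z"]) auto
next
  case (step N)
  obtain y where y: "continuous_on K y" "\<forall>x\<in>K. M N x *v y x = z x"
    using invertible_linear_solve_continuous[of K "M N" z] assms(1,2) step by auto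
  obtain \<Phi> where \<Phi>: "\<forall>n\<in>{1..N}. continuous_on K (\<Phi> n)" "\<Phi> N = y"
    "\<forall>n\<in>{1..<N}. \<forall>x\<in>K. \<Phi> (Suc n) x = M n x *v \<Phi> n x"
    using step.IH[OF y(1)] by blast
  show ?case
    using \<Phi> y step.prems by (intro exI[of _ "\<Phi>(Suc N := z)"]) (auto simp: less_Suc_eq le_Suc_eq)
qed

text \<open>The multipliers are replaced by \<open>1\<close> below the index \<open>N\<close> from which on everything is continuous and
  nonvanishing. This changes neither the limits nor the quotients, because \<open>\<Phi> n\<close> is defined with the
  modified product for \<open>n \<ge> N\<close>. For \<open>n < N\<close> the values of \<open>\<Phi>\<close> come from solving backwards if all
  matrices are invertible, and are arbitrary otherwise.\<close>

lemma solution_from_direction: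
  fixes M :: "nat \<Rightarrow> real \<Rightarrow> complex^2^2" and A :: "real \<Rightarrow> complex^2^2"
  assumes K: "compact K"
    and M_cont: "\<And>n. n \<ge> 1 \<Longrightarrow> continuous_on K (M n)"
    and M: "\<And>i j. unif_conv K (\<lambda>n x. M n x $ i $ j) (\<lambda>x. A x $ i $ j)"
    and \<eta>: "\<And>x. x \<in> K \<Longrightarrow> \<eta> x \<noteq> 0"
    and dir: "has_direction K M \<eta>"
  shows "\<exists>(\<Phi> :: nat \<Rightarrow> real \<Rightarrow> complex^2) (\<mu> :: nat \<Rightarrow> real \<Rightarrow> complex) (v :: real \<Rightarrow> complex^2) (N :: nat).
    (\<forall>n\<ge>1. continuous_on K (\<Phi> n)) \<and>
    (\<forall>n\<ge>1. continuous_on K (\<mu> n) \<and> (\<forall>x\<in>K. \<mu> n x \<noteq> 0)) \<and>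
    continuous_on K v \<and>
    N \<ge> 1 \<and>
    ((\<forall>n\<ge>1. \<forall>x\<in>K. invertible (M n x)) \<longrightarrow> N = 1) \<and>
    (\<forall>n\<ge>N. \<forall>x\<in>K. \<Phi> (Suc n) x = M n x *v \<Phi> n x) \<and>
    (\<lambda>n. sup_on K (\<lambda>x. cmod (\<mu> n x - \<eta> x))) \<longlonglongrightarrow> 0 \<and>
    (\<lambda>n. sup_on K (\<lambda>x. norm (inverse (\<Prod>j\<in>{1..<n}. \<mu> j x) *s \<Phi> n x - v x))) \<longlonglongrightarrow> 0 \<and>
    (\<forall>x\<in>K. is_eigenvector (A x) (\<eta> x) (v x))"
proof -
  obtain f\<^sub>1 f\<^sub>2 v\<^sub>1 v\<^sub>2 \<mu> where f: "unif_conv K f\<^sub>1 v\<^sub>1" "unif_conv K f\<^sub>2 v\<^sub>2" and \<mu>: "unif_conv K \<mu> \<eta>"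
    and v: "\<forall>x\<in>K. v\<^sub>1 x \<noteq> 0 \<or> v\<^sub>2 x \<noteq> 0"
    and rel: "\<forall>\<^sub>F n in sequentially. \<forall>x\<in>K.
        M n x $ 1 $ 1 * f\<^sub>1 n x + M n x $ 1 $ 2 * f\<^sub>2 n x = \<mu> n x * f\<^sub>1 (Suc n) x \<and>
        M n x $ 2 $ 1 * f\<^sub>1 n x + M n x $ 2 $ 2 * f\<^sub>2 n x = \<mu> n x * f\<^sub>2 (Suc n) x"
    using dir unfolding has_direction_def by blast
  have \<mu>_nz: "\<forall>\<^sub>F n in sequentially. \<forall>x\<in>K. \<mu> n x \<noteq> 0" by (rule unif_conv_nonzero[OF K \<mu> \<eta>])
  have "\<forall>\<^sub>F n in sequentially. continuous_on K (f\<^sub>1 n)" "\<forall>\<^sub>F n in sequentially. continuous_on K (f\<^sub>2 n)"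
    "\<forall>\<^sub>F n in sequentially. continuous_on K (\<mu> n)" using f \<mu> by (simp_all add: unif_conv_def)
  with rel \<mu>_nz eventually_ge_at_top[of "1::nat"]
  have "\<forall>\<^sub>F n in sequentially. 1 \<le> n \<and> continuous_on K (f\<^sub>1 n) \<and> continuous_on K (f\<^sub>2 n) \<and> continuous_on K (\<mu> n) \<and>
    (\<forall>x\<in>K. \<mu> n x \<noteq> 0) \<and> (\<forall>x\<in>K.
        M n x $ 1 $ 1 * f\<^sub>1 n x + M n x $ 1 $ 2 * f\<^sub>2 n x = \<mu> n x * f\<^sub>1 (Suc n) x \<and>
        M n x $ 2 $ 1 * f\<^sub>1 n x + M n x $ 2 $ 2 * f\<^sub>2 n x = \<mu> n x * f\<^sub>2 (Suc n) x)"
    by eventually_elim blast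
  then obtain N where N: "\<And>n. n \<ge> N \<Longrightarrow> 1 \<le> n \<and> continuous_on K (f\<^sub>1 n) \<and> continuous_on K (f\<^sub>2 n) \<and> continuous_on K (\<mu> n) \<and>
    (\<forall>x\<in>K. \<mu> n x \<noteq> 0) \<and> (\<forall>x\<in>K.
        M n x $ 1 $ 1 * f\<^sub>1 n x + M n x $ 1 $ 2 * f\<^sub>2 n x = \<mu> n x * f\<^sub>1 (Suc n) x \<and>
        M n x $ 2 $ 1 * f\<^sub>1 n x + M n x $ 2 $ 2 * f\<^sub>2 n x = \<mu> n x * f\<^sub>2 (Suc n) x)"
    unfolding eventually_sequentially by blast
  define \<phi> :: "nat \<Rightarrow> real \<Rightarrow> complex^2" where "\<phi> n x = vector [f\<^sub>1 n x, f\<^sub>2 n x]" for n x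
  define V :: "real \<Rightarrow> complex^2" where "V x = vector [v\<^sub>1 x, v\<^sub>2 x]" for x
  define \<nu> where "\<nu> n x = (if n < N then 1 else \<mu> n x)" for n x
  have \<phi>_rel: "M n x *v \<phi> n x = \<mu> n x *s \<phi> (Suc n) x" if "n \<ge> N" "x \<in> K" for n x
    using N[OF that(1)] that(2) by (simp add: \<phi>_def matrix_vector_mult_2 scalar_mult_vec2)
  have \<phi>_cont: "continuous_on K (\<phi> n)" if "n \<ge> N" for n
    unfolding \<phi>_def using N[OF that] by (intro continuous_on_vec2) auto
  have N1: "N \<ge> 1" using N[of N] by simp

  obtain \<Psi> where \<Psi>: "\<forall>n\<in>{1..N}. continuous_on K (\<Psi> n)" "\<Psi> N = \<phi> N"
    "(\<forall>n\<ge>1. \<forall>x\<in>K. invertible (M n x)) \<longrightarrow> (\<forall>n\<in>{1..<N}. \<forall>x\<in>K. \<Psi> (Suc n) x = M n x *v \<Psi> n x)"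
  proof (cases "\<forall>n\<ge>1. \<forall>x\<in>K. invertible (M n x)")
    case True
    have "\<exists>\<Psi>. (\<forall>n\<in>{1..N}. continuous_on K (\<Psi> n)) \<and> \<Psi> N = \<phi> N \<and>
        (\<forall>n\<in>{1..<N}. \<forall>x\<in>K. \<Psi> (Suc n) x = M n x *v \<Psi> n x)"
      by (rule backward_extension) (use M_cont True \<phi>_cont N1 in auto)
    then show thesis using that by blast
  next
    case False
    show thesis by (rule that[of "\<lambda>_. \<phi> N"]) (use False \<phi>_cont in auto)
  qed
  define P where "P n x = (\<Prod>j\<in>{1..<n}. \<nu> j x)" for n x
  define \<Phi> where "\<Phi> n x = (if n < N then \<Psi> n x else P n x *s \<phi> n x)" for n x
  have P_N: "P N x = 1" for x unfolding P_def \<nu>_def by (rule prod.neutral) auto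
  have P_Suc: "P (Suc n) x = P n x * \<mu> n x" if "n \<ge> N" for n x
    using that N1 by (simp add: P_def \<nu>_def)
  have \<nu>_cont: "continuous_on K (\<nu> n)" for n
    using N[of n] by (cases "n < N") (auto simp: \<nu>_def[abs_def])
  have \<nu>_nz: "\<nu> n x \<noteq> 0" if "x \<in> K" for n x using N[of n] that by (cases "n < N") (auto simp: \<nu>_def)
  have P_nz: "P n x \<noteq> 0" if "x \<in> K" for n x unfolding P_def using \<nu>_nz[OF that] by simp
  have \<Phi>_N: "\<Phi> N = \<Psi> N" by (simp add: fun_eq_iff \<Phi>_def P_N \<Psi>(2))

  have "\<forall>n\<ge>1. continuous_on K (\<Phi> n)"
  proof (intro allI impI)
    fix n :: nat assume "n \<ge> 1"
    show "continuous_on K (\<Phi> n)"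
    proof (cases "n < N")
      case True
      then show ?thesis using \<Psi>(1) \<open>n \<ge> 1\<close> by (simp add: \<Phi>_def[abs_def])
    next
      case False
      have "continuous_on K (\<lambda>x. vector [P n x * f\<^sub>1 n x, P n x * f\<^sub>2 n x] :: complex^2)"
        unfolding P_def using False N[of n]
        by (intro continuous_on_vec2 continuous_on_mult continuous_on_prod \<nu>_cont) auto
      then show ?thesis using False by (simp add: \<Phi>_def[abs_def] \<phi>_def scalar_mult_vec2)
    qed
  qed
  moreover have "\<forall>n\<ge>1. continuous_on K (\<nu> n) \<and> (\<forall>x\<in>K. \<nu> n x \<noteq> 0)" using \<nu>_cont \<nu>_nz by blast
  moreover have "continuous_on K V"
    unfolding V_def using f by (intro continuous_on_vec2) (auto dest: unif_conv_continuous_limit)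
  moreover have late: "\<Phi> (Suc n) x = M n x *v \<Phi> n x" if "n \<ge> N" "x \<in> K" for n x
  proof -
    have "M n x *v (P n x *s \<phi> n x) = P n x *s (\<mu> n x *s \<phi> (Suc n) x)"
      by (simp add: \<phi>_rel[OF that, symmetric] vec_eq_iff forall_2 matrix_vector_mult_2 algebra_simps)
    then show ?thesis using that by (simp add: \<Phi>_def P_Suc vec_eq_iff mult_ac)
  qed
  moreover have "\<exists>N'\<ge>1. ((\<forall>n\<ge>1. \<forall>x\<in>K. invertible (M n x)) \<longrightarrow> N' = 1) \<and>
      (\<forall>n\<ge>N'. \<forall>x\<in>K. \<Phi> (Suc n) x = M n x *v \<Phi> n x)"
  proof (cases "\<forall>n\<ge>1. \<forall>x\<in>K. invertible (M n x)")
    case True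
    have "\<Phi> (Suc n) x = M n x *v \<Phi> n x" if "n \<ge> 1" "x \<in> K" for n x
    proof (cases "n < N")
      case n: True
      have "\<Phi> (Suc n) x = \<Psi> (Suc n) x"
        using n \<Phi>_N by (cases "Suc n = N") (auto simp: \<Phi>_def)
      then show ?thesis using n \<Psi>(3) True that by (simp add: \<Phi>_def)
    qed (use late that in auto)
    then show ?thesis by (intro exI[of _ 1]) auto
  next
    case False
    then show ?thesis using late N1 by (intro exI[of _ N]) auto
  qed
  moreover have "(\<lambda>n. sup_on K (\<lambda>x. cmod (\<nu> n x - \<eta> x))) \<longlonglongrightarrow> 0"
  proof (rule sup_on_tendsto_0)
    fix e :: real assume "e > 0"
    from unif_convD[OF \<mu> this] eventually_ge_at_top[of N]
    show "\<forall>\<^sub>F n in sequentially. \<forall>x\<in>K. cmod (\<nu> n x - \<eta> x) < e"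
      by eventually_elim (simp add: \<nu>_def dist_norm)
  qed simp
  moreover have "(\<lambda>n. sup_on K (\<lambda>x. norm (inverse (\<Prod>j\<in>{1..<n}. \<nu> j x) *s \<Phi> n x - V x))) \<longlonglongrightarrow> 0"
  proof (rule sup_on_tendsto_0)
    fix e :: real assume "e > 0"
    from uniform_limit_vec2[OF f this] eventually_ge_at_top[of N]
    show "\<forall>\<^sub>F n in sequentially. \<forall>x\<in>K. norm (inverse (\<Prod>j\<in>{1..<n}. \<nu> j x) *s \<Phi> n x - V x) < e"
    proof eventually_elim
      case (elim n)
      show ?case
      proof
        fix x assume x: "x \<in> K"
        have "inverse (P n x) *s \<Phi> n x = \<phi> n x"
          using elim(2) P_nz[OF x] by (simp add: \<Phi>_def vec_eq_iff)
        then show "norm (inverse (\<Prod>j\<in>{1..<n}. \<nu> j x) *s \<Phi> n x - V x) < e"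
          using elim(1) x by (simp add: P_def \<phi>_def V_def)
      qed
    qed
  qed simp
  moreover have "\<forall>x\<in>K. is_eigenvector (A x) (\<eta> x) (V x)"
  proof
    fix x assume x: "x \<in> K"
    have row: "A x $ i $ 1 * v\<^sub>1 x + A x $ i $ 2 * v\<^sub>2 x = \<eta> x * w x"
      if "unif_conv K g w" "\<forall>\<^sub>F n in sequentially. \<forall>x\<in>K.
        M n x $ i $ 1 * f\<^sub>1 n x + M n x $ i $ 2 * f\<^sub>2 n x = \<mu> n x * g (Suc n) x" for i g w
    proof (rule unif_conv_limit_unique[OF _ _ x])
      show "unif_conv K (\<lambda>n x. M n x $ i $ 1 * f\<^sub>1 n x + M n x $ i $ 2 * f\<^sub>2 n x)
          (\<lambda>x. A x $ i $ 1 * v\<^sub>1 x + A x $ i $ 2 * v\<^sub>2 x)"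
        by (intro unif_conv_add unif_conv_mult K M f)
      show "unif_conv K (\<lambda>n x. M n x $ i $ 1 * f\<^sub>1 n x + M n x $ i $ 2 * f\<^sub>2 n x) (\<lambda>x. \<eta> x * w x)"
        by (rule unif_conv_cong[OF that(2) refl unif_conv_mult[OF K \<mu> unif_conv_Suc[OF that(1)]]])
    qed
    have rel1: "\<forall>\<^sub>F n in sequentially. \<forall>x\<in>K. M n x $ 1 $ 1 * f\<^sub>1 n x + M n x $ 1 $ 2 * f\<^sub>2 n x = \<mu> n x * f\<^sub>1 (Suc n) x"
      and rel2: "\<forall>\<^sub>F n in sequentially. \<forall>x\<in>K. M n x $ 2 $ 1 * f\<^sub>1 n x + M n x $ 2 $ 2 * f\<^sub>2 n x = \<mu> n x * f\<^sub>2 (Suc n) x"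
      using rel by (auto elim: eventually_mono)
    show "is_eigenvector (A x) (\<eta> x) (V x)"
      unfolding is_eigenvector_def using row[OF f(1) rel1] row[OF f(2) rel2] v x
      by (auto simp: V_def matrix_vector_mult_2 scalar_mult_vec2 vec_eq_iff forall_2)
  qed
  ultimately show ?thesis by blast
qed

lemma eigenvalue_characteristic_equation:
  fixes A :: "real^2^2"
  assumes "is_eigenvalue (cmat A) c"
  shows "c * c - complex_of_real (trace A) * c + complex_of_real (det A) = 0"
proof -
  obtain v where v: "v \<noteq> 0" "cmat A *v v = c *s v"
    using assms by (auto simp: is_eigenvalue_def is_eigenvector_def)
  define p q r s where "p = complex_of_real (A $ 1 $ 1)" "q = complex_of_real (A $ 1 $ 2)"
    "r = complex_of_real (A $ 2 $ 1)" "s = complex_of_real (A $ 2 $ 2)"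
  have "p * v $ 1 + q * v $ 2 = c * v $ 1" "r * v $ 1 + s * v $ 2 = c * v $ 2"
    using v(2) by (simp_all add: vec_eq_iff forall_2 matrix_vector_mult_def sum_2 map_matrix_def p_q_r_s_def)
  then have "(c * c - (p + s) * c + (p * s - q * r)) * v $ 1 = 0"
    "(c * c - (p + s) * c + (p * s - q * r)) * v $ 2 = 0" by algebra+
  moreover have "v $ 1 \<noteq> 0 \<or> v $ 2 \<noteq> 0" using v(1) by (auto simp: vec_eq_iff forall_2)
  ultimately have "c * c - (p + s) * c + (p * s - q * r) = 0" by auto
  then show ?thesis by (simp add: p_q_r_s_def trace_def sum_2 det_2)
qed

text \<open>A positive discriminant makes the two roots real and distinct, and a positive product gives them
  the same sign.\<close>

lemma hyperbolic_eigenvalue_moduli: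
  fixes c c' :: complex and t d :: real
  assumes "c + c' = complex_of_real t" "c * c' = complex_of_real d" "d > 0" "t\<^sup>2 - 4 * d > 0"
  shows "cmod c \<noteq> cmod c'"
proof -
  have "(c - c') * (c - c') = (c + c') * (c + c') - 4 * (c * c')" by (simp add: algebra_simps)
  then have sq: "(c - c') * (c - c') = complex_of_real (t\<^sup>2 - 4 * d)"
    unfolding assms(1,2) by (simp add: power2_eq_square)
  have "Im (c - c') = 0"
  proof (rule ccontr)
    assume "Im (c - c') \<noteq> 0"
    moreover have "2 * Re (c - c') * Im (c - c') = 0" using arg_cong[OF sq, of Im] by auto
    ultimately have "Re (c - c') = 0" by simp
    then have "Re ((c - c') * (c - c')) \<le> 0" by simp
    with assms(4) show False unfolding sq by simp
  qed
  moreover have "Im (c + c') = 0" unfolding assms(1) by simp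
  ultimately have "Im c = 0" "Im c' = 0" by simp_all
  then have c: "c = complex_of_real (Re c)" "c' = complex_of_real (Re c')" by (simp_all add: complex_eq_iff)
  have prod: "Re c * Re c' > 0" using arg_cong[OF assms(2), of Re] assms(3) \<open>Im c = 0\<close> by simp
  have ne: "Re c \<noteq> Re c'"
  proof
    assume "Re c = Re c'"
    then have "c = c'" using c by metis
    then have "complex_of_real (t\<^sup>2 - 4 * d) = 0" unfolding sq[symmetric] by simp
    with assms(4) show False unfolding of_real_eq_0_iff by simp
  qed
  have "\<bar>Re c\<bar> \<noteq> \<bar>Re c'\<bar>"
  proof
    assume "\<bar>Re c\<bar> = \<bar>Re c'\<bar>"
    then have "Re c = - Re c'" using ne by (auto simp: abs_eq_iff)
    with prod show False by (simp add: mult_less_0_iff zero_less_mult_iff)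
  qed
  then show ?thesis using c by (metis norm_of_real)
qed

section \<open>The asymptotics\<close>

(* If some factor X n + E n is singular, the recurrence can only hold from some index N on:
   for E 1 = - X 1 it would otherwise force v = 0. *)
theorem theorem4p1:
  fixes X :: "nat \<Rightarrow> real \<Rightarrow> real^2^2"
    and E :: "nat \<Rightarrow> real \<Rightarrow> complex^2^2"
    and \<X> :: "real \<Rightarrow> real^2^2"
    and K :: "real set"
    and \<eta> :: "real \<Rightarrow> complex"
    and r :: nat
  assumes "compact K"
    and "\<And>n. n \<ge> 1 \<Longrightarrow> continuous_on UNIV (X n)"
    and "\<And>n x. n \<ge> 1 \<Longrightarrow> invertible (X n x)"
    and "uniform_limit K X \<X> sequentially"
    and "\<And>x. x \<in> K \<Longrightarrow> discr (\<X> x) \<noteq> 0"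
    and "\<And>x. x \<in> K \<Longrightarrow> det (\<X> x) > 0"
    and "(\<forall>x\<in>K. discr (\<X> x) > 0) \<Longrightarrow>
      \<exists>l\<^sub>1 l\<^sub>2. continuous_eigenvalue K \<X> l\<^sub>1 \<and> continuous_eigenvalue K \<X> l\<^sub>2 \<and>
        (\<forall>x\<in>K. cmod (complex_of_real (\<X> x $ 1 $ 1) - l\<^sub>1 x) > 0 \<and>
               cmod (complex_of_real (\<X> x $ 2 $ 2) - l\<^sub>2 x) > 0)"
    and "\<And>n. n \<ge> 1 \<Longrightarrow> continuous_on UNIV (E n)"
    and "summable (\<lambda>n. sup_on K (\<lambda>x. opnorm (E (Suc n) x)))"
    and "r \<ge> 1"
    and "D_r0_GL2 r K X"
    and "continuous_eigenvalue K \<X> \<eta>"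
  shows "\<exists>(\<Phi> :: nat \<Rightarrow> real \<Rightarrow> complex^2) (\<mu> :: nat \<Rightarrow> real \<Rightarrow> complex) (v :: real \<Rightarrow> complex^2) (N :: nat).
    (\<forall>n\<ge>1. continuous_on K (\<Phi> n)) \<and>
    (\<forall>n\<ge>1. continuous_on K (\<mu> n) \<and> (\<forall>x\<in>K. \<mu> n x \<noteq> 0)) \<and>
    continuous_on K v \<and>
    N \<ge> 1 \<and>
    ((\<forall>n\<ge>1. \<forall>x\<in>K. invertible (cmat (X n x) + E n x)) \<longrightarrow> N = 1) \<and>
    (\<forall>n\<ge>N. \<forall>x\<in>K. \<Phi> (Suc n) x = (cmat (X n x) + E n x) *v \<Phi> n x) \<and>
    (\<lambda>n. sup_on K (\<lambda>x. cmod (\<mu> n x - \<eta> x))) \<longlonglongrightarrow> 0 \<and>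
    (\<lambda>n. sup_on K (\<lambda>x. norm (inverse (\<Prod>j\<in>{1..<n}. \<mu> j x) *s \<Phi> n x - v x))) \<longlonglongrightarrow> 0 \<and>
    (\<forall>x\<in>K. is_eigenvector (cmat (\<X> x)) (\<eta> x) (v x))"
proof -
  note K = assms(1)
  have r: "Suc (r - 1) = r" using assms(10) by simp
  have X: "unif_conv K (\<lambda>n x. X n x $ i $ j) (\<lambda>x. \<X> x $ i $ j)" for i j
  proof -
    have "uniform_limit K (\<lambda>n x. X n x $ i $ j) (\<lambda>x. \<X> x $ i $ j) sequentially"
      using bounded_linear.uniform_limit[OF bounded_linear_compose[OF bounded_linear_vec_nth bounded_linear_vec_nth] assms(4)] .
    moreover have "\<forall>\<^sub>F n in sequentially. continuous_on K (\<lambda>x. X n x $ i $ j)"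
      using eventually_ge_at_top[of 1]
      by eventually_elim (use assms(2) in \<open>auto intro!: continuous_intros intro: continuous_on_subset\<close>)
    ultimately show ?thesis by (simp add: unif_conv_def)
  qed
  have Xc: "unif_conv K (\<lambda>n x. cmat (X n x) $ i $ j) (\<lambda>x. cmat (\<X> x) $ i $ j)" for i j
    using unif_conv_of_real[OF X] by (simp add: map_matrix_def)
  define \<epsilon> where "\<epsilon> n = (if n = 0 then 0 else sup_on K (\<lambda>x. opnorm (E n x)))" for n
  have E_le: "cmod (E n x $ i $ j) \<le> \<epsilon> n" if "n \<ge> 1" "x \<in> K" for n x i j
    using norm_entry_le_sup_on[OF K continuous_on_subset[OF assms(8)] that(2), of n i j] that(1) by (simp add: \<epsilon>_def)
  have \<epsilon>: "0 \<le> \<epsilon> n" for n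
  proof (cases "n = 0 \<or> K = {}")
    case True
    then show ?thesis by (auto simp: \<epsilon>_def sup_on_def)
  next
    case False
    then obtain x where "x \<in> K" by blast
    then have "cmod (E n x $ 1 $ 1) \<le> \<epsilon> n" using False by (intro E_le) auto
    then show ?thesis using norm_ge_zero order_trans by blast
  qed
  have \<epsilon>_summable: "summable \<epsilon>"
    by (subst summable_Suc_iff[symmetric]) (use assms(9) in \<open>simp add: \<epsilon>_def\<close>)
  have E_dom: "dominated K \<epsilon> (\<lambda>n x. E n x $ i $ j)" for i j
  proof (rule dominatedI[where C = 1])
    show "\<forall>\<^sub>F n in sequentially. \<forall>x\<in>K. cmod (E n x $ i $ j) \<le> 1 * \<epsilon> n"
      using eventually_ge_at_top[of 1] by eventually_elim (simp add: E_le)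
  qed
  have E: "unif_conv K (\<lambda>n x. E n x $ i $ j) (\<lambda>_. 0)" for i j
  proof -
    have "uniform_limit K (\<lambda>n x. E n x $ i $ j) (\<lambda>_. 0) sequentially"
      by (rule dominated_imp_uniform_limit_0[OF E_dom summable_LIMSEQ_zero[OF \<epsilon>_summable] \<epsilon>])
    moreover have "\<forall>\<^sub>F n in sequentially. continuous_on K (\<lambda>x. E n x $ i $ j)"
      using eventually_ge_at_top[of 1]
      by eventually_elim (use assms(8) in \<open>auto intro!: continuous_intros intro: continuous_on_subset\<close>)
    ultimately show ?thesis by (simp add: unif_conv_def)
  qed
  let ?M = "\<lambda>n x. cmat (X n x) + E n x"
  have M: "unif_conv K (\<lambda>n x. ?M n x $ i $ j) (\<lambda>x. cmat (\<X> x) $ i $ j)" for i j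
    using unif_conv_add[OF Xc[of i j] E[of i j]] by simp
  have M_cont: "continuous_on K (?M n)" if "n \<ge> 1" for n
  proof -
    have "continuous_on K (\<lambda>x. \<chi> i j. complex_of_real (X n x $ i $ j) + E n x $ i $ j)"
      using continuous_on_subset[OF assms(2)[OF that], of K] continuous_on_subset[OF assms(8)[OF that], of K]
      by (intro continuous_intros) auto
    moreover have "?M n = (\<lambda>x. \<chi> i j. complex_of_real (X n x $ i $ j) + E n x $ i $ j)"
      by (simp add: fun_eq_iff vec_eq_iff map_matrix_def)
    ultimately show ?thesis by (simp only:)
  qed

  have \<eta>: "continuous_on K \<eta>" and eig: "\<And>x. x \<in> K \<Longrightarrow> is_eigenvalue (cmat (\<X> x)) (\<eta> x)"
    using assms(12) by (auto simp: continuous_eigenvalue_def)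
  note char = eigenvalue_characteristic_equation[OF eig]
  note X_cont = X[THEN unif_conv_continuous_limit]
  have tr_cont: "continuous_on K (\<lambda>x. trace (\<X> x))"
    unfolding trace_def sum_2 by (intro continuous_intros X_cont)
  have discr_cont: "continuous_on K (\<lambda>x. discr (\<X> x))"
    unfolding discr_def trace_def sum_2 det_2 by (intro continuous_intros X_cont)
  define \<eta>' where "\<eta>' x = complex_of_real (trace (\<X> x)) - \<eta> x" for x
  have \<eta>': "continuous_on K \<eta>'" unfolding \<eta>'_def by (intro continuous_intros \<eta> tr_cont)
  have vieta: "\<eta> x + \<eta>' x = complex_of_real (trace (\<X> x))" "\<eta> x * \<eta>' x = complex_of_real (det (\<X> x))"
    if "x \<in> K" for x
    using char[OF that] by (simp_all add: \<eta>'_def algebra_simps)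
  have \<eta>_nz: "\<eta> x \<noteq> 0" if "x \<in> K" for x
    using vieta(2)[OF that] assms(6)[OF that] by auto
  have moduli: "cmod (\<eta> x) \<noteq> cmod (\<eta>' x)" if "x \<in> K" "discr (\<X> x) > 0" for x
    using hyperbolic_eigenvalue_moduli[OF vieta[OF that(1)] assms(6)[OF that(1)]] that(2) by (simp add: discr_def)

  \<comment> \<open>The weak inequalities make the three pieces closed; they are in fact strict, because the
    discriminant does not vanish and the moduli differ wherever it is positive.\<close>
  define K\<^sub>1 where "K\<^sub>1 = {x\<in>K. discr (\<X> x) \<le> 0}"
  define K\<^sub>2 where "K\<^sub>2 = {x\<in>K. discr (\<X> x) \<ge> 0} \<inter> {x\<in>K. cmod (\<eta> x) \<le> cmod (\<eta>' x)}"
  define K\<^sub>3 where "K\<^sub>3 = {x\<in>K. discr (\<X> x) \<ge> 0} \<inter> {x\<in>K. cmod (\<eta>' x) \<le> cmod (\<eta> x)}"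
  note Kc = compact_imp_closed[OF K]
  have closed: "closed K\<^sub>1" "closed K\<^sub>2" "closed K\<^sub>3"
    unfolding K\<^sub>1_def K\<^sub>2_def K\<^sub>3_def
    by (intro closed_Int continuous_on_closed_Collect_le Kc discr_cont continuous_intros \<eta> \<eta>')+
  have cover: "K = K\<^sub>1 \<union> (K\<^sub>2 \<union> K\<^sub>3)" unfolding K\<^sub>1_def K\<^sub>2_def K\<^sub>3_def by auto
  have sub: "K\<^sub>1 \<subseteq> K" "K\<^sub>2 \<subseteq> K" "K\<^sub>3 \<subseteq> K" using cover by auto
  have compact: "compact K\<^sub>1" "compact K\<^sub>2" "compact K\<^sub>3"
    using compact_Int_closed[OF K] closed sub by (metis inf.absorb_iff2)+
  have K1: "discr (\<X> x) < 0" if "x \<in> K\<^sub>1" for x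
    using that assms(5)[of x] by (auto simp: K\<^sub>1_def)
  have K2: "discr (\<X> x) > 0" "cmod (\<eta> x) < cmod (\<eta>' x)" if "x \<in> K\<^sub>2" for x
    using that assms(5)[of x] moduli[of x] by (auto simp: K\<^sub>2_def)
  have K3: "discr (\<X> x) > 0" "cmod (\<eta>' x) < cmod (\<eta> x)" if "x \<in> K\<^sub>3" for x
    using that assms(5)[of x] moduli[of x] by (auto simp: K\<^sub>3_def)
  have disjoint: "K\<^sub>1 \<inter> (K\<^sub>2 \<union> K\<^sub>3) = {}" "K\<^sub>2 \<inter> K\<^sub>3 = {}"
    using K1 K2 K3 by (force dest: less_asym)+

  have hyp: "has_direction L ?M \<eta>"
    if L: "compact L" "L \<subseteq> K" "\<And>x. x \<in> L \<Longrightarrow> discr (\<X> x) > 0"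
      "(\<forall>x\<in>L. cmod (\<eta> x) < cmod (\<eta>' x)) \<or> (\<forall>x\<in>L. cmod (\<eta>' x) < cmod (\<eta> x))" for L
  proof (rule has_direction_hyperbolic[OF L(1) unif_conv_subset[OF M L(2)] L(3)
        continuous_on_subset[OF \<eta> L(2)] continuous_on_subset[OF \<eta>' L(2)] _ _ _ L(4)])
    fix x assume "x \<in> L"
    then have x: "x \<in> K" using L(2) by blast
    show "\<eta> x + \<eta>' x = complex_of_real (trace (\<X> x))" "\<eta> x * \<eta>' x = complex_of_real (det (\<X> x))"
      "det (\<X> x) \<noteq> 0" using vieta[OF x] assms(6)[OF x] by auto
  qed
  have ell: "has_direction K\<^sub>1 ?M \<eta>"
  proof -
    let ?D = "\<lambda>j n. sup_on K (\<lambda>x. opnorm (fdiff j X n x))"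
    have "summable (\<lambda>n. ?D j (Suc n) powr (real r / real j))" if "j \<in> {1..r}" for j
      using assms(11) that by (simp add: D_r0_GL2_def D_r0_def)
    then obtain \<rho> where \<rho>: "\<And>n. 0 \<le> \<rho> n" "\<And>n. \<rho> (Suc n) \<le> 2 * \<rho> n" "\<rho> \<longlonglongrightarrow> 0"
      "summable (\<lambda>n. \<rho> n ^ r)" "\<And>j n. j \<in> {1..r} \<Longrightarrow> ?D j n \<le> \<rho> n ^ j"
      using weight_exists[OF assms(10), of ?D] by blast
    interpret weight_sequence K\<^sub>1 \<rho> by unfold_locales (use compact(1) \<rho> in auto)
    show ?thesis
    proof (rule has_direction_elliptic[of X \<X> "r - 1" E \<epsilon> \<eta>, unfolded r])
      fix j n x and i l :: 2 assume j: "j \<in> {1..r}" and n: "(1::nat) \<le> n" and x: "x \<in> K\<^sub>1"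
      have "continuous_on K (fdiff j X n)"
        by (rule continuous_on_fdiff[OF _ n]) (use assms(2) continuous_on_subset in blast)
      from norm_entry_le_sup_on[OF K this, of x i l] x sub(1) \<rho>(5)[OF j, of n]
      show "\<bar>fdiff j X n x $ i $ l\<bar> \<le> \<rho> n ^ j" by auto
    next
      fix x assume "x \<in> K\<^sub>1"
      then show "\<eta> x * \<eta> x - complex_of_real (trace (\<X> x)) * \<eta> x + complex_of_real (det (\<X> x)) = 0"
        using char[of x] sub(1) by blast
      show "discr (\<X> x) < 0" using K1[OF \<open>x \<in> K\<^sub>1\<close>] .
    next
      show "dominated K\<^sub>1 \<epsilon> (\<lambda>n x. E n x $ i $ j)" for i j
        by (rule dominated_subset[OF E_dom sub(1)])
    qed (use \<rho>(4) unif_conv_subset[OF X sub(1)] unif_conv_subset[OF E sub(1)] \<epsilon> \<epsilon>_summable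
        continuous_on_subset[OF \<eta> sub(1)] in auto)
  qed
  have "has_direction (K\<^sub>2 \<union> K\<^sub>3) ?M \<eta>"
    using hyp[OF compact(2) sub(2)] hyp[OF compact(3) sub(3)] K2 K3
    by (intro has_direction_glue closed disjoint) auto
  then have "has_direction K ?M \<eta>"
    using has_direction_glue[OF closed(1) closed_Un[OF closed(2,3)] disjoint(1) ell] cover by simp
  from solution_from_direction[OF K M_cont M \<eta>_nz this] show ?thesis by blast
qed

end
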